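(* Let $d\geqslant 1$ and let $(\mathbf{X}_k)_{k\geqslant 0}$ be a $d$-type Galton-Watson process with offspring distributions $p_1,\ldots,p_d$, satisfying assumption $(A_1)$ (stated in the context). Assume in addition that: $(A_4)$ there exists $\mathbf{a}>\mathbf{0}$ such that the associated process with respect to $\mathbf{a}$ is critical; $(A_5)$ for each $j=1,\ldots,d$ there exist $i\in\{1,\ldots,d\}$ and $\mathbf{k}\in\mathbb{N}^d$ such that $p_i(\mathbf{k})>0$ and $p_i(\mathbf{k}+\mathbf{e}_j)>0$; $(A_6)$ the associated process with respect to $\mathbf{a}$ admits moments of order $d+1$ (i.e. its offspring distributions $\overline{p}_1,\ldots,\overline{p}_d$ have finite moments of order $d+1$), and the covariance matrices of its offspring distributions are positive-definite. Let $(\overline{\mathbf{X}}_k)_{k\geqslant 0}$ be the associated process with respect to $\mathbf{a}$, let $\overline{\mathbf{u}},\overline{\mathbf{v}}$ be the normalized right and left Perron eigenvectors of its mean matrix (for the eigenvalue $1$), and let $\mathbf{N}=\sum_{k=0}^{+\infty}\mathbf{X}_k$ be the total progeny of $(\mathbf{X}_k)_{k\geqslant 0}$. Then for all $\mathbf{x}_0\in\mathbb{N}^d\setminus\{\mathbf{0}\}$, all integers $j\geqslant 1$, all $k_1\leqslant\ldots\leqslant k_j$ in $\mathbb{N}$ and all $\mathbf{x}_1,\ldots,\mathbf{x}_j\in\mathbb{N}^d$, $$\lim_{n\to+\infty}\mathbb{P}_{\mathbf{x}_0}\big(\mathbf{X}_{k_1}=\mathbf{x}_1,\ldots,\mathbf{X}_{k_j}=\mathbf{x}_j\mid\mathbf{N}=\lfloor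 n\overline{\mathbf{v}}\rfloor\big)=\frac{\mathbf{x}_j\cdot\overline{\mathbf{u}}}{\mathbf{x}_0\cdot\overline{\mathbf{u}}}\,\mathbb{P}_{\mathbf{x}_0}\big(\overline{\mathbf{X}}_{k_1}=\mathbf{x}_1,\ldots,\overline{\mathbf{X}}_{k_j}=\mathbf{x}_j\big).$$
   Context: Notation. $\mathbb{N}=\{0,1,2,\ldots\}$; vectors $\mathbf{x}=(x_1,\ldots,x_d)$; $\mathbf{e}_i$ is the $i$-th unit vector; $\mathbf{0}=(0,\ldots,0)$, $\mathbf{1}=(1,\ldots,1)$; $\mathbf{x}\mathbf{y}$ is the vector with coordinates $x_iy_i$; $\lfloor\mathbf{x}\rfloor$ is the vector with coordinates $\lfloor x_i\rfloor$ (integer part); $\mathbf{x}^{\mathbf{y}}=\prod_{i}x_i^{y_i}$; $\mathbf{x}\cdot\mathbf{y}$ is the scalar product; $\mathbf{x}<\mathbf{y}$ means $x_i<y_i$ for every $i$. A $d$-type Galton-Watson process $(\mathbf{X}_k)_{k\geqslant 0}$ is the Markov chain on $\mathbb{N}^d$ in which, at each generation, every individual of type $i$ independently produces a random offspring vector with law $p_i$ on $\mathbb{N}^d$, and $\mathbf{X}_{k+1}$ is the sum of the offspring vectors of the individuals counted by $\mathbf{X}_k$. The subscript in $\mathbb{P}_{\mathbf{x}},\mathbb{E}_{\mathbf{x}}$ denotes the initial state $\mathbf{X}_0=\mathbf{x}$; $X_{k,j}$ is the $j$-th coordinate of $\mathbf{X}_k$. The offspring generating function is $\mathbf{f}=(f_1,\ldots,f_d)$,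 $f_i(\mathbf{r})=\sum_{\mathbf{k}\in\mathbb{N}^d}p_i(\mathbf{k})\mathbf{r}^{\mathbf{k}}$. The mean matrix is $\mathbf{M}=(m_{ij})_{1\leqslant i,j\leqslant d}$ with $m_{ij}=\mathbb{E}_{\mathbf{e}_i}(X_{1,j})$. $\rho$ denotes the Perron root of $\mathbf{M}$, and $\mathbf{u},\mathbf{v}$ the associated right and left (positive) eigenvectors, $\mathbf{M}\mathbf{u}^T=\rho\mathbf{u}^T$, $\mathbf{v}\mathbf{M}=\rho\mathbf{v}$, normalized by $\mathbf{u}\cdot\mathbf{1}=\mathbf{u}\cdot\mathbf{v}=1$. The process is critical if $\rho=1$. The extinction time is $T=\inf\{k\in\mathbb{N}:\mathbf{X}_k=\mathbf{0}\}$, and the extinction probability vector is $\mathbf{q}=(q_1,\ldots,q_d)$, $q_i=\mathbb{P}_{\mathbf{e}_i}(T<+\infty)$. Assumption $(A_1)$: $\mathbf{M}$ has finite entries; the process is nonsingular (the function $\mathbf{f}$ is not identically equal to $\mathbf{r}\mapsto\mathbf{M}\mathbf{r}$) and positive regular (there is $n\geqslant 1$ such that every entry of $\mathbf{M}^n$ is positive); and $\mathbf{q}>\mathbf{0}$. Associated process. For a vector $\mathbf{a}>\mathbf{0}$ with $f_i(\mathbf{a})=\sum_{\mathbf{k}}p_i(\mathbf{k})\mathbf{a}^{\mathbf{k}}<+\infty$ for every $i$ (this is part of the meaning of "associated process with respect to $\mathbf{a}$"), the associated process with respect to $\mathbf{a}$, denoted $(\overline{\mathbf{X}}_k)_{k\geqslant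 0}$, is the $d$-type Galton-Watson process with offspring generating function $\overline{f}_i(\mathbf{r})=f_i(\mathbf{a}\mathbf{r})/f_i(\mathbf{a})$, $\mathbf{r}\in[0,1]^d$, i.e. with offspring distributions $\overline{p}_i(\mathbf{k})=\mathbf{a}^{\mathbf{k}}p_i(\mathbf{k})/f_i(\mathbf{a})$. Quantities relative to it carry an overline (with the same normalization $\overline{\mathbf{u}}\cdot\mathbf{1}=\overline{\mathbf{u}}\cdot\overline{\mathbf{v}}=1$). Total progeny. $\mathbf{N}=(N_1,\ldots,N_d)$ with $N_i=\sum_{k=0}^{+\infty}X_{k,i}\in\mathbb{N}\cup\{+\infty\}$. *)

theory Defs
  imports "HOL-Probability.Probability"
begin

definition real_vec :: "nat ^ 'd \<Rightarrow> real ^ 'd" where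
  "real_vec x = (\<chi> i. real (x $ i))"

definition monom_vec :: "real ^ 'd \<Rightarrow> nat ^ 'd \<Rightarrow> real" where
  "monom_vec r k = (\<Prod>i\<in>UNIV. (r $ i) ^ (k $ i))"

text \<open>Integer part of a vector with nonnegative coordinates.\<close>

definition floor_vec :: "real ^ 'd \<Rightarrow> nat ^ 'd" where
  "floor_vec x = (\<chi> i. nat \<lfloor>x $ i\<rfloor>)"

text \<open>
  Powers for the matrix product; the library's \<open>^\<close> on this type is coordinatewise.
\<close>

primrec mat_power :: "real ^ 'd ^ 'd \<Rightarrow> nat \<Rightarrow> real ^ 'd ^ 'd" where
  "mat_power A 0 = mat 1"
| "mat_power A (Suc n) = A ** mat_power A n"

definition complex_eigenvalue :: "real ^ 'd ^ 'd \<Rightarrow> complex \<Rightarrow> bool" where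
  "complex_eigenvalue A z \<longleftrightarrow>
     (\<exists>w. w \<noteq> 0 \<and> (\<chi> i j. complex_of_real (A $ i $ j)) *v w = z *s w)"

definition perron_root :: "real ^ 'd ^ 'd \<Rightarrow> real \<Rightarrow> bool" where
  "perron_root A \<rho> \<longleftrightarrow>
     complex_eigenvalue A (complex_of_real \<rho>) \<and>
     (\<forall>z. complex_eigenvalue A z \<longrightarrow> cmod z \<le> \<rho>)"

definition perron_eigenvectors ::
    "real ^ 'd ^ 'd \<Rightarrow> real \<Rightarrow> real ^ 'd \<Rightarrow> real ^ 'd \<Rightarrow> bool" where
  "perron_eigenvectors A \<rho> u v \<longleftrightarrow>
     (\<forall>i. u $ i > 0) \<and> (\<forall>i. v $ i > 0) \<and>
     A *v u = \<rho> *\<^sub>R u \<and> v v* A = \<rho> *\<^sub>R v \<and>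
     u \<bullet> 1 = 1 \<and> u \<bullet> v = 1"

definition positive_definite :: "real ^ 'd ^ 'd \<Rightarrow> bool" where
  "positive_definite A \<longleftrightarrow> transpose A = A \<and> (\<forall>x. x \<noteq> 0 \<longrightarrow> x \<bullet> (A *v x) > 0)"


subsection \<open>Offspring distributions\<close>

text \<open>
  The individuals of a population \<open>x\<close> are labelled \<open>(i, l)\<close> with \<open>i\<close> a type and \<open>l < x $ i\<close>.
  Under the product distribution \<open>Pi_pmf\<close> they have independent offspring vectors, of law
  \<open>p i\<close> for an individual of type \<open>i\<close>.
\<close>

definition individuals :: "nat ^ 'd \<Rightarrow> ('d \<times> nat) set" where
  "individuals x = (SIGMA i:UNIV. {..<x $ i})"

definition next_generation :: "('d \<Rightarrow> (nat ^ 'd) pmf) \<Rightarrow> nat ^ 'd \<Rightarrow> (nat ^ 'd) pmf" where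
  "next_generation p x =
     map_pmf (\<lambda>Y. \<Sum>s\<in>individuals x. Y s) (Pi_pmf (individuals x) 0 (\<lambda>(i, l). p i))"

definition gen_fun :: "('d \<Rightarrow> (nat ^ 'd) pmf) \<Rightarrow> real ^ 'd \<Rightarrow> real ^ 'd" where
  "gen_fun p r = (\<chi> i. \<Sum>\<^sub>\<infinity>k. pmf (p i) k * monom_vec r k)"

definition gen_fun_finite :: "('d \<Rightarrow> (nat ^ 'd) pmf) \<Rightarrow> real ^ 'd \<Rightarrow> bool" where
  "gen_fun_finite p r \<longleftrightarrow> (\<forall>i. (\<lambda>k. pmf (p i) k * monom_vec r k) summable_on UNIV)"

text \<open>
  Only meaningful for \<open>a\<close> with positive coordinates and \<open>gen_fun_finite p a\<close>, when the
  argument of \<open>embed_pmf\<close> is a probability mass function.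
\<close>

definition associated :: "('d \<Rightarrow> (nat ^ 'd) pmf) \<Rightarrow> real ^ 'd \<Rightarrow> 'd \<Rightarrow> (nat ^ 'd) pmf" where
  "associated p a i = embed_pmf (\<lambda>k. monom_vec a k * pmf (p i) k / gen_fun p a $ i)"

definition finite_moments :: "nat \<Rightarrow> (nat ^ 'd) pmf \<Rightarrow> bool" where
  "finite_moments m D \<longleftrightarrow> integrable (measure_pmf D) (\<lambda>k. norm (real_vec k) ^ m)"

definition covariance_matrix :: "(nat ^ 'd) pmf \<Rightarrow> real ^ 'd ^ 'd" where
  "covariance_matrix D = (\<chi> j l. measure_pmf.expectation D (\<lambda>k.
     (real (k $ j) - measure_pmf.expectation D (\<lambda>k'. real (k' $ j))) *
     (real (k $ l) - measure_pmf.expectation D (\<lambda>k'. real (k' $ l)))))"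

lemma associated_pmf:
  fixes p :: "'d::finite \<Rightarrow> (nat ^ 'd) pmf"
  assumes a: "\<And>i. a $ i > 0" and fin: "gen_fun_finite p a"
  shows "pmf (associated p a i) k = monom_vec a k * pmf (p i) k / gen_fun p a $ i"
proof -
  let ?g = "\<lambda>k. pmf (p i) k * monom_vec a k"
  have mpos: "monom_vec a k > 0" for k
    unfolding monom_vec_def by (intro prod_pos ballI zero_less_power a)
  have g0: "?g k \<ge> 0" for k using mpos[of k] by simp
  have summ: "?g summable_on UNIV" using fin by (simp add: gen_fun_finite_def)
  have F: "gen_fun p a $ i = infsum ?g UNIV" by (simp add: gen_fun_def)
  obtain k0 where k0: "pmf (p i) k0 > 0"
    using set_pmf_not_empty[of "p i"] pmf_positive by fast
  have "sum ?g {k0} \<le> infsum ?g UNIV"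
    by (rule finite_sum_le_infsum) (use summ g0 in auto)
  moreover have "?g k0 > 0" using k0 mpos[of k0] by simp
  ultimately have Fpos: "gen_fun p a $ i > 0" unfolding F by simp
  have abs: "Infinite_Set_Sum.abs_summable_on ?g UNIV"
    by (rule abs_summable_equivalent[THEN iffD1,
          OF summable_on_iff_abs_summable_on_real[THEN iffD1, OF summ]])
  then have int: "integrable (count_space UNIV) ?g"
    unfolding abs_summable_on_def .
  have "infsum ?g UNIV = (\<integral>k. ?g k \<partial>count_space UNIV)"
    using infsetsum_infsum[OF abs] unfolding infsetsum_def by simp
  then have nn: "(\<integral>\<^sup>+k. ennreal (?g k) \<partial>count_space UNIV) = ennreal (gen_fun p a $ i)"
    using nn_integral_eq_integral[OF int] g0 F by simp
  have eq: "ennreal (monom_vec a k * pmf (p i) k / gen_fun p a $ i) =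
      ennreal (?g k) / ennreal (gen_fun p a $ i)" for k
    using divide_ennreal[OF g0 Fpos, of k] by (simp only: mult.commute)
  have "(\<integral>\<^sup>+k. ennreal (monom_vec a k * pmf (p i) k / gen_fun p a $ i) \<partial>count_space UNIV) =
      (\<integral>\<^sup>+k. ennreal (?g k) \<partial>count_space UNIV) / ennreal (gen_fun p a $ i)"
    unfolding eq by (rule nn_integral_divide) simp
  also have "\<dots> = 1"
    unfolding nn using Fpos by (simp add: ennreal_divide_self)
  finally have one: "(\<integral>\<^sup>+k. ennreal (monom_vec a k * pmf (p i) k / gen_fun p a $ i)
      \<partial>count_space UNIV) = 1" .
  show ?thesis
    unfolding associated_def
    by (rule pmf_embed_pmf[OF _ one]) (use Fpos mpos in \<open>simp add: less_imp_le\<close>)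
qed


subsection \<open>Multitype Galton--Watson processes\<close>

text \<open>
  The measure \<open>P x\<close> is the law of the chain started at \<open>x\<close>. The last assumption is the Markov
  property with transition law \<open>next_generation p\<close>, stated for cylinder events.
\<close>

locale galton_watson =
  fixes p :: "'d::finite \<Rightarrow> (nat ^ 'd) pmf"
    and P :: "nat ^ 'd \<Rightarrow> 'a measure"
    and X :: "nat \<Rightarrow> 'a \<Rightarrow> nat ^ 'd"
  assumes prob_space_P: "prob_space (P x)"
    and measurable_X: "X k \<in> measurable (P x) (count_space UNIV)"
    and start: "AE \<omega> in P x. X 0 \<omega> = x"
    and markov: "\<P>(\<omega> in P x. \<forall>l\<le>Suc k. X l \<omega> = y l) =
      \<P>(\<omega> in P x. \<forall>l\<le>k. X l \<omega> = y l) * pmf (next_generation p (y k)) (y (Suc k))"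

definition finite_means ::
    "(nat ^ 'd \<Rightarrow> 'a measure) \<Rightarrow> (nat \<Rightarrow> 'a \<Rightarrow> nat ^ 'd) \<Rightarrow> bool" where
  "finite_means P X \<longleftrightarrow> (\<forall>i j. integrable (P (axis i 1)) (\<lambda>\<omega>. real (X 1 \<omega> $ j)))"

definition mean_matrix ::
    "(nat ^ 'd \<Rightarrow> 'a measure) \<Rightarrow> (nat \<Rightarrow> 'a \<Rightarrow> nat ^ 'd) \<Rightarrow> real ^ 'd ^ 'd" where
  "mean_matrix P X = (\<chi> i j. \<integral>\<omega>. real (X 1 \<omega> $ j) \<partial>P (axis i 1))"

definition nonsingular ::
    "('d \<Rightarrow> (nat ^ 'd) pmf) \<Rightarrow> (nat ^ 'd \<Rightarrow> 'a measure) \<Rightarrow> (nat \<Rightarrow> 'a \<Rightarrow> nat ^ 'd) \<Rightarrow> bool" where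
  "nonsingular p P X \<longleftrightarrow>
     \<not> (\<forall>r. (\<forall>i. 0 \<le> r $ i \<and> r $ i \<le> 1) \<longrightarrow> gen_fun p r = mean_matrix P X *v r)"

definition positive_regular ::
    "(nat ^ 'd \<Rightarrow> 'a measure) \<Rightarrow> (nat \<Rightarrow> 'a \<Rightarrow> nat ^ 'd) \<Rightarrow> bool" where
  "positive_regular P X \<longleftrightarrow> (\<exists>n\<ge>1. \<forall>i j. mat_power (mean_matrix P X) n $ i $ j > 0)"

definition critical ::
    "(nat ^ 'd \<Rightarrow> 'a measure) \<Rightarrow> (nat \<Rightarrow> 'a \<Rightarrow> nat ^ 'd) \<Rightarrow> bool" where
  "critical P X \<longleftrightarrow> finite_means P X \<and> perron_root (mean_matrix P X) 1"

definition extinction_time :: "(nat \<Rightarrow> 'a \<Rightarrow> nat ^ 'd) \<Rightarrow> 'a \<Rightarrow> enat" where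
  "extinction_time X \<omega> = (INF k\<in>{k. X k \<omega> = 0}. enat k)"

definition extinction_prob ::
    "(nat ^ 'd \<Rightarrow> 'a measure) \<Rightarrow> (nat \<Rightarrow> 'a \<Rightarrow> nat ^ 'd) \<Rightarrow> real ^ 'd" where
  "extinction_prob P X = (\<chi> i. \<P>(\<omega> in P (axis i 1). extinction_time X \<omega> < \<infinity>))"

definition total_progeny :: "(nat \<Rightarrow> 'a \<Rightarrow> nat ^ 'd) \<Rightarrow> 'a \<Rightarrow> enat ^ 'd" where
  "total_progeny X \<omega> = (\<chi> i. \<Sum>k. enat (X k \<omega> $ i))"

end

theory Submission
  imports Defs
begin

text \<open>
  Tilting by \<open>a\<close> multiplies the probability of every family tree with total progeny \<open>m\<close> by a
  constant depending only on \<open>m\<close> and \<open>x\<^sub>0\<close>, so the original process may be replaced by the critical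
  one. There, by the Markov property, the conditional probability of a path \<open>y\<^sub>0, \<dots>, y\<^sub>K\<close> is its
  probability times \<open>g(y\<^sub>K, m - y\<^sub>0 - \<dots> - y\<^sub>K\<^sub>-\<^sub>1) / g(x\<^sub>0, m)\<close>, where \<open>g(x, m)\<close> is the probability that
  \<open>x\<close> has total progeny \<open>m\<close>; since \<open>u\<close> is harmonic, Scheffe's lemma reduces the theorem to
  \<open>n\<^bsup>1 + d/2\<^esup> g(x, m\<^sub>n) \<longrightarrow> L (x \<bullet> u)\<close> for \<open>m\<^sub>n = n v + O(1)\<close>.

  For this, fix a type \<open>\<tau>\<close> and cut the trees at the individuals of type \<open>\<tau>\<close>. What remains is a
  single-type process whose individuals carry the numbers of individuals of the other types as
  marks, and the one-dimensional Otter--Dwass formula expresses \<open>g(x, m)\<close> through the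
  \<open>m\<^sub>\<tau>\<close>-fold convolution of the law of one marked offspring. That law has finite variance because the
  types other than \<open>\<tau>\<close> form a subcritical process, its mean is \<open>v / v\<^sub>\<tau>\<close>, and (A5) makes it
  aperiodic, so the local limit theorem applies.
\<close>

subsection \<open>Formal power series in several variables\<close>

text \<open>An Otter--Dwass formula for all types at once contains a determinant. Singling out one
  type replaces it by the scalar factor \<open>r $ \<tau>\<close>; the price is that the step law
  \<open>excursion\<close> is known only through another branching process, so that its variance,
  mean and aperiodicity have to be derived from the offspring laws.

  The exponent \<open>1 + d/2\<close> has two sources: \<open>d/2\<close> from the local limit
  theorem in dimension \<open>d\<close>, and 1 from the division by \<open>m $ \<tau>\<close>, which
  is of order \<open>n\<close>. The factor \<open>x \<bullet> u\<close> is, up to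
  \<open>u $ \<tau>\<close>, the expected number of individuals of type \<open>\<tau>\<close> at
  which the trees of \<open>x\<close> are cut. Averaging over the cut trees is the reason why the
  local limit theorem comes with a bound uniform in the end point.

  The combinatorial part works with formal coefficients, because nothing is known there about
  finiteness of the total progeny. Subcriticality is never stated by a spectral radius but by a
  positive vector \<open>w\<close> with \<open>w \<ge> 1 + M w\<close>, against which all moments
  are compared.\<close>

lemma finite_atMost_vec: "finite {..m :: nat ^ 'd::finite}"
proof -
  have "{..m} \<subseteq> vec_lambda ` (UNIV \<rightarrow>\<^sub>E {..Max (range (($) m))})"
  proof
    fix k assume "k \<in> {..m}"
    then have "k $ i \<le> Max (range (($) m))" for i
      by (auto simp: less_eq_vec_def intro: order_trans[OF _ Max_ge])
    then show "k \<in> vec_lambda ` (UNIV \<rightarrow>\<^sub>E {..Max (range (($) m))})"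
      by (intro image_eqI[of _ _ "($) k"]) (auto simp: vec_eq_iff)
  qed
  then show ?thesis
    by (rule finite_subset) (intro finite_imageI finite_PiE, auto)
qed

definition size_vec :: "nat ^ 'd::finite \<Rightarrow> nat" where
  "size_vec x = (\<Sum>i\<in>UNIV. x $ i)"

lemma size_vec_zero [simp]: "size_vec 0 = 0"
  by (simp add: size_vec_def)

lemma size_vec_plus [simp]: "size_vec (x + y) = size_vec x + size_vec y"
  by (simp add: size_vec_def sum.distrib)

lemma size_vec_axis [simp]: "size_vec (axis i a) = a"
  by (simp add: size_vec_def axis_def)

lemma size_vec_eq_0_iff [simp]: "size_vec x = 0 \<longleftrightarrow> x = 0"
  by (simp add: size_vec_def vec_eq_iff)

lemma le_size_vec: "x $ i \<le> size_vec x"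
  unfolding size_vec_def by (rule member_le_sum) auto

lemma component_le_size_sq: "real (r $ l) \<le> (real (size_vec r))\<^sup>2"
proof -
  have "r $ l \<le> (size_vec r)\<^sup>2"
    using le_size_vec[of r l] by (simp add: power2_eq_square) (metis le_square le_trans)
  then show ?thesis by (metis of_nat_le_iff of_nat_power)
qed

lemma vec_add_diff_inverse: "x \<le> m \<Longrightarrow> x + (m - x) = (m :: nat ^ 'd::finite)"
  by (simp add: vec_eq_iff less_eq_vec_def)

lemma vec_le_iff_add: "x \<le> m \<longleftrightarrow> (\<exists>y. m = x + (y :: nat ^ 'd::finite))"
  by (metis vec_add_diff_inverse less_eq_vec_def vector_add_component le_add1)

lemma vec_diff_diff_cancel: "k \<le> m \<Longrightarrow> m - (m - k) = (k :: nat ^ 'd::finite)"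
  by (simp add: vec_eq_iff less_eq_vec_def)

lemma vec_diff_le [simp]: "m - k \<le> (m :: nat ^ 'd::finite)"
  by (simp add: less_eq_vec_def)

lemma size_vec_diff: "x \<le> m \<Longrightarrow> size_vec m = size_vec x + size_vec (m - x)"
  by (metis size_vec_plus vec_add_diff_inverse)

lemma axis_le_iff: "axis i (Suc 0) \<le> (m :: nat ^ 'd::finite) \<longleftrightarrow> m $ i \<noteq> 0"
  by (auto simp: less_eq_vec_def axis_def)

lemma zero_le_vec [simp]: "0 \<le> (x :: nat ^ 'd::finite)"
  by (simp add: less_eq_vec_def)

lemma vec_le_zero_iff [simp]: "x \<le> 0 \<longleftrightarrow> x = (0 :: nat ^ 'd::finite)"
  by (simp add: less_eq_vec_def vec_eq_iff)

lemma nat_vec_cases: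
  obtains "x = 0" | i y where "x = y + axis i (1::nat)"
proof (cases "x = 0")
  case False
  then obtain i where "x $ i \<noteq> 0" by (auto simp: vec_eq_iff)
  then have "x = (x - axis i 1) + axis i 1"
    by (auto simp: vec_eq_iff axis_def)
  then show ?thesis using that by blast
qed

lemma nat_vec_induct [case_names zero add_axis]:
  assumes "P 0" and step: "\<And>x i. P x \<Longrightarrow> P (x + axis i (1::nat))"
  shows "P x"
proof (induction "size_vec x" arbitrary: x rule: less_induct)
  case less
  show ?case
  proof (cases x rule: nat_vec_cases)
    case (2 i y)
    with less[of y] have "P y" by simp
    with 2 show ?thesis by (simp only: step)
  qed (use assms in auto)
qed

text \<open>No growth condition is imposed, so identities are checked coefficient by coefficient. A
  type of its own lets the Cauchy product be the \<open>*\<close> of a commutative semiring, with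
  powers and \<open>algebra_simps\<close> at hand.\<close>

typedef (overloaded) ('d::finite) mfps = "UNIV :: (nat ^ 'd \<Rightarrow> real) set"
  morphisms cf Abs_mfps ..

lemma cf_Abs [simp]: "cf (Abs_mfps f) = f"
  by (simp add: Abs_mfps_inverse)

lemma mfps_eqI: "(\<And>m. cf F m = cf G m) \<Longrightarrow> F = G"
  by (simp add: cf_inject[symmetric] fun_eq_iff)

instantiation mfps :: (finite) comm_semiring_1
begin

definition "0 = Abs_mfps (\<lambda>_. 0)"
definition "1 = Abs_mfps (\<lambda>m. if m = 0 then 1 else 0)"
definition "F + G = Abs_mfps (\<lambda>m. cf F m + cf G m)"
definition "F * G = Abs_mfps (\<lambda>m. \<Sum>k\<in>{..m}. cf F k * cf G (m - k))"

text \<open>The pairs \<open>l \<le> k \<le> m\<close> correspond to the pairs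
  \<open>(l, k - l)\<close>. Associativity of the product rests on this, and so does
  \<open>cf_psum_conv\<close>, where a convolution is summed against a family.\<close>

lemma sum_atMost_vec_swap:
  "(\<Sum>k\<in>{..m}. \<Sum>l\<in>{..k}. f l (k - l)) = (\<Sum>l\<in>{..m}. \<Sum>j\<in>{..m - l}. f l (j :: nat ^ 'd::finite) :: real)"
proof -
  have "(\<Sum>k\<in>{..m}. \<Sum>l\<in>{..k}. f l (k - l)) =
      (\<Sum>(k, l)\<in>(SIGMA k:{..m}. {..k}). f l (k - l))"
    by (rule sum.Sigma) (auto simp: finite_atMost_vec)
  also have "\<dots> = (\<Sum>(l, j)\<in>(SIGMA l:{..m}. {..m - l}). f l j)"
    by (rule sum.reindex_bij_witness[of _ "\<lambda>(l, j). (l + j, l)" "\<lambda>(k, l). (l, k - l)"])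
      (auto simp: less_eq_vec_def vec_eq_iff intro: order_trans,
       (metis diff_le_mono le_diff_conv2 add.commute order_trans)+)
  also have "\<dots> = (\<Sum>l\<in>{..m}. \<Sum>j\<in>{..m - l}. f l j)"
    by (rule sum.Sigma[symmetric]) (auto simp: finite_atMost_vec)
  finally show ?thesis .
qed

instance
proof
  fix a b c :: "'a mfps"
  show "a * b * c = a * (b * c)"
  proof (rule mfps_eqI)
    fix m
    have "cf (a * b * c) m = (\<Sum>k\<in>{..m}. \<Sum>l\<in>{..k}. cf a l * cf b (k - l) * cf c (m - (l + (k - l))))"
      unfolding times_mfps_def cf_Abs sum_distrib_right
      by (intro sum.cong refl) (auto simp: vec_add_diff_inverse)
    also have "\<dots> = (\<Sum>l\<in>{..m}. \<Sum>j\<in>{..m - l}. cf a l * cf b j * cf c (m - (l + j)))"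
      by (rule sum_atMost_vec_swap)
    also have "\<dots> = cf (a * (b * c)) m"
      unfolding times_mfps_def cf_Abs sum_distrib_left
      by (intro sum.cong refl) (simp add: mult.assoc diff_diff_add)
    finally show "cf (a * b * c) m = cf (a * (b * c)) m" .
  qed
  show "a * b = b * a"
  proof (rule mfps_eqI)
    fix m
    show "cf (a * b) m = cf (b * a) m"
      unfolding times_mfps_def cf_Abs
      by (rule sum.reindex_bij_witness[of _ "\<lambda>k. m - k" "\<lambda>k. m - k"])
        (auto simp: vec_diff_diff_cancel mult.commute)
  qed
  show "1 * a = a"
  proof (rule mfps_eqI)
    fix m
    have "cf (1 * a) m = (\<Sum>k\<in>{..m}. if k = 0 then cf a m else 0)"
      unfolding times_mfps_def one_mfps_def cf_Abs
      by (intro sum.cong refl) auto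
    then show "cf (1 * a) m = cf a m"
      by (simp add: finite_atMost_vec)
  qed
  show "(a + b) * c = a * c + b * c"
    by (rule mfps_eqI) (simp add: times_mfps_def plus_mfps_def distrib_right sum.distrib)
  have "cf 0 (0 :: nat ^ 'a) \<noteq> cf 1 (0 :: nat ^ 'a)"
    by (simp add: zero_mfps_def one_mfps_def)
  then show "(0 :: 'a mfps) \<noteq> 1" by metis
qed (auto intro!: mfps_eqI simp: zero_mfps_def plus_mfps_def times_mfps_def)

end

lemma cf_plus [simp]: "cf (F + G) m = cf F m + cf G m"
  by (simp add: plus_mfps_def)

lemma cf_zero [simp]: "cf 0 m = 0"
  by (simp add: zero_mfps_def)

lemma cf_one: "cf 1 m = (if m = 0 then 1 else 0)"
  by (simp add: one_mfps_def)

lemma cf_times: "cf (F * G) m = (\<Sum>k\<in>{..m}. cf F k * cf G (m - k))"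
  by (simp add: times_mfps_def)

lemma cf_of_nat_times: "cf (of_nat n * F) m = real n * cf F m"
  by (induction n) (auto simp: distrib_right)

definition zmon :: "nat ^ 'd \<Rightarrow> 'd::finite mfps" where
  "zmon x = Abs_mfps (\<lambda>m. if m = x then 1 else 0)"

lemma cf_zmon_times: "cf (zmon x * F) m = (if x \<le> m then cf F (m - x) else 0)"
proof -
  have "cf (zmon x * F) m = (\<Sum>k\<in>{..m}. if k = x then cf F (m - x) else 0)"
    unfolding cf_times zmon_def cf_Abs by (intro sum.cong) auto
  then show ?thesis by (simp add: finite_atMost_vec)
qed

lemma zmon_zero [simp]: "zmon 0 = 1"
  by (simp add: zmon_def one_mfps_def)

lemma zmon_plus: "zmon (x + y) = zmon x * zmon y"
  by (rule mfps_eqI, unfold cf_zmon_times)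
     (auto simp: zmon_def vec_le_iff_add)

text \<open>The operator \<open>z_i d/dz_i\<close>: a derivation that, unlike the plain derivative,
  does not shift coefficients.\<close>

definition euler :: "'d \<Rightarrow> 'd::finite mfps \<Rightarrow> 'd mfps" where
  "euler i F = Abs_mfps (\<lambda>m. real (m $ i) * cf F m)"

lemma cf_euler [simp]: "cf (euler i F) m = real (m $ i) * cf F m"
  by (simp add: euler_def)

lemma euler_times: "euler i (F * G) = euler i F * G + F * euler i G"
proof (rule mfps_eqI)
  fix m
  have "cf (euler i (F * G)) m =
      (\<Sum>k\<in>{..m}. (real (k $ i) + real ((m - k) $ i)) * (cf F k * cf G (m - k)))"
    unfolding cf_euler cf_times sum_distrib_left
    by (intro sum.cong refl) (simp add: less_eq_vec_def flip: of_nat_add)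
  then show "cf (euler i (F * G)) m = cf (euler i F * G + F * euler i G) m"
    unfolding cf_plus cf_times cf_euler by (simp add: sum.distrib algebra_simps)
qed

lemma euler_one [simp]: "euler i 1 = 0"
  by (rule mfps_eqI) (simp add: cf_one)

lemma euler_power: "euler i (F ^ Suc n) = of_nat (Suc n) * F ^ n * euler i F"
  by (induction n) (simp_all add: euler_times algebra_simps)

lemma euler_zmon: "euler i (zmon x) = of_nat (x $ i) * zmon x"
  by (rule mfps_eqI) (auto simp: zmon_def cf_of_nat_times)

text \<open>The formal sum of \<open>pmf A k * G k\<close> over all \<open>k\<close>; the truncation is harmless for admissible \<open>G\<close>.\<close>

definition psum :: "(nat ^ 'd) pmf \<Rightarrow> (nat ^ 'd \<Rightarrow> 'd::finite mfps) \<Rightarrow> 'd mfps" where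
  "psum A G = Abs_mfps (\<lambda>m. \<Sum>k\<in>{..m}. pmf A k * cf (G k) m)"

text \<open>Divisibility of \<open>G k\<close> by the monomial of exponent \<open>k\<close>. It
  holds for \<open>progeny p k\<close> because the total progeny counts the initial population, and
  it leaves finitely many contributions to each coefficient.\<close>

definition admissible :: "(nat ^ 'd \<Rightarrow> 'd::finite mfps) \<Rightarrow> bool" where
  "admissible G \<longleftrightarrow> (\<forall>k m. \<not> k \<le> m \<longrightarrow> cf (G k) m = 0)"

lemma cf_psum: "cf (psum A G) m = (\<Sum>k\<in>{..m}. pmf A k * cf (G k) m)"
  by (simp add: psum_def)

lemma cf_psum_le:
  assumes "admissible G" "m \<le> M"
  shows "cf (psum A G) m = (\<Sum>k\<in>{..M}. pmf A k * cf (G k) m)"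
  unfolding cf_psum
  by (rule sum.mono_neutral_left)
     (use assms in \<open>auto simp: finite_atMost_vec admissible_def intro: order_trans\<close>)

lemma psum_times:
  assumes "admissible G"
  shows "psum A G * F = psum A (\<lambda>k. G k * F)"
proof (rule mfps_eqI)
  fix m
  have "cf (psum A G * F) m = (\<Sum>s\<in>{..m}. \<Sum>k\<in>{..m}. pmf A k * (cf (G k) s * cf F (m - s)))"
    unfolding cf_times
    by (intro sum.cong refl) (simp add: cf_psum_le[OF assms] sum_distrib_right mult.assoc)
  also have "\<dots> = cf (psum A (\<lambda>k. G k * F)) m"
    unfolding cf_psum cf_times sum_distrib_left by (rule sum.swap)
  finally show "cf (psum A G * F) m = cf (psum A (\<lambda>k. G k * F)) m" .
qed

lemma admissible_times_right: "admissible G \<Longrightarrow> admissible (\<lambda>k. G k * F)"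
  unfolding admissible_def cf_times by (fastforce intro!: sum.neutral dest: order_trans)

lemma euler_psum: "euler i (psum A G) = psum A (\<lambda>k. euler i (G k))"
  by (rule mfps_eqI) (simp add: cf_psum sum_distrib_left mult_ac)

lemma admissible_euler: "admissible G \<Longrightarrow> admissible (\<lambda>k. euler i (G k))"
  by (simp add: admissible_def)

lemma psum_return_0 [simp]: "psum (return_pmf 0) G = G 0"
proof (rule mfps_eqI)
  fix m
  have "cf (psum (return_pmf 0) G) m = (\<Sum>k\<in>{..m}. if k = 0 then cf (G 0) m else 0)"
    unfolding cf_psum by (intro sum.cong) (auto simp: indicator_def)
  then show "cf (psum (return_pmf 0) G) m = cf (G 0) m"
    by (simp add: finite_atMost_vec)
qed

section \<open>Convolution of laws and the branching transition\<close>

definition conv_pmf :: "(nat ^ 'd) pmf \<Rightarrow> (nat ^ 'd) pmf \<Rightarrow> (nat ^ 'd::finite) pmf" where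
  "conv_pmf A B = map_pmf (\<lambda>(x, y). x + y) (pair_pmf A B)"

lemma pmf_conv_pmf: "pmf (conv_pmf A B) m = (\<Sum>k\<in>{..m}. pmf A k * pmf B (m - k))"
proof -
  let ?S = "(\<lambda>k. (k, m - k)) ` {..m}"
  have "(\<lambda>(x, y). x + y) -` {m} = ?S"
    by (auto simp: image_iff vec_le_iff_add)
  then have "pmf (conv_pmf A B) m = measure (measure_pmf (pair_pmf A B)) ?S"
    by (simp add: conv_pmf_def pmf_map)
  also have "\<dots> = (\<Sum>z\<in>?S. pmf (pair_pmf A B) z)"
    by (rule measure_measure_pmf_finite) (simp add: finite_atMost_vec)
  also have "\<dots> = (\<Sum>k\<in>{..m}. pmf (pair_pmf A B) (k, m - k))"
    by (subst sum.reindex) (auto simp: inj_on_def)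
  finally show ?thesis by (simp add: pmf_pair)
qed

text \<open>Multiplicativity of \<open>G\<close> is assumed at the single coefficient
  \<open>m\<close> only, since \<open>progeny_plus\<close> applies this lemma inside an induction
  that supplies no more.\<close>

lemma cf_psum_conv:
  assumes adm: "admissible G"
    and mult: "\<And>k l. cf (G (k + l)) m = cf (G k * G l) m"
  shows "cf (psum (conv_pmf A B) G) m = cf (psum A G * psum B G) m"
proof -
  have z: "cf (G (k + l)) m = 0" if "l \<in> {..m} - {..m - k}" "k \<le> m" for k l
  proof -
    have "\<not> k + l \<le> m"
    proof
      assume "k + l \<le> m"
      then obtain y where "m = k + l + y" by (auto simp: vec_le_iff_add)
      then have "m - k = l + y" by (simp add: vec_eq_iff)
      then have "l \<le> m - k" by (auto simp: vec_le_iff_add)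
      with that show False by simp
    qed
    then show ?thesis using adm by (simp add: admissible_def)
  qed
  have "cf (psum (conv_pmf A B) G) m =
      (\<Sum>z\<in>{..m}. \<Sum>k\<in>{..z}. pmf A k * pmf B (z - k) * cf (G (k + (z - k))) m)"
    unfolding cf_psum pmf_conv_pmf sum_distrib_right
    by (intro sum.cong refl) (simp add: vec_add_diff_inverse)
  also have "\<dots> = (\<Sum>k\<in>{..m}. \<Sum>l\<in>{..m - k}. pmf A k * pmf B l * cf (G (k + l)) m)"
    by (rule sum_atMost_vec_swap)
  also have "\<dots> = (\<Sum>k\<in>{..m}. \<Sum>l\<in>{..m}. pmf A k * pmf B l * cf (G (k + l)) m)"
    by (intro sum.cong refl sum.mono_neutral_left)
       (use z in \<open>auto simp: finite_atMost_vec less_eq_vec_def intro: order_trans\<close>)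
  also have "\<dots> = (\<Sum>k\<in>{..m}. pmf A k * (\<Sum>l\<in>{..m}. pmf B l * cf (G l * G k) m))"
    by (simp add: mult sum_distrib_left mult_ac)
  also have "\<dots> = (\<Sum>k\<in>{..m}. pmf A k * cf (G k * psum B G) m)"
    by (simp add: cf_psum[symmetric] psum_times[OF adm, symmetric] mult.commute[of _ "psum B G"])
  also have "\<dots> = cf (psum A G * psum B G) m"
    by (simp add: psum_times[OF adm] cf_psum)
  finally show ?thesis .
qed

lemma next_generation_zero [simp]: "next_generation p 0 = return_pmf (0 :: nat ^ 'd::finite)"
  by (simp add: next_generation_def individuals_def)

lemma individuals_add_axis:
  "individuals (x + axis i 1) = insert (i, x $ i) (individuals x)"
  by (auto simp: individuals_def axis_def split: if_splits)

lemma finite_individuals: "finite (individuals x)"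
  by (simp add: individuals_def)

text \<open>The new individual receives the first free label \<open>(i, x $ i)\<close>, so the
  product law splits off one independent factor. From here on transitions are handled as
  convolutions and the labels disappear.\<close>

lemma next_generation_add_axis:
  "next_generation p (x + axis i 1) = conv_pmf (p i) (next_generation p x)"
proof -
  have nin: "(i, x $ i) \<notin> individuals x"
    by (simp add: individuals_def)
  have eq: "(\<Sum>s\<in>individuals x. (f((i, x $ i) := y)) s) = (\<Sum>s\<in>individuals x. f s)"
    for f :: "'a \<times> nat \<Rightarrow> nat ^ 'a" and y
    by (rule sum.cong) (use nin in auto)
  show ?thesis
    unfolding next_generation_def individuals_add_axis conv_pmf_def
    by (subst Pi_pmf_insert[OF finite_individuals nin])
       (simp add: pmf.map_comp o_def case_prod_unfold finite_individuals nin eq pair_map_pmf2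
         del: fun_upd_apply, simp)
qed

text \<open>Embedding laws into the series makes commutativity and associativity of convolution
  instances of the semiring laws.\<close>

lemma Abs_mfps_conv_pmf:
  "Abs_mfps (pmf (conv_pmf A B)) = Abs_mfps (pmf A) * Abs_mfps (pmf B)"
  by (rule mfps_eqI) (simp add: cf_times pmf_conv_pmf)

lemma Abs_mfps_pmf_inject: "Abs_mfps (pmf A) = Abs_mfps (pmf B) \<Longrightarrow> A = B"
  by (rule pmf_eqI) (metis cf_Abs)

lemma conv_pmf_commute: "conv_pmf A B = conv_pmf B A"
  by (rule Abs_mfps_pmf_inject) (simp add: Abs_mfps_conv_pmf mult.commute)

lemma conv_pmf_assoc: "conv_pmf (conv_pmf A B) C = conv_pmf A (conv_pmf B C)"
  by (rule Abs_mfps_pmf_inject) (simp add: Abs_mfps_conv_pmf mult.assoc)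

lemma conv_pmf_return_0 [simp]: "conv_pmf A (return_pmf 0) = A" "conv_pmf (return_pmf 0) A = A"
  by (simp_all add: conv_pmf_def pair_return_pmf1 pair_return_pmf2 pmf.map_comp o_def)

lemma next_generation_plus:
  "next_generation p (x + y) = conv_pmf (next_generation p x) (next_generation p y)"
proof (induction y rule: nat_vec_induct)
  case (add_axis y i)
  then show ?case
    by (metis add.assoc next_generation_add_axis conv_pmf_assoc conv_pmf_commute)
qed simp

lemma next_generation_axis [simp]: "next_generation p (axis i (Suc 0)) = p i"
  using next_generation_add_axis[of p 0 i] by simp

subsection \<open>The law of the total progeny\<close>

text \<open>The probability that the total progeny of the population \<open>x\<close> equals \<open>m\<close>.\<close>

function progeny_cf :: "('d::finite \<Rightarrow> (nat ^ 'd) pmf) \<Rightarrow> nat ^ 'd \<Rightarrow> nat ^ 'd \<Rightarrow> real" where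
  "progeny_cf p x m =
     (if x = 0 then if m = 0 then 1 else 0
      else if x \<le> m then \<Sum>y\<in>{..m - x}. pmf (next_generation p x) y * progeny_cf p y (m - x)
      else 0)"
  by pat_completeness auto
termination
  by (relation "Wellfounded.measure (\<lambda>(p, x, m). size_vec m)")
     (auto simp: size_vec_diff[of x m for x m] simp flip: size_vec_eq_0_iff)

declare progeny_cf.simps [simp del]

definition progeny :: "('d::finite \<Rightarrow> (nat ^ 'd) pmf) \<Rightarrow> nat ^ 'd \<Rightarrow> 'd mfps" where
  "progeny p x = Abs_mfps (progeny_cf p x)"

lemma progeny_zero [simp]: "progeny p 0 = 1"
  by (rule mfps_eqI) (simp add: progeny_def progeny_cf.simps[of p 0] cf_one)

text \<open>Decomposition at the first generation. Restricting the sum over its offspring to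
  \<open>y \<le> m - x\<close> loses nothing, as a population never exceeds its total
  progeny.\<close>

lemma progeny_rec: "progeny p x = zmon x * psum (next_generation p x) (progeny p)"
proof (cases "x = 0")
  case False
  then show ?thesis
    by (intro mfps_eqI)
       (auto simp: progeny_def progeny_cf.simps[of p x] cf_zmon_times cf_psum)
qed simp

lemma admissible_progeny: "admissible (progeny p)"
  unfolding admissible_def by (metis progeny_rec cf_zmon_times)

text \<open>The branching property. Both sides obey the same recursion, because the offspring of
  \<open>x + y\<close> is a convolution; a nonzero generation removed from \<open>m\<close> makes
  the induction on its size work.\<close>

lemma progeny_plus: "progeny p (x + y) = progeny p x * progeny p y"
proof (rule mfps_eqI)
  fix m
  show "cf (progeny p (x + y)) m = cf (progeny p x * progeny p y) m"
  proof (induction "size_vec m" arbitrary: m x y rule: less_induct)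
    case less
    have prod: "progeny p x * progeny p y = zmon (x + y) *
        (psum (next_generation p x) (progeny p) * psum (next_generation p y) (progeny p))"
      using progeny_rec[of p x] progeny_rec[of p y] by (simp only: zmon_plus mult_ac)
    show ?case
    proof (cases "x = 0 \<or> y = 0 \<or> \<not> x + y \<le> m")
      case True
      have "cf (progeny p x * progeny p y) m = 0" if "\<not> x + y \<le> m"
        using that by (simp add: prod cf_zmon_times)
      moreover have "cf (progeny p (x + y)) m = 0" if "\<not> x + y \<le> m"
        using that admissible_progeny by (auto simp: admissible_def)
      ultimately show ?thesis using True by auto
    next
      case False
      then have "size_vec (m - (x + y)) < size_vec m"
        by (auto simp: size_vec_diff[of "x + y" m] simp flip: size_vec_eq_0_iff)
      then have "cf (psum (conv_pmf (next_generation p x) (next_generation p y)) (progeny p)) (m - (x + y)) =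
          cf (psum (next_generation p x) (progeny p) * psum (next_generation p y) (progeny p)) (m - (x + y))"
        by (intro cf_psum_conv admissible_progeny less)
      then have "cf (progeny p (x + y)) m = cf (zmon (x + y) *
            (psum (next_generation p x) (progeny p) * psum (next_generation p y) (progeny p))) m"
        by (subst progeny_rec) (simp only: cf_zmon_times next_generation_plus)
      then show ?thesis by (simp only: prod)
    qed
  qed
qed

lemma progeny_axis: "progeny p (axis i 1) = zmon (axis i 1) * psum (p i) (progeny p)"
  by (subst progeny_rec) simp

lemma progeny_nonneg: "0 \<le> cf (progeny p x) m"
proof (induction "size_vec m" arbitrary: m x rule: less_induct)
  case less
  have "cf (progeny p x) m \<ge> 0" if "x \<noteq> 0" "x \<le> m"
    by (subst progeny_rec)
       (use that less size_vec_diff[of x m] in \<open>auto simp: cf_zmon_times cf_psum intro!: sum_nonneg mult_nonneg_nonneg simp flip: size_vec_eq_0_iff\<close>)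
  moreover have "cf (progeny p x) m = 0" if "\<not> x \<le> m"
    using that admissible_progeny by (auto simp: admissible_def)
  ultimately show ?case by (cases "x = 0"; cases "x \<le> m") (auto simp: cf_one)
qed

text \<open>Individuals of type \<open>\<tau>\<close> become sterile but are still counted, so the
  progeny under \<open>freeze \<tau> p\<close> is the tree cut at the first individual of type
  \<open>\<tau>\<close> on each branch, these included.\<close>

definition freeze :: "'d \<Rightarrow> ('d::finite \<Rightarrow> (nat ^ 'd) pmf) \<Rightarrow> 'd \<Rightarrow> (nat ^ 'd) pmf" where
  "freeze \<tau> p = p(\<tau> := return_pmf 0)"

lemma progeny_freeze_axis:
  "progeny (freeze \<tau> p) (axis \<tau> 1) = zmon (axis \<tau> 1)"
  "i \<noteq> \<tau> \<Longrightarrow> progeny (freeze \<tau> p) (axis i 1) = zmon (axis i 1) * psum (p i) (progeny (freeze \<tau> p))"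
  using progeny_axis[of "freeze \<tau> p" i] progeny_axis[of "freeze \<tau> p" \<tau>] by (simp_all add: freeze_def)

text \<open>One individual is explored at a time instead of a whole generation; the total progeny
  does not depend on the order of exploration. This is the recursion behind the next two
  inductions.\<close>

lemma progeny_plus_axis:
  "progeny p (x + axis i 1) = zmon (axis i 1) * psum (p i) (\<lambda>k. progeny p (x + k))"
  unfolding progeny_plus progeny_axis psum_times[OF admissible_progeny, symmetric]
    mult.commute[of "progeny p x" "progeny p k" for k]
  by (simp add: mult_ac)

text \<open>A tree without individuals of type \<open>\<tau>\<close> never draws from
  \<open>p \<tau>\<close>.\<close>

lemma cf_progeny_freeze:
  assumes "m $ \<tau> = 0"
  shows "cf (progeny p x) m = cf (progeny (freeze \<tau> p) x) m"
  using assms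
proof (induction "size_vec m" arbitrary: m x rule: less_induct)
  case less
  show ?case
  proof (cases x rule: nat_vec_cases)
    case (2 i y)
    show ?thesis
    proof (cases "axis i 1 \<le> m")
      case True
      with less have "i \<noteq> \<tau>" by (auto simp: axis_le_iff)
      have "size_vec (m - axis i 1) < size_vec m"
        using size_vec_diff[OF True] by simp
      then show ?thesis
        unfolding 2 progeny_plus_axis cf_zmon_times
        using less True \<open>i \<noteq> \<tau>\<close> by (auto simp: freeze_def cf_psum intro!: sum.cong)
    next
      case False
      then show ?thesis unfolding 2 progeny_plus_axis cf_zmon_times by simp
    qed
  qed simp
qed

text \<open>
  The Otter--Dwass formula for the type \<open>\<tau>\<close>: pruning the tree at the individuals of type \<open>\<tau>\<close>
  leaves a single-type branching process, and the Euler operator turns the exchangeability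
  argument into the Leibniz rule.
\<close>

theorem otter_dwass:
  fixes p :: "'d::finite \<Rightarrow> (nat ^ 'd) pmf" and \<tau> :: 'd
  defines "\<pi> \<equiv> psum (p \<tau>) (progeny (freeze \<tau> p))"
  shows "real (m $ \<tau>) * cf (progeny p x) m =
    cf (euler \<tau> (progeny (freeze \<tau> p) x) * \<pi> ^ (m $ \<tau>)) m"
proof (induction "size_vec m" arbitrary: m x rule: less_induct)
  case less
  define G where "G = progeny (freeze \<tau> p)"
  have adm: "admissible (\<lambda>k. G y * G k)" for y
    using admissible_times_right[OF admissible_progeny, of "freeze \<tau> p" "G y"]
    by (simp add: G_def mult.commute)
  \<comment> \<open>Linearity in the offspring \<open>k\<close> of the explored individual:
    averaging over \<open>k\<close> replaces that individual's factor by
    \<open>psum (p i) G\<close>.\<close>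
  have step: "(\<Sum>k\<in>{..q}. pmf (p i) k * cf (euler \<tau> (G (y + k)) * F) q) =
      cf (euler \<tau> (G y * psum (p i) G) * F) q" for i y F q
  proof -
    have "euler \<tau> (G y * psum (p i) G) * F = psum (p i) (\<lambda>k. euler \<tau> (G y * G k) * F)"
      using psum_times[OF admissible_progeny, of "p i" "freeze \<tau> p" "G y"]
        psum_times[OF admissible_euler[OF adm], of "p i" \<tau> y F]
      by (simp add: G_def mult.commute[of "progeny (freeze \<tau> p) y"] euler_psum)
    then show ?thesis by (simp add: cf_psum G_def progeny_plus)
  qed
  show ?case
  proof (cases x rule: nat_vec_cases)
    case (2 i y)
    show ?thesis
    proof (cases "axis i 1 \<le> m")
      case le: True
      define q where "q = m - axis i (Suc 0)"
      have q: "size_vec q < size_vec m"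
        using size_vec_diff[OF le] by (simp add: q_def)
      \<comment> \<open>The induction hypothesis at \<open>q\<close>, averaged over the offspring of
        the explored individual. The exponent of \<open>\<pi>\<close> is that of \<open>q\<close>,
        one less than for \<open>m\<close> exactly when \<open>i = \<tau>\<close>.\<close>
      have L: "real (q $ \<tau>) * cf (progeny p x) m =
          cf (euler \<tau> (G y * psum (p i) G) * \<pi> ^ (q $ \<tau>)) q"
        unfolding 2 progeny_plus_axis cf_zmon_times step[symmetric]
        using le
        by (simp add: cf_psum q_def[symmetric] sum_distrib_left less[OF q, folded G_def, symmetric])
           (simp add: mult_ac)
      show ?thesis
      proof (cases "i = \<tau>")
        case False
        have "euler \<tau> (G x) = zmon (axis i 1) * euler \<tau> (G y * psum (p i) G)"
          unfolding 2 G_def progeny_plus progeny_freeze_axis(2)[OF False]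
          using False by (simp add: euler_times euler_zmon axis_def algebra_simps)
        moreover have "q $ \<tau> = m $ \<tau>" using False by (simp add: q_def axis_def)
        ultimately show ?thesis
          using L le by (simp add: G_def[symmetric] mult.assoc cf_zmon_times q_def[symmetric])
      next
        case True
        define n where "n = q $ \<tau>"
        have mn: "m $ \<tau> = Suc n"
          using le True by (auto simp: n_def q_def axis_le_iff)
        \<comment> \<open>The explored individual is a leaf of the cut tree that counts in
          coordinate \<open>\<tau>\<close>, so the Leibniz rule produces the extra term
          \<open>G y\<close>.\<close>
        have "euler \<tau> (G x) = zmon (axis \<tau> 1) * (G y + euler \<tau> (G y))"
          unfolding 2 True G_def progeny_plus progeny_freeze_axis(1)
          by (simp add: euler_times euler_zmon axis_def algebra_simps)
        then have R: "cf (euler \<tau> (G x) * \<pi> ^ (m $ \<tau>)) m =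
            cf (G y * \<pi> ^ Suc n) q + cf (euler \<tau> (G y) * \<pi> ^ Suc n) q"
          using le True by (simp add: mn mult.assoc cf_zmon_times q_def distrib_right)
        have pi: "psum (p i) G = \<pi>" by (simp add: \<pi>_def G_def True)
        \<comment> \<open>\<open>L\<close> carries the factor \<open>n\<close>, which can be
          cancelled only if it is nonzero. For \<open>n = 0\<close> the remaining tree has no
          individual of type \<open>\<tau>\<close> and coincides with a cut tree.\<close>
        show ?thesis
        proof (cases "n = 0")
          case n0: True
          have "cf (progeny p x) m = cf (G y * \<pi>) q"
          proof -
            have "cf (progeny p x) m = (\<Sum>k\<in>{..q}. pmf (p i) k * cf (G (y + k)) q)"
              unfolding 2 progeny_plus_axis cf_zmon_times
              using le n0 by (simp add: cf_psum q_def[symmetric] n_def cf_progeny_freeze[of q \<tau> p] G_def)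
            also have "\<dots> = cf (psum (p i) (\<lambda>k. G k * G y)) q"
              by (simp add: cf_psum G_def progeny_plus mult.commute)
            also have "\<dots> = cf (G y * \<pi>) q"
              using psum_times[OF admissible_progeny, of "p i" "freeze \<tau> p" "G y"] pi
              by (simp add: G_def mult.commute[of "progeny (freeze \<tau> p) y"])
            finally show ?thesis .
          qed
          moreover have "cf (euler \<tau> (G y) * \<pi> ^ Suc n) q = 0"
            unfolding cf_times
            by (rule sum.neutral) (use n0 in \<open>auto simp: n_def less_eq_vec_def dest!: spec[of _ \<tau>]\<close>)
          ultimately show ?thesis using R by (simp add: G_def[symmetric] mn n0)
        next
          case False
          \<comment> \<open>On both sides the Leibniz rule gives \<open>Suc n\<close> copies of the
            term where \<open>G y\<close> is differentiated and of the term where one factor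
            \<open>\<pi>\<close> is. At the coefficient \<open>q\<close> the outer
            \<open>euler\<close> is multiplication by \<open>n\<close>, which turns the right side
            into \<open>n\<close> times \<open>R\<close>.\<close>
          have "of_nat (Suc n) * (euler \<tau> (G y * \<pi>) * \<pi> ^ n) =
              of_nat n * (euler \<tau> (G y) * \<pi> ^ Suc n) + euler \<tau> (G y * \<pi> ^ Suc n)"
            unfolding euler_times euler_power by (simp add: algebra_simps)
          then have "cf (of_nat (Suc n) * (euler \<tau> (G y * \<pi>) * \<pi> ^ n)) q =
              cf (of_nat n * (euler \<tau> (G y) * \<pi> ^ Suc n) + euler \<tau> (G y * \<pi> ^ Suc n)) q"
            by simp
          then have "real (Suc n) * (real n * cf (progeny p x) m) =
              real n * (cf (euler \<tau> (G x) * \<pi> ^ (m $ \<tau>)) m)"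
            unfolding R cf_plus cf_of_nat_times cf_euler n_def[symmetric] distrib_left
            using L[folded n_def, unfolded pi] by simp
          then have "real n * (real (Suc n) * cf (progeny p x) m) =
              real n * (cf (euler \<tau> (G x) * \<pi> ^ (m $ \<tau>)) m)"
            by (simp only: mult.left_commute)
          with False show ?thesis by (simp add: mn G_def)
        qed
      qed
    next
      case False
      then have "\<not> axis i 1 \<le> k" if "k \<le> m" for k
        using that order_trans by blast
      then have z: "cf (G x) k = 0" if "k \<le> m" for k
        unfolding 2 G_def progeny_plus_axis cf_zmon_times using that by simp
      have "cf (progeny p x) m = 0"
        unfolding 2 progeny_plus_axis cf_zmon_times using False by simp
      moreover have "cf (euler \<tau> (G x) * \<pi> ^ (m $ \<tau>)) m = 0"
        unfolding cf_times by (rule sum.neutral) (simp add: z)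
      ultimately show ?thesis by (simp add: G_def)
    qed
  qed (simp add: cf_one)
qed

subsection \<open>A local limit theorem\<close>

lemma pair_pmf_eq_pair_measure:
  fixes A :: "'a::countable pmf" and B :: "'b::countable pmf"
  shows "measure_pmf (pair_pmf A B) = measure_pmf A \<Otimes>\<^sub>M measure_pmf B"
proof (rule measure_eqI_countable[of _ UNIV])
  have "sets (measure_pmf A \<Otimes>\<^sub>M measure_pmf B) =
      sets (count_space (UNIV :: 'a set) \<Otimes>\<^sub>M count_space (UNIV :: 'b set))"
    by (intro sets_pair_measure_cong) simp_all
  then show "sets (measure_pmf A \<Otimes>\<^sub>M measure_pmf B) = Pow UNIV"
    by (subst (asm) pair_measure_countable) simp_all
  fix z :: "'a \<times> 'b"
  obtain a b where z: "z = (a, b)" by fastforce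
  have "emeasure (measure_pmf A \<Otimes>\<^sub>M measure_pmf B) ({a} \<times> {b}) =
      emeasure (measure_pmf A) {a} * emeasure (measure_pmf B) {b}"
    by (intro measure_pmf.emeasure_pair_measure_Times) auto
  then show "emeasure (measure_pmf (pair_pmf A B)) {z} = emeasure (measure_pmf A \<Otimes>\<^sub>M measure_pmf B) {z}"
    by (simp add: z emeasure_pmf_single pmf_pair ennreal_mult)
qed auto

lemma expectation_pair_pmf_mult:
  fixes A :: "'a::countable pmf" and B :: "'b::countable pmf"
    and f :: "'a \<Rightarrow> complex" and g :: "'b \<Rightarrow> complex"
  assumes "\<And>x. cmod (f x) \<le> 1" "\<And>y. cmod (g y) \<le> 1"
  shows "measure_pmf.expectation (pair_pmf A B) (\<lambda>z. f (fst z) * g (snd z)) =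
    measure_pmf.expectation A f * measure_pmf.expectation B g"
proof -
  interpret pair_sigma_finite "measure_pmf A" "measure_pmf B" ..
  have "integrable (measure_pmf (pair_pmf A B)) (\<lambda>z. f (fst z) * g (snd z))"
    by (rule measure_pmf.integrable_const_bound[of _ 1])
       (auto simp: norm_mult intro!: mult_le_one assms)
  then have "measure_pmf.expectation (pair_pmf A B) (\<lambda>z. f (fst z) * g (snd z)) =
      (\<integral>x. \<integral>y. f x * g y \<partial>B \<partial>A)"
    unfolding pair_pmf_eq_pair_measure by (subst integral_fst'[symmetric]) auto
  then show ?thesis by simp
qed

section \<open>Fourier transforms and inversion on the torus\<close>

definition fourier :: "(nat ^ 'd::finite) pmf \<Rightarrow> real ^ 'd \<Rightarrow> complex" where
  "fourier A t = measure_pmf.expectation A (\<lambda>r. cis (t \<bullet> real_vec r))"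

lemma real_vec_plus: "real_vec (x + y) = real_vec x + real_vec (y :: nat ^ 'd::finite)"
  by (simp add: real_vec_def vec_eq_iff)

lemma real_vec_zero [simp]: "real_vec 0 = (0 :: real ^ 'd::finite)"
  by (simp add: real_vec_def vec_eq_iff)

lemma real_vec_nth [simp]: "real_vec x $ i = real (x $ i)"
  by (simp add: real_vec_def)

lemma fourier_conv_pmf: "fourier (conv_pmf A B) t = fourier A t * fourier B t"
  unfolding fourier_def conv_pmf_def
  by (subst expectation_pair_pmf_mult[symmetric])
     (simp_all add: case_prod_unfold real_vec_plus inner_add_right cis_mult)

lemma fourier_return_0 [simp]: "fourier (return_pmf 0) t = 1"
  by (simp add: fourier_def)

lemma cmod_fourier_le_1: "cmod (fourier A t) \<le> 1"
proof -
  have "cmod (fourier A t) \<le> measure_pmf.expectation A (\<lambda>r. cmod (cis (t \<bullet> real_vec r)))"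
    unfolding fourier_def by (rule integral_norm_bound)
  then show ?thesis by simp
qed

primrec conv_power :: "(nat ^ 'd::finite) pmf \<Rightarrow> nat \<Rightarrow> (nat ^ 'd) pmf" where
  "conv_power A 0 = return_pmf 0"
| "conv_power A (Suc n) = conv_pmf A (conv_power A n)"

lemma fourier_conv_power: "fourier (conv_power A n) t = fourier A t ^ n"
  by (induction n) (simp_all add: fourier_conv_pmf)

lemma Abs_mfps_conv_power: "Abs_mfps (pmf (conv_power A n)) = Abs_mfps (pmf A) ^ n"
proof (induction n)
  case 0
  show ?case by (rule mfps_eqI) (simp add: cf_one indicator_def)
qed (simp add: Abs_mfps_conv_pmf)

lemma integral_cis_int:
  fixes k :: int
  shows "(\<integral>x. indicator {-pi..pi} x *\<^sub>R cis (x * of_int k) \<partial>lborel) = (if k = 0 then complex_of_real (2 * pi) else 0)"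
proof (cases "k = 0")
  case False
  define F where "F x = cis (x * of_int k) / (\<i> * of_int k)" for x
  have D: "(F has_vector_derivative cis (x * of_int k)) (at x within {-pi..pi})" for x
  proof -
    have "((\<lambda>z. exp (z * (\<i> * of_int k)) / (\<i> * of_int k)) has_field_derivative
        exp (of_real x * (\<i> * of_int k))) (at (of_real x))"
      using False by (auto intro!: derivative_eq_intros)
    from has_vector_derivative_real_field[OF this] show ?thesis
      by (simp add: F_def[abs_def] cis_conv_exp mult_ac)
  qed
  have "(\<integral>x. indicator {-pi..pi} x *\<^sub>R cis (x * of_int k) \<partial>lborel) = F pi - F (-pi)"
    by (rule integral_FTC_Icc) (use D in \<open>auto intro!: continuous_intros\<close>)
  also have "F pi = F (-pi)"
  proof -
    have "cis (pi * of_int k) = cis (- pi * of_int k)"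
      by (simp add: complex_eq_iff mult.commute[of pi] sin_times_pi_eq_0)
    then show ?thesis by (simp add: F_def)
  qed
  finally show ?thesis using False by simp
qed (simp add: scaleR_conv_of_real)

text \<open>Orthogonality of characters. Lebesgue measure is the image of a product of
  one-dimensional measures indexed by \<open>Basis\<close>, so the integral factors over the
  coordinates.\<close>

lemma integral_cis_box:
  fixes k :: "'d::finite \<Rightarrow> int"
  shows "(\<integral>t. indicator (cbox (\<chi> i. -pi) (\<chi> i. pi)) t *\<^sub>R cis (t \<bullet> (\<chi> i. of_int (k i))) \<partial>lborel) =
    (if \<forall>i. k i = 0 then complex_of_real ((2 * pi) ^ CARD('d)) else 0)"
proof -
  interpret product_sigma_finite "\<lambda>_ :: real ^ 'd. lborel :: real measure" ..
  let ?K = "(\<chi> i. of_int (k i)) :: real ^ 'd"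
  let ?a = "(\<chi> i. -pi) :: real ^ 'd" and ?b = "(\<chi> i. pi) :: real ^ 'd"
  let ?g = "\<lambda>b x. indicator {-pi..pi} x *\<^sub>R cis (x * (?K \<bullet> b))"
  have Basis: "\<exists>j. b = axis j 1" if "b \<in> Basis" for b :: "real ^ 'd"
    using that by (auto simp: Basis_vec_def)
  have eq: "indicator (cbox ?a ?b) t *\<^sub>R cis (t \<bullet> ?K) = (\<Prod>b\<in>Basis. ?g b (f b))"
    if t: "t = (\<Sum>b\<in>Basis. f b *\<^sub>R b)" for f and t :: "real ^ 'd"
  proof -
    have tb: "t \<bullet> b = f b" if "b \<in> Basis" for b
      using that by (simp add: t inner_sum_left inner_Basis if_distrib sum.delta cong: if_cong)
    have ab: "?a \<bullet> b = -pi" "?b \<bullet> b = pi" if "b \<in> Basis" for b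
      using Basis[OF that] by (auto simp: inner_axis)
    have "cis (t \<bullet> ?K) = (\<Prod>b\<in>Basis. cis (f b * (?K \<bullet> b)))"
    proof -
      have "t \<bullet> ?K = (\<Sum>b\<in>Basis. f b * (?K \<bullet> b))"
        by (subst euclidean_inner) (simp add: tb)
      then show ?thesis by (simp add: cis_conv_exp exp_sum sum_distrib_left)
    qed
    moreover have "(indicator (cbox ?a ?b) t :: real) = (\<Prod>b\<in>Basis. indicator {-pi..pi} (f b))"
    proof (cases "t \<in> cbox ?a ?b")
      case True
      then show ?thesis using tb ab by (simp add: mem_box)
    next
      case False
      then obtain b where "b \<in> Basis" "f b \<notin> {-pi..pi}"
        using tb ab by (auto simp: mem_box)
      then show ?thesis using False by (auto intro!: prod_zero[symmetric] simp: indicator_def)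
    qed
    ultimately show ?thesis by (simp add: scaleR_conv_of_real prod.distrib)
  qed
  have [measurable]: "(\<lambda>t. cis (t \<bullet> ?K)) \<in> borel_measurable borel"
    by (intro borel_measurable_continuous_onI continuous_intros)
  have "(\<integral>t. indicator (cbox ?a ?b) t *\<^sub>R cis (t \<bullet> ?K) \<partial>lborel) =
      (\<integral>f. (\<Prod>b\<in>Basis. ?g b (f b)) \<partial>(\<Pi>\<^sub>M b\<in>(Basis :: (real ^ 'd) set). lborel))"
    by (subst lborel_eq, subst integral_distr) (simp_all add: eq)
  also have "\<dots> = (\<Prod>b\<in>(Basis :: (real ^ 'd) set). \<integral>x. ?g b x \<partial>lborel)"
    by (rule product_integral_prod)
       (auto intro!: borel_integrable_compact[of "{-pi..pi}", simplified] continuous_intros)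
  also have "\<dots> = (\<Prod>i\<in>(UNIV :: 'd set). \<integral>x. ?g (axis i 1) x \<partial>lborel)"
    by (rule prod.reindex_bij_betw[symmetric])
       (auto simp: bij_betw_def inj_on_def axis_eq_axis Basis_vec_def)
  also have "\<dots> = (\<Prod>i\<in>(UNIV :: 'd set). if k i = 0 then complex_of_real (2 * pi) else 0)"
    by (simp add: inner_axis integral_cis_int)
  also have "\<dots> = (if \<forall>i. k i = 0 then complex_of_real ((2 * pi) ^ CARD('d)) else 0)"
    by (auto intro!: prod_zero)
  finally show ?thesis .
qed

text \<open>Fubini applies because the integrand has modulus one on a finite measure space;
  orthogonality then leaves only the atom \<open>r = w\<close>.\<close>

lemma fourier_inversion:
  fixes A :: "(nat ^ 'd::finite) pmf"
  shows "complex_of_real ((2 * pi) ^ CARD('d) * pmf A w) =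
    (\<integral>t. indicator (cbox (\<chi> i. -pi) (\<chi> i. pi)) t *\<^sub>R (fourier A t * cis (- (t \<bullet> real_vec w))) \<partial>lborel)"
proof -
  let ?B = "cbox (\<chi> i. -pi) (\<chi> i. pi) :: (real ^ 'd) set"
  let ?M = "restrict_space lborel ?B"
  have fin: "finite_measure ?M"
    by (rule finite_measureI)
       (simp add: emeasure_restrict_space space_restrict_space emeasure_lborel_cbox_eq)
  interpret M: finite_measure ?M by fact
  interpret P: pair_sigma_finite "measure_pmf A" ?M ..
  interpret PF: finite_measure "measure_pmf A \<Otimes>\<^sub>M ?M"
    by (rule finite_measure_pair_measure) (auto intro: fin measure_pmf.finite_measure_axioms)
  let ?f = "\<lambda>r t. cis (t \<bullet> (real_vec r - real_vec w))"
  have meas: "case_prod ?f \<in> borel_measurable (measure_pmf A \<Otimes>\<^sub>M ?M)"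
  proof -
    have "case_prod ?f \<in> borel_measurable (count_space UNIV \<Otimes>\<^sub>M ?M)"
      by (rule measurable_pair_measure_countable1)
         (auto intro!: measurable_restrict_space1 borel_measurable_continuous_onI continuous_intros)
    also have "borel_measurable (count_space UNIV \<Otimes>\<^sub>M ?M) = borel_measurable (measure_pmf A \<Otimes>\<^sub>M ?M)"
      by (intro measurable_cong_sets sets_pair_measure_cong) simp_all
    finally show ?thesis .
  qed
  have int: "integrable (measure_pmf A \<Otimes>\<^sub>M ?M) (case_prod ?f)"
    by (rule PF.integrable_const_bound[of _ 1]) (use meas in auto)
  have "(\<integral>t. indicator ?B t *\<^sub>R (fourier A t * cis (- (t \<bullet> real_vec w))) \<partial>lborel) =
      (\<integral>t. fourier A t * cis (- (t \<bullet> real_vec w)) \<partial>?M)"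
    by (subst integral_restrict_space) (auto simp: )
  also have "\<dots> = (\<integral>t. \<integral>r. ?f r t \<partial>A \<partial>?M)"
    unfolding fourier_def
    by (intro Bochner_Integration.integral_cong refl, subst integral_mult_left_zero[symmetric])
       (simp add: cis_mult inner_diff_right)
  also have "\<dots> = (\<integral>r. \<integral>t. ?f r t \<partial>?M \<partial>A)"
    by (rule P.Fubini_integral[OF int])
  also have "\<dots> = (\<integral>r. indicator {w} r *\<^sub>R complex_of_real ((2 * pi) ^ CARD('d)) \<partial>A)"
  proof (intro Bochner_Integration.integral_cong refl)
    fix r
    have "real_vec r - real_vec w = (\<chi> i. of_int (int (r $ i) - int (w $ i)))"
      by (simp add: vec_eq_iff)
    then have "(\<integral>t. ?f r t \<partial>?M) = (if \<forall>i. int (r $ i) - int (w $ i) = 0 then complex_of_real ((2 * pi) ^ CARD('d)) else 0)"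
      by (subst integral_restrict_space) (simp_all only: integral_cis_box, simp_all)
    then show "(\<integral>t. ?f r t \<partial>?M) = indicator {w} r *\<^sub>R complex_of_real ((2 * pi) ^ CARD('d))"
      by (auto simp: vec_eq_iff indicator_def)
  qed
  also have "\<dots> = complex_of_real ((2 * pi) ^ CARD('d) * pmf A w)"
    by (simp add: measure_pmf_single scaleR_conv_of_real mult.commute)
  finally show ?thesis by simp
qed

lemma one_minus_cos_ge:
  fixes x :: real
  assumes "\<bar>x\<bar> \<le> pi"
  shows "x\<^sup>2 / 8 \<le> 1 - cos x"
proof -
  have small: "z * cos z \<le> sin z" if "0 \<le> z" "z \<le> pi / 2" for z
  proof (cases "z = 0")
    case False
    then have "\<exists>\<xi>. 0 < \<xi> \<and> \<xi> < z \<and> sin z - sin 0 = (z - 0) * cos \<xi>"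
      using that by (intro MVT2) (auto intro!: derivative_eq_intros)
    then obtain \<xi> where \<xi>: "0 < \<xi>" "\<xi> < z" "sin z = z * cos \<xi>" by auto
    then have "cos z \<le> cos \<xi>"
      using that pi_gt_zero by (intro cos_monotone_0_pi_le) linarith+
    then show ?thesis using \<xi> that by (simp add: mult_left_mono)
  qed simp
  \<comment> \<open>With \<open>z = y / 2\<close> the chain is
    \<open>sin y = 2 sin z cos z \<ge> 2 z (cos z)^2 \<ge> z\<close>, the last step because
    \<open>z \<le> pi / 4\<close> forces \<open>(cos z)^2 \<ge> 1 / 2\<close>.\<close>
  have half: "y / 2 \<le> sin y" if "0 \<le> y" "y \<le> pi / 2" for y
  proof -
    define z where "z = y / 2"
    have z: "0 \<le> z" "z \<le> pi / 4" "y = 2 * z" using that by (auto simp: z_def)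
    have c: "cos (pi / 4) \<le> cos z" using z pi_gt_zero by (intro cos_monotone_0_pi_le) linarith+
    have c2: "1 / 2 \<le> (cos z)\<^sup>2"
    proof -
      have "(sqrt 2 / 2)\<^sup>2 \<le> (cos z)\<^sup>2"
        using c by (intro power_mono) (simp_all add: cos_45)
      then show ?thesis by (simp add: power_divide)
    qed
    have "z \<le> 2 * (z * (cos z)\<^sup>2)" using mult_left_mono[OF c2, of z] z by simp
    also have "\<dots> = 2 * (z * cos z) * cos z" by (simp add: power2_eq_square)
    also have "\<dots> \<le> 2 * sin z * cos z"
    proof (intro mult_right_mono)
      show "0 \<le> cos z" using z pi_gt_zero by (intro cos_ge_zero) linarith+
    qed (use small[of z] z pi_gt_zero in auto)
    also have "\<dots> = sin y" by (simp add: z sin_double)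
    finally show ?thesis by (simp add: z_def)
  qed
  have "\<bar>x\<bar> / 4 \<le> sin (\<bar>x\<bar> / 2)" using half[of "\<bar>x\<bar> / 2"] assms by simp
  then have "(\<bar>x\<bar> / 4)\<^sup>2 \<le> (sin (\<bar>x\<bar> / 2))\<^sup>2" by (intro power_mono) auto
  moreover have "cos x = 1 - 2 * (sin (\<bar>x\<bar> / 2))\<^sup>2"
    using cos_double_sin[of "\<bar>x\<bar> / 2"] by simp
  ultimately show ?thesis by (simp add: power_divide)
qed

lemma integrable_exp_neg_norm_sq:
  fixes c :: real
  assumes "c > 0"
  shows "integrable lborel (\<lambda>t :: real ^ 'd::finite. exp (- c * (norm t)\<^sup>2))"
proof (rule integrableI_nonneg)
  define \<sigma> where "\<sigma> = sqrt (1 / (2 * c))"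
  have \<sigma>: "\<sigma> > 0" "\<sigma>\<^sup>2 = 1 / (2 * c)" using assms by (auto simp: \<sigma>_def)
  have "exp (- c * x\<^sup>2) = sqrt (2 * pi * \<sigma>\<^sup>2) * normal_density 0 \<sigma> x" for x
    using \<sigma> assms by (simp add: normal_density_def)
  then have int: "integrable lborel (\<lambda>x. exp (- c * x\<^sup>2))"
    using \<sigma> by simp
  have "(\<integral>\<^sup>+t. ennreal (exp (- c * (norm t)\<^sup>2)) \<partial>(lborel :: (real ^ 'd) measure)) =
      (\<integral>\<^sup>+t. (\<Prod>b\<in>Basis. ennreal (exp (- c * (t \<bullet> b)\<^sup>2))) \<partial>(lborel :: (real ^ 'd) measure))"
  proof (intro nn_integral_cong)
    fix t :: "real ^ 'd"
    have "(norm t)\<^sup>2 = (\<Sum>b\<in>Basis. (t \<bullet> b)\<^sup>2)"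
      unfolding power2_norm_eq_inner by (subst euclidean_inner) (simp only: power2_eq_square)
    then have "exp (- c * (norm t)\<^sup>2) = (\<Prod>b\<in>Basis. exp (- c * (t \<bullet> b)\<^sup>2))"
      unfolding exp_sum[OF finite_Basis, symmetric] sum_distrib_left[symmetric] by simp
    then show "ennreal (exp (- c * (norm t)\<^sup>2)) = (\<Prod>b\<in>Basis. ennreal (exp (- c * (t \<bullet> b)\<^sup>2)))"
      by (simp add: prod_ennreal)
  qed
  also have "\<dots> = (\<Prod>b\<in>(Basis :: (real ^ 'd) set). \<integral>\<^sup>+x. ennreal (exp (- c * x\<^sup>2)) \<partial>lborel)"
    by (rule nn_integral_lborel_prod) auto
  also have "\<dots> < \<infinity>"
    using nn_integral_eq_integral[OF int] by (simp add: power_less_top_ennreal)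
  finally show "(\<integral>\<^sup>+t. ennreal (exp (- c * (norm t)\<^sup>2)) \<partial>(lborel :: (real ^ 'd) measure)) < \<infinity>" .
qed auto

lemma borel_measurable_fourier [measurable]: "fourier A \<in> borel_measurable borel"
proof -
  have "(\<lambda>(r, t). cis (t \<bullet> real_vec r)) \<in> borel_measurable (count_space UNIV \<Otimes>\<^sub>M borel)"
    by (rule measurable_pair_measure_countable1)
       (auto intro!: borel_measurable_continuous_onI continuous_intros)
  also have "borel_measurable (count_space UNIV \<Otimes>\<^sub>M borel) = borel_measurable (measure_pmf A \<Otimes>\<^sub>M borel)"
    by (intro measurable_cong_sets sets_pair_measure_cong) simp_all
  finally have "(\<lambda>(t, r). cis (t \<bullet> real_vec r)) \<in> borel_measurable (borel \<Otimes>\<^sub>M measure_pmf A)"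
    by (subst (asm) measurable_pair_swap_iff) (simp add: case_prod_unfold)
  then show ?thesis
    unfolding fourier_def[abs_def] by (rule measure_pmf.borel_measurable_lebesgue_integral)
qed

lemma lborel_integral_scaleR:
  fixes f :: "'a::euclidean_space \<Rightarrow> complex"
  assumes "c > 0" and [measurable]: "f \<in> borel_measurable borel"
  shows "(\<integral>x. f x \<partial>lborel) = c ^ DIM('a) *\<^sub>R (\<integral>x. f (c *\<^sub>R x) \<partial>lborel)"
  by (subst lborel_affine[of c 0])
     (use assms in \<open>simp_all add: integral_density integral_distr\<close>)

text \<open>The hypothesis bounds every squared coordinate of \<open>t\<close> in the box by a
  multiple of \<open>1 - \<bar>fourier A t\<bar>^2\<close>; summing over the coordinates and using
  \<open>1 + x \<le> exp x\<close> gives a Gaussian.\<close>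

lemma fourier_gaussian_bound:
  fixes A :: "(nat ^ 'd::finite) pmf"
  assumes "\<And>l. \<exists>C. \<forall>t. 1 - cos (t $ l) \<le> C * (1 - (cmod (fourier A t))\<^sup>2)"
  obtains c where "c > 0"
    "\<And>t. t \<in> cbox (\<chi> i. -pi) (\<chi> i. pi) \<Longrightarrow> cmod (fourier A t) \<le> exp (- c * (norm t)\<^sup>2)"
proof -
  obtain C where C: "\<And>l t. 1 - cos (t $ l) \<le> C l * (1 - (cmod (fourier A t))\<^sup>2)"
    using assms by metis
  define S where "S = 1 + (\<Sum>l\<in>UNIV. \<bar>C l\<bar>)"
  have S: "S > 0" unfolding S_def by (rule add_pos_nonneg) (auto intro: sum_nonneg)
  \<comment> \<open>The factor 8 is that of \<open>one_minus_cos_ge\<close>, \<open>S\<close>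
    dominates the constants of all coordinates, the dimension comes from summing squares, and the
    remaining 2 from taking a square root at the end.\<close>
  define c where "c = 1 / (16 * S * CARD('d))"
  have c: "c > 0" using S by (simp add: c_def)
  show thesis
  proof (rule that[OF c])
    fix t :: "real ^ 'd" assume t: "t \<in> cbox (\<chi> i. -pi) (\<chi> i. pi)"
    define D where "D = 1 - (cmod (fourier A t))\<^sup>2"
    have D: "D \<ge> 0" using cmod_fourier_le_1[of A t] by (simp add: D_def power_le_one)
    have "(t $ l)\<^sup>2 \<le> 8 * S * D" for l
    proof -
      have "\<bar>t $ l\<bar> \<le> pi" using t by (auto simp: mem_box_cart abs_le_iff minus_le_iff)
      then have "(t $ l)\<^sup>2 / 8 \<le> 1 - cos (t $ l)" by (rule one_minus_cos_ge)
      also have "\<dots> \<le> C l * D" unfolding D_def by (rule C)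
      also have "\<dots> \<le> S * D"
      proof (rule mult_right_mono[OF _ D])
        have "\<bar>C l\<bar> \<le> (\<Sum>l\<in>UNIV. \<bar>C l\<bar>)" by (rule member_le_sum) auto
        then show "C l \<le> S" by (simp add: S_def)
      qed
      finally show ?thesis by simp
    qed
    then have "(\<Sum>l\<in>UNIV. (t $ l)\<^sup>2) \<le> (\<Sum>l\<in>(UNIV :: 'd set). 8 * S * D)"
      by (intro sum_mono)
    moreover have "(norm t)\<^sup>2 = (\<Sum>l\<in>UNIV. (t $ l)\<^sup>2)"
      unfolding power2_norm_eq_inner inner_vec_def by (simp add: power2_eq_square)
    ultimately have "2 * c * (norm t)\<^sup>2 \<le> D"
      using S by (simp add: c_def field_simps)
    then have "(cmod (fourier A t))\<^sup>2 \<le> 1 + (- 2 * c * (norm t)\<^sup>2)" by (simp add: D_def)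
    also have "\<dots> \<le> exp (- 2 * c * (norm t)\<^sup>2)" by (rule exp_ge_add_one_self)
    also have "\<dots> = (exp (- c * (norm t)\<^sup>2))\<^sup>2" by (simp add: exp_double[symmetric])
    finally show "cmod (fourier A t) \<le> exp (- c * (norm t)\<^sup>2)"
      by (rule power2_le_imp_le) simp
  qed
qed

text \<open>The variance may vanish: the lemma is applied to the centred projections onto all
  directions, the zero vector included.\<close>

lemma (in prob_space) char_power_tendsto:
  assumes [measurable]: "random_variable borel Y"
    and int1: "integrable M Y" and int2: "integrable M (\<lambda>x. (Y x)\<^sup>2)"
    and mean: "expectation Y = 0"
  shows "(\<lambda>n. char (distr M borel Y) (1 / sqrt (real n)) ^ n) \<longlonglongrightarrow>
    complex_of_real (exp (- (expectation (\<lambda>x. (Y x)\<^sup>2) / 2)))"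
proof -
  define \<sigma> where "\<sigma> = expectation (\<lambda>x. (Y x)\<^sup>2)"
  have var: "variance Y = \<sigma>" by (simp add: mean \<sigma>_def)
  have \<sigma>: "\<sigma> \<ge> 0" by (simp add: \<sigma>_def)
  interpret D: real_distribution "distr M borel Y" by (rule real_distribution_distr) simp
  let ?R = "\<lambda>n. expectation (\<lambda>x. min (6 * (Y x)\<^sup>2) (\<bar>1 / sqrt n\<bar> * \<bar>Y x\<bar> ^ 3))"
  have main: "\<forall>\<^sub>F n in sequentially.
      cmod (char (distr M borel Y) (1 / sqrt (real n)) ^ n - complex_of_real ((1 + (- (\<sigma> / 2)) / real n) ^ n))
      \<le> ?R n / 6"
  proof (rule eventually_sequentiallyI)
    \<comment> \<open>For \<open>n \<ge> \<sigma>\<close> the number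
      \<open>1 - \<sigma> / (2 n)\<close> has modulus at most one, as the comparison of
      \<open>n\<close>-th powers requires.\<close>
    fix n :: nat assume "n \<ge> nat (ceiling \<sigma>) + 1"
    then have n: "real n \<ge> \<sigma>" "n > 0" by linarith+
    let ?t = "1 / sqrt (real n)"
    have "cmod (char (distr M borel Y) ?t - (1 - ?t\<^sup>2 * \<sigma> / 2)) \<le> ?t\<^sup>2 / 6 * ?R n"
      by (rule char_approx3') (use int1 int2 mean var in auto)
    then have b: "cmod (char (distr M borel Y) ?t - complex_of_real (1 + (- (\<sigma> / 2)) / real n)) \<le> ?R n / 6 / n"
      using n by (simp add: power_divide mult.commute)
    have "cmod (char (distr M borel Y) ?t ^ n - complex_of_real (1 + (- (\<sigma> / 2)) / real n) ^ n) \<le>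
        n * cmod (char (distr M borel Y) ?t - complex_of_real (1 + (- (\<sigma> / 2)) / real n))"
    proof (rule norm_power_diff)
      have "\<bar>1 + (- (\<sigma> / 2)) / real n\<bar> \<le> 1"
        using n \<sigma> by (auto simp: abs_le_iff field_simps)
      then show "cmod (complex_of_real (1 + (- (\<sigma> / 2)) / real n)) \<le> 1"
        by (simp only: norm_of_real)
    qed (rule D.cmod_char_le_1)
    also have "\<dots> \<le> n * (?R n / 6 / n)" by (intro mult_left_mono b) simp
    finally show "cmod (char (distr M borel Y) ?t ^ n - complex_of_real ((1 + (- (\<sigma> / 2)) / real n) ^ n)) \<le> ?R n / 6"
      using n by simp
  qed
  have "(\<lambda>n. ?R n) \<longlonglongrightarrow> expectation (\<lambda>x. 0)"
  proof (rule integral_dominated_convergence[where w = "\<lambda>x. 6 * (Y x)\<^sup>2"])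
    have "(\<lambda>n. min (6 * y\<^sup>2) (\<bar>1 / sqrt n\<bar> * \<bar>y\<bar> ^ 3)) \<longlonglongrightarrow> min (6 * y\<^sup>2) (\<bar>0\<bar> * \<bar>y\<bar> ^ 3)" for y :: real
      by (intro tendsto_intros tendsto_divide_0[OF tendsto_const]
          filterlim_at_top_imp_at_infinity sqrt_at_top[THEN filterlim_compose] filterlim_real_sequentially)
    then show "AE x in M. (\<lambda>n. min (6 * (Y x)\<^sup>2) (\<bar>1 / sqrt n\<bar> * \<bar>Y x\<bar> ^ 3)) \<longlonglongrightarrow> 0"
      by (simp add: min_absorb2)
  qed (use int2 in auto)
  then have R: "(\<lambda>n. ?R n / 6) \<longlonglongrightarrow> 0"
    using tendsto_divide[of ?R 0 sequentially "\<lambda>_. 6" 6] by simp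
  have "(\<lambda>n. complex_of_real ((1 + (- (\<sigma> / 2)) / real n) ^ n)) \<longlonglongrightarrow> complex_of_real (exp (- (\<sigma> / 2)))"
    by (intro tendsto_of_real tendsto_exp_limit_sequentially)
  then show ?thesis
    unfolding \<sigma>_def[symmetric]
    by (rule Lim_transform) (rule Lim_null_comparison[OF main R])
qed

lemma tendsto_bounded_over_sqrt:
  fixes z :: "nat \<Rightarrow> real ^ 'd::finite"
  assumes N: "filterlim N at_top sequentially" and bd: "\<And>i. \<exists>B. \<forall>\<^sub>F n in sequentially. \<bar>z n $ i\<bar> \<le> B"
  shows "(\<lambda>n. z n /\<^sub>R sqrt (real (N n))) \<longlonglongrightarrow> 0"
proof (rule vec_tendstoI)
  fix i
  obtain B where B: "\<forall>\<^sub>F n in sequentially. \<bar>z n $ i\<bar> \<le> B" using bd by blast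
  have "filterlim (\<lambda>n. sqrt (real (N n))) at_top sequentially"
    by (intro sqrt_at_top[THEN filterlim_compose] filterlim_compose[OF filterlim_real_sequentially N])
  then have "(\<lambda>n. inverse (sqrt (real (N n)))) \<longlonglongrightarrow> 0" by (rule tendsto_inverse_0_at_top)
  then have "(\<lambda>n. inverse (sqrt (real (N n))) * B) \<longlonglongrightarrow> 0 * B" by (rule tendsto_mult) simp
  then have lim: "(\<lambda>n. inverse (sqrt (real (N n))) * B) \<longlonglongrightarrow> 0" by simp
  have "(\<lambda>n. (z n /\<^sub>R sqrt (real (N n))) $ i) \<longlonglongrightarrow> 0"
    by (rule Lim_null_comparison[OF _ lim])
       (use B in \<open>eventually_elim, auto simp: abs_mult intro!: mult_left_mono\<close>)
  then show "(\<lambda>n. (z n /\<^sub>R sqrt (real (N n))) $ i) \<longlonglongrightarrow> 0 $ i" by simp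
qed

text \<open>The substitution \<open>t = \<tau> / sqrt n\<close> in the inversion formula gives
  integrands dominated by one Gaussian, whose integral is the uniform bound and which allows passing
  to the limit. End points within \<open>o(sqrt n)\<close> of the mean all see the centre of the
  limiting density, so \<open>L\<close> is one constant. The number of steps is a sequence
  \<open>N\<close> because it will be the component of type \<open>\<tau>\<close> of the
  target.\<close>

theorem local_limit_theorem:
  fixes A :: "(nat ^ 'd::finite) pmf"
  assumes sq: "integrable (measure_pmf A) (\<lambda>r. (norm (real_vec r))\<^sup>2)"
    and aperiodic: "\<And>l. \<exists>C. \<forall>t. 1 - cos (t $ l) \<le> C * (1 - (cmod (fourier A t))\<^sup>2)"
  defines "\<mu> \<equiv> measure_pmf.expectation A real_vec"
  obtains L B where "L > 0"
    "\<And>n w. n > 0 \<Longrightarrow> sqrt (real n) ^ CARD('d) * pmf (conv_power A n) w \<le> B"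
    "\<And>N w. filterlim N at_top sequentially \<Longrightarrow>
       (\<lambda>n. (real_vec (w n) - real (N n) *\<^sub>R \<mu>) /\<^sub>R sqrt (real (N n))) \<longlonglongrightarrow> 0 \<Longrightarrow>
       (\<lambda>n. sqrt (real (N n)) ^ CARD('d) * pmf (conv_power A (N n)) (w n)) \<longlonglongrightarrow> L"
proof -
  obtain c where c: "c > 0"
    "\<And>t. t \<in> cbox (\<chi> i. -pi) (\<chi> i. pi) \<Longrightarrow> cmod (fourier A t) \<le> exp (- c * (norm t)\<^sup>2)"
    using fourier_gaussian_bound[OF aperiodic] by blast
  let ?B = "cbox (\<chi> i. -pi) (\<chi> i. pi) :: (real ^ 'd) set"
  define V where "V = (2 * pi) ^ CARD('d)"
  have V: "V > 0" by (simp add: V_def)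
  define I where "I n w \<tau> = indicator ?B (\<tau> /\<^sub>R sqrt (real n)) *\<^sub>R
      (fourier A (\<tau> /\<^sub>R sqrt (real n)) ^ n * cis (- ((\<tau> /\<^sub>R sqrt (real n)) \<bullet> real_vec w)))" for n w \<tau>
  have [measurable]: "(\<lambda>t. cis (- (t \<bullet> z))) \<in> borel_measurable borel" for z :: "real ^ 'd"
    by (intro borel_measurable_continuous_onI continuous_intros)
  have [measurable]: "I n w \<in> borel_measurable borel" for n w
    unfolding I_def[abs_def] by measurable
  have inv: "complex_of_real (V * (sqrt (real n) ^ CARD('d) * pmf (conv_power A n) w)) = (\<integral>\<tau>. I n w \<tau> \<partial>lborel)"
    if "n > 0" for n w
  proof -
    have "complex_of_real (V * pmf (conv_power A n) w) =
        (\<integral>t. indicator ?B t *\<^sub>R (fourier A t ^ n * cis (- (t \<bullet> real_vec w))) \<partial>lborel)"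
      unfolding V_def by (subst fourier_inversion) (simp add: fourier_conv_power)
    also have "\<dots> = (inverse (sqrt (real n))) ^ CARD('d) *\<^sub>R (\<integral>\<tau>. I n w \<tau> \<partial>lborel)"
      unfolding I_def using that
      by (subst lborel_integral_scaleR[of "inverse (sqrt (real n))"]) simp_all
    finally have "complex_of_real (sqrt (real n) ^ CARD('d)) * complex_of_real (V * pmf (conv_power A n) w) =
        (complex_of_real (sqrt (real n)) ^ CARD('d) * (inverse (complex_of_real (sqrt (real n)))) ^ CARD('d)) * (\<integral>\<tau>. I n w \<tau> \<partial>lborel)"
      by (simp add: scaleR_conv_of_real)
    also have "complex_of_real (sqrt (real n)) ^ CARD('d) * (inverse (complex_of_real (sqrt (real n)))) ^ CARD('d) = 1"
      using that by (simp flip: power_mult_distrib)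
    finally show ?thesis by (simp add: mult_ac)
  qed
  have bound: "norm (I n w \<tau>) \<le> exp (- c * (norm \<tau>)\<^sup>2)" if "n > 0" for n w \<tau>
  proof (cases "\<tau> /\<^sub>R sqrt (real n) \<in> ?B")
    case True
    have "norm (I n w \<tau>) = cmod (fourier A (\<tau> /\<^sub>R sqrt (real n))) ^ n"
      using True by (simp add: I_def norm_mult norm_power)
    also have "\<dots> \<le> exp (- c * (norm (\<tau> /\<^sub>R sqrt (real n)))\<^sup>2) ^ n"
      by (intro power_mono c True) simp
    also have "\<dots> = exp (real n * (- c * (norm (\<tau> /\<^sub>R sqrt (real n)))\<^sup>2))"
      by (rule exp_of_nat_mult[symmetric])
    also have "\<dots> = exp (- c * (norm \<tau>)\<^sup>2)"
      using that by (simp add: power_mult_distrib power_divide field_simps)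
    finally show ?thesis .
  qed (simp add: I_def)
  have gauss: "integrable lborel (\<lambda>t :: real ^ 'd. exp (- c * (norm t)\<^sup>2))"
    by (rule integrable_exp_neg_norm_sq) fact
  have int_I: "integrable lborel (I n w)" if "n > 0" for n w
    by (rule Bochner_Integration.integrable_bound[OF gauss]) (use bound[OF that] in auto)

  have intv: "integrable (measure_pmf A) real_vec"
  proof (rule Bochner_Integration.integrable_bound)
    show "integrable (measure_pmf A) (\<lambda>r. 1 + (norm (real_vec r))\<^sup>2)" using sq by simp
    show "AE r in measure_pmf A. norm (real_vec r) \<le> norm (1 + (norm (real_vec r))\<^sup>2)"
    proof (rule AE_I2)
      fix r :: "nat ^ 'd"
      have "2 * norm (real_vec r) \<le> 1 + (norm (real_vec r))\<^sup>2"
        using zero_le_power2[of "norm (real_vec r) - 1"] by (simp add: power2_diff)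
      then have "norm (real_vec r) \<le> 1 + (norm (real_vec r))\<^sup>2"
        using norm_ge_zero[of "real_vec r"] by linarith
      then show "norm (real_vec r) \<le> norm (1 + (norm (real_vec r))\<^sup>2)"
        by simp
    qed
  qed auto
  define \<sigma> where "\<sigma> \<tau> = measure_pmf.expectation A (\<lambda>r. (\<tau> \<bullet> (real_vec r - \<mu>))\<^sup>2)" for \<tau>
  have point: "(\<lambda>n. I (N n) (w n) \<tau>) \<longlonglongrightarrow> complex_of_real (exp (- (\<sigma> \<tau> / 2)))"
    if N: "filterlim N at_top sequentially"
      and w: "(\<lambda>n. (real_vec (w n) - real (N n) *\<^sub>R \<mu>) /\<^sub>R sqrt (real (N n))) \<longlonglongrightarrow> 0" for N w \<tau>
  proof -
    define Y where "Y r = \<tau> \<bullet> (real_vec r - \<mu>)" for r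
    have sqN: "filterlim (\<lambda>n. sqrt (real (N n))) at_top sequentially"
      by (intro sqrt_at_top[THEN filterlim_compose] filterlim_compose[OF filterlim_real_sequentially N])
    have inv0: "(\<lambda>n. inverse (sqrt (real (N n)))) \<longlonglongrightarrow> 0"
      by (rule tendsto_inverse_0_at_top[OF sqN])
    have intY: "integrable (measure_pmf A) Y" unfolding Y_def using intv by simp
    have intY2: "integrable (measure_pmf A) (\<lambda>r. (Y r)\<^sup>2)"
    proof (rule Bochner_Integration.integrable_bound)
      show "integrable (measure_pmf A) (\<lambda>r. (norm \<tau>)\<^sup>2 * (2 * (norm (real_vec r))\<^sup>2 + 2 * (norm \<mu>)\<^sup>2))"
        using sq by simp
      show "AE r in measure_pmf A. norm ((Y r)\<^sup>2) \<le>
          norm ((norm \<tau>)\<^sup>2 * (2 * (norm (real_vec r))\<^sup>2 + 2 * (norm \<mu>)\<^sup>2))"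
      proof (rule AE_I2)
        fix r :: "nat ^ 'd"
        have "\<bar>Y r\<bar> \<le> norm \<tau> * norm (real_vec r - \<mu>)" unfolding Y_def by (rule Cauchy_Schwarz_ineq2)
        also have "\<dots> \<le> norm \<tau> * (norm (real_vec r) + norm \<mu>)"
          by (intro mult_left_mono norm_triangle_ineq4) simp
        finally have "\<bar>Y r\<bar>\<^sup>2 \<le> (norm \<tau> * (norm (real_vec r) + norm \<mu>))\<^sup>2"
          by (intro power_mono) auto
        also have "\<dots> \<le> (norm \<tau>)\<^sup>2 * (2 * (norm (real_vec r))\<^sup>2 + 2 * (norm \<mu>)\<^sup>2)"
          unfolding power_mult_distrib
          using zero_le_power2[of "norm (real_vec r) - norm \<mu>"]
          by (intro mult_left_mono) (auto simp: power2_sum power2_diff)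
        finally show "norm ((Y r)\<^sup>2) \<le> norm ((norm \<tau>)\<^sup>2 * (2 * (norm (real_vec r))\<^sup>2 + 2 * (norm \<mu>)\<^sup>2))"
          by simp
      qed
    qed auto
    have meanY: "measure_pmf.expectation A Y = 0"
      unfolding Y_def using intv by (simp add: \<mu>_def)
    \<comment> \<open>Centring costs only a phase; together with the phase of the end point it
      becomes the rescaled distance of \<open>w\<close> from the mean, which tends to zero.\<close>
    have char: "char (distr (measure_pmf A) borel Y) s = fourier A (s *\<^sub>R \<tau>) * cis (- (s * (\<tau> \<bullet> \<mu>)))" for s
      unfolding char_def fourier_def
      by (subst integral_distr, simp, simp, subst integral_mult_left_zero[symmetric])
         (simp add: Y_def cis_mult inner_diff_right right_diff_distrib, simp add: cis_conv_exp right_diff_distrib)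
    have "(\<lambda>n. char (distr (measure_pmf A) borel Y) (1 / sqrt (real (N n))) ^ N n) \<longlonglongrightarrow>
        complex_of_real (exp (- (\<sigma> \<tau> / 2)))"
      using filterlim_compose[OF measure_pmf.char_power_tendsto[OF _ intY intY2 meanY] N]
      by (simp add: \<sigma>_def Y_def)
    moreover have "(\<lambda>n. cis (- (\<tau> \<bullet> ((real_vec (w n) - real (N n) *\<^sub>R \<mu>) /\<^sub>R sqrt (real (N n)))))) \<longlonglongrightarrow> cis (- (\<tau> \<bullet> 0))"
      by (intro tendsto_intros w)
    moreover have "(\<lambda>n. indicator ?B (\<tau> /\<^sub>R sqrt (real (N n))) :: real) \<longlonglongrightarrow> 1"
    proof (rule tendsto_eventually)
      have "(\<lambda>n. \<tau> /\<^sub>R sqrt (real (N n))) \<longlonglongrightarrow> 0 *\<^sub>R \<tau>"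
        by (intro tendsto_intros inv0)
      moreover have "open (box (\<chi> i. -pi) (\<chi> i. pi) :: (real ^ 'd) set)" by (rule open_box)
      moreover have "0 *\<^sub>R \<tau> \<in> box (\<chi> i. -pi) (\<chi> i. pi)" by (simp add: mem_box_cart)
      ultimately have "\<forall>\<^sub>F n in sequentially. \<tau> /\<^sub>R sqrt (real (N n)) \<in> box (\<chi> i. -pi) (\<chi> i. pi)"
        by (rule topological_tendstoD)
      then show "\<forall>\<^sub>F n in sequentially. indicator ?B (\<tau> /\<^sub>R sqrt (real (N n))) = (1 :: real)"
        by eventually_elim (auto simp: mem_box_cart indicator_def less_imp_le)
    qed
    ultimately have "(\<lambda>n. indicator ?B (\<tau> /\<^sub>R sqrt (real (N n))) *\<^sub>R
        (char (distr (measure_pmf A) borel Y) (1 / sqrt (real (N n))) ^ N n *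
         cis (- (\<tau> \<bullet> ((real_vec (w n) - real (N n) *\<^sub>R \<mu>) /\<^sub>R sqrt (real (N n)))))))
        \<longlonglongrightarrow> 1 *\<^sub>R (complex_of_real (exp (- (\<sigma> \<tau> / 2))) * cis (- (\<tau> \<bullet> 0)))"
      by (intro tendsto_scaleR tendsto_mult)
    moreover have "indicator ?B (\<tau> /\<^sub>R sqrt (real (N n))) *\<^sub>R
        (char (distr (measure_pmf A) borel Y) (1 / sqrt (real (N n))) ^ N n *
         cis (- (\<tau> \<bullet> ((real_vec (w n) - real (N n) *\<^sub>R \<mu>) /\<^sub>R sqrt (real (N n)))))) = I (N n) (w n) \<tau>" for n
      unfolding I_def char power_mult_distrib Complex.DeMoivre
      by (simp add: mult.assoc cis_mult inner_diff_right algebra_simps inverse_eq_divide)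
    ultimately show ?thesis by simp
  qed
  \<comment> \<open>Measurability and the Gaussian bound of the limit function are inherited from
    the integrands along a convergent sequence, so at least one such sequence must be
    exhibited.\<close>
  obtain N\<^sub>0 w\<^sub>0 where N\<^sub>0: "filterlim N\<^sub>0 at_top sequentially"
    and w\<^sub>0: "(\<lambda>n. (real_vec (w\<^sub>0 n) - real (N\<^sub>0 n) *\<^sub>R \<mu>) /\<^sub>R sqrt (real (N\<^sub>0 n))) \<longlonglongrightarrow> 0"
  proof -
    define N where "N n = n" for n :: nat
    define w where "w n = floor_vec (real n *\<^sub>R \<mu>)" for n :: nat
    have N: "filterlim N at_top sequentially" by (simp add: N_def[abs_def] filterlim_ident)
    have \<mu>0: "\<mu> $ i \<ge> 0" for i
    proof -
      have "\<mu> $ i = measure_pmf.expectation A (\<lambda>r. real_vec r $ i)"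
        unfolding \<mu>_def using integral_inner_left[OF intv, of "axis i 1"] by (simp add: inner_axis)
      then show ?thesis by simp
    qed
    have "(\<lambda>n. (real_vec (w n) - real (N n) *\<^sub>R \<mu>) /\<^sub>R sqrt (real (N n))) \<longlonglongrightarrow> 0"
    proof (rule tendsto_bounded_over_sqrt[OF N])
      fix i
      have "\<bar>(real_vec (w n) - real (N n) *\<^sub>R \<mu>) $ i\<bar> \<le> 1" for n
        using \<mu>0[of i] by (simp add: w_def N_def floor_vec_def of_nat_nat) linarith
      then show "\<exists>B. \<forall>\<^sub>F n in sequentially. \<bar>(real_vec (w n) - real (N n) *\<^sub>R \<mu>) $ i\<bar> \<le> B"
        by (blast intro: always_eventually)
    qed
    with N show thesis by (rule that)
  qed
  have [measurable]: "(\<lambda>\<tau>. complex_of_real (exp (- (\<sigma> \<tau> / 2)))) \<in> borel_measurable borel"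
    using point[OF N\<^sub>0 w\<^sub>0] by (rule borel_measurable_LIMSEQ_metric[rotated]) measurable
  have int_\<sigma>: "integrable lborel (\<lambda>\<tau>. complex_of_real (exp (- (\<sigma> \<tau> / 2))))"
  proof (rule Bochner_Integration.integrable_bound[OF gauss])
    show "AE \<tau> in lborel. norm (complex_of_real (exp (- (\<sigma> \<tau> / 2)))) \<le> norm (exp (- c * (norm \<tau>)\<^sup>2))"
    proof (rule AE_I2)
      fix \<tau>
      have ev: "\<forall>\<^sub>F n in sequentially. N\<^sub>0 n > 0"
        using N\<^sub>0 by (metis eventually_gt_at_top filterlim_iff)
      have "norm (complex_of_real (exp (- (\<sigma> \<tau> / 2)))) \<le> exp (- c * (norm \<tau>)\<^sup>2)"
        by (rule tendsto_upperbound[OF tendsto_norm[OF point[OF N\<^sub>0 w\<^sub>0]]])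
           (rule eventually_mono[OF ev], erule bound, simp)
      then show "norm (complex_of_real (exp (- (\<sigma> \<tau> / 2)))) \<le> norm (exp (- c * (norm \<tau>)\<^sup>2))"
        by simp
    qed
  qed simp
  define L where "L = (\<integral>\<tau>. exp (- (\<sigma> \<tau> / 2)) \<partial>lborel)"
  show thesis
  proof (rule that)
    fix n :: nat and w assume n: "n > 0"
    have "V * (sqrt (real n) ^ CARD('d) * pmf (conv_power A n) w) =
        norm (complex_of_real (V * (sqrt (real n) ^ CARD('d) * pmf (conv_power A n) w)))"
      unfolding norm_of_real using V by simp
    also have "\<dots> \<le> (\<integral>\<tau>. exp (- c * (norm \<tau>)\<^sup>2) \<partial>(lborel :: (real ^ 'd) measure))"
      unfolding inv[OF n]
      by (rule Bochner_Integration.integral_norm_bound_integral[OF int_I[OF n] gauss]) (rule bound[OF n])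
    finally show "sqrt (real n) ^ CARD('d) * pmf (conv_power A n) w \<le>
        (\<integral>\<tau>. exp (- c * (norm \<tau>)\<^sup>2) \<partial>(lborel :: (real ^ 'd) measure)) / V"
      using V by (simp add: pos_le_divide_eq mult.commute)
  next
    fix N :: "nat \<Rightarrow> nat" and w
    assume N: "filterlim N at_top sequentially"
      and w: "(\<lambda>n. (real_vec (w n) - real (N n) *\<^sub>R \<mu>) /\<^sub>R sqrt (real (N n))) \<longlonglongrightarrow> 0"
    have ev: "\<forall>\<^sub>F n in sequentially. N n > 0"
      using N by (metis eventually_gt_at_top filterlim_iff)
    \<comment> \<open>The domination holds only for a positive number of steps; the finitely many
      other indices are set to zero.\<close>
    have "(\<lambda>n. \<integral>\<tau>. (if N n > 0 then I (N n) (w n) \<tau> else 0) \<partial>lborel) \<longlonglongrightarrow>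
        (\<integral>\<tau>. complex_of_real (exp (- (\<sigma> \<tau> / 2))) \<partial>lborel)"
    proof (rule integral_dominated_convergence[OF _ _ gauss])
      show "AE \<tau> in lborel. (\<lambda>n. if N n > 0 then I (N n) (w n) \<tau> else 0) \<longlonglongrightarrow> complex_of_real (exp (- (\<sigma> \<tau> / 2)))"
      proof (rule AE_I2)
        fix \<tau>
        show "(\<lambda>n. if N n > 0 then I (N n) (w n) \<tau> else 0) \<longlonglongrightarrow> complex_of_real (exp (- (\<sigma> \<tau> / 2)))"
          by (rule Lim_transform_eventually[OF point[OF N w, of \<tau>]])
             (use ev in eventually_elim, simp)
      qed
      show "AE \<tau> in lborel. norm (if N n > 0 then I (N n) (w n) \<tau> else 0) \<le> exp (- c * (norm \<tau>)\<^sup>2)" for n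
        using bound[of "N n" "w n"] by auto
    qed auto
    then have "(\<lambda>n. complex_of_real (V * (sqrt (real (N n)) ^ CARD('d) * pmf (conv_power A (N n)) (w n)))) \<longlonglongrightarrow> complex_of_real L"
      unfolding L_def integral_complex_of_real
      by (rule Lim_transform_eventually) (use ev in eventually_elim, simp only: inv if_True simp_thms)
    then have "(\<lambda>n. V * (sqrt (real (N n)) ^ CARD('d) * pmf (conv_power A (N n)) (w n))) \<longlonglongrightarrow> L"
      by (simp only: tendsto_of_real_iff)
    then have "(\<lambda>n. V * (sqrt (real (N n)) ^ CARD('d) * pmf (conv_power A (N n)) (w n)) / V) \<longlonglongrightarrow> L / V"
      by (rule tendsto_divide) (use V in auto)
    then show "(\<lambda>n. sqrt (real (N n)) ^ CARD('d) * pmf (conv_power A (N n)) (w n)) \<longlonglongrightarrow> L / V"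
      using V by simp
  next
    have int: "integrable lborel (\<lambda>\<tau>. exp (- (\<sigma> \<tau> / 2)))"
      using int_\<sigma> by (simp only: complex_of_real_integrable_eq)
    have "L \<noteq> 0"
    proof
      assume "L = 0"
      then have "AE \<tau> in (lborel :: (real ^ 'd) measure). False"
        unfolding L_def by (subst (asm) integral_nonneg_eq_0_iff_AE[OF int]) auto
      then show False by (simp add: ae_filter_eq_bot_iff trivial_limit_def[symmetric] emeasure_lborel_UNIV)
    qed
    moreover have "L \<ge> 0" unfolding L_def by simp
    ultimately show "L / V > 0" using V by simp
  qed
qed

subsection \<open>Moments of a subcritical total progeny\<close>

text \<open>A maximum principle: at an index where \<open>y / w\<close> is largest, a ratio above
  \<open>b\<close> would contradict the two inequalities.\<close>

lemma subsolution_le: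
  fixes M :: "'d::finite \<Rightarrow> 'd \<Rightarrow> real"
  assumes M: "\<And>i j. M i j \<ge> 0" and w: "\<And>i. w i \<ge> 1 + (\<Sum>j\<in>UNIV. M i j * w j)" "\<And>i. w i > 0"
    and y: "\<And>i. y i \<le> b + (\<Sum>j\<in>UNIV. M i j * y j)" and b: "b \<ge> 0"
  shows "y i \<le> b * w i"
proof -
  define c where "c = Max (range (\<lambda>i. y i / w i))"
  have "c \<in> range (\<lambda>i. y i / w i)" unfolding c_def by (rule Max_in) auto
  then obtain k where k: "c = y k / w k" by auto
  have le: "y j \<le> c * w j" for j
  proof -
    have "y j / w j \<le> c" unfolding c_def by (rule Max_ge) auto
    then show ?thesis using w(2)[of j] by (simp add: pos_divide_le_eq)
  qed
  have "c \<le> b"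
  proof (rule ccontr)
    assume c: "\<not> c \<le> b"
    have "c * w k = y k" using k w(2)[of k] by simp
    also have "\<dots> \<le> b + (\<Sum>j\<in>UNIV. M k j * (c * w j))"
      by (rule order_trans[OF y]) (intro add_left_mono sum_mono mult_left_mono le M)
    also have "\<dots> = b + c * (\<Sum>j\<in>UNIV. M k j * w j)"
      by (simp add: sum_distrib_left mult_ac)
    also have "\<dots> \<le> b + c * (w k - 1)"
      using w(1)[of k] c b by (intro add_left_mono mult_left_mono) auto
    finally show False using c by (simp add: algebra_simps)
  qed
  then show ?thesis using le[of i] mult_right_mono[of c b "w i"] w(2)[of i] by linarith
qed

lemma nn_integral_zmon_times:
  "(\<integral>\<^sup>+m. ennreal (cf (zmon x * F) m) * h m \<partial>count_space UNIV) =
   (\<integral>\<^sup>+m. ennreal (cf F m) * h (x + m) \<partial>count_space UNIV)"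
proof -
  have "(\<integral>\<^sup>+m. ennreal (cf (zmon x * F) m) * h m \<partial>count_space UNIV) =
      (\<integral>\<^sup>+m. ennreal (cf (zmon x * F) m) * h m \<partial>count_space (range ((+) x)))"
    by (intro nn_integral_count_space_eq) (auto simp: cf_zmon_times vec_le_iff_add)
  also have "\<dots> = (\<integral>\<^sup>+m. ennreal (cf (zmon x * F) (x + m)) * h (x + m) \<partial>count_space UNIV)"
    by (intro nn_integral_bij_count_space[symmetric]) (auto simp: bij_betw_def inj_on_def)
  also have "\<dots> = (\<integral>\<^sup>+m. ennreal (cf F m) * h (x + m) \<partial>count_space UNIV)"
    by (intro nn_integral_cong) (auto simp: cf_zmon_times vec_le_iff_add)
  finally show ?thesis .
qed

lemma ennreal_sum_atMost_eq_nn_integral: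
  assumes "\<And>k. f k \<ge> 0"
  shows "ennreal (\<Sum>k\<in>{..m :: nat ^ 'd::finite}. f k) =
    (\<integral>\<^sup>+k. (if k \<le> m then ennreal (f k) else 0) \<partial>count_space UNIV)"
proof -
  have "(\<integral>\<^sup>+k. (if k \<le> m then ennreal (f k) else 0) \<partial>count_space UNIV) =
      (\<integral>\<^sup>+k. ennreal (f k) \<partial>count_space {..m})"
    by (subst nn_integral_count_space_indicator) (auto intro!: nn_integral_cong simp: indicator_def)
  then show ?thesis
    by (simp add: nn_integral_count_space_finite finite_atMost_vec assms sum_ennreal)
qed

lemma nn_integral_count_space_swap:
  "(\<integral>\<^sup>+x. \<integral>\<^sup>+y. f x y \<partial>count_space UNIV \<partial>count_space UNIV) =
   (\<integral>\<^sup>+y. \<integral>\<^sup>+x. f x y \<partial>count_space UNIV \<partial>count_space UNIV)"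
  using nn_integral_fst_count_space[of "\<lambda>(x, y). f x y"] nn_integral_snd_count_space[of "\<lambda>(x, y). f x y"]
  by simp

lemma nn_integral_times:
  fixes F G :: "'d::finite mfps"
  assumes F: "\<And>m. cf F m \<ge> 0" and G: "\<And>m. cf G m \<ge> 0"
  shows "(\<integral>\<^sup>+m. ennreal (cf (F * G) m) \<partial>count_space UNIV) =
   (\<integral>\<^sup>+m. ennreal (cf F m) \<partial>count_space UNIV) * (\<integral>\<^sup>+m. ennreal (cf G m) \<partial>count_space UNIV)"
proof -
  have "(\<integral>\<^sup>+m. ennreal (cf (F * G) m) \<partial>count_space UNIV) =
      (\<integral>\<^sup>+m. \<integral>\<^sup>+k. (if k \<le> m then ennreal (cf F k * cf G (m - k)) else 0) \<partial>count_space UNIV \<partial>count_space UNIV)"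
    unfolding cf_times using F G by (simp add: ennreal_sum_atMost_eq_nn_integral)
  also have "\<dots> = (\<integral>\<^sup>+k. \<integral>\<^sup>+m. (if k \<le> m then ennreal (cf F k * cf G (m - k)) else 0) \<partial>count_space UNIV \<partial>count_space UNIV)"
    by (rule nn_integral_count_space_swap)
  also have "\<dots> = (\<integral>\<^sup>+k. ennreal (cf F k) * (\<integral>\<^sup>+m. ennreal (cf (zmon k * G) m) \<partial>count_space UNIV) \<partial>count_space UNIV)"
    by (intro nn_integral_cong, subst nn_integral_cmult[symmetric])
       (auto intro!: nn_integral_cong simp: cf_zmon_times ennreal_mult F G)
  also have "\<dots> = (\<integral>\<^sup>+k. ennreal (cf F k) * (\<integral>\<^sup>+m. ennreal (cf G m) \<partial>count_space UNIV) \<partial>count_space UNIV)"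
    using nn_integral_zmon_times[of _ G "\<lambda>_. 1"] by simp
  finally show ?thesis by (simp add: nn_integral_multc)
qed

lemma nn_integral_psum:
  fixes G :: "nat ^ 'd \<Rightarrow> 'd::finite mfps"
  assumes adm: "admissible G" and G: "\<And>k m. cf (G k) m \<ge> 0"
  shows "(\<integral>\<^sup>+m. ennreal (cf (psum A G) m) * h m \<partial>count_space UNIV) =
    (\<integral>\<^sup>+k. \<integral>\<^sup>+m. ennreal (cf (G k) m) * h m \<partial>count_space UNIV \<partial>A)"
proof -
  have "(\<integral>\<^sup>+m. ennreal (cf (psum A G) m) * h m \<partial>count_space UNIV) =
      (\<integral>\<^sup>+m. (\<integral>\<^sup>+k. ennreal (pmf A k) * ennreal (cf (G k) m) * h m \<partial>count_space UNIV) \<partial>count_space UNIV)"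
  proof (intro nn_integral_cong)
    fix m
    have "(\<integral>\<^sup>+k. (if k \<le> m then ennreal (pmf A k * cf (G k) m) else 0) \<partial>count_space UNIV) =
        (\<integral>\<^sup>+k. ennreal (pmf A k) * ennreal (cf (G k) m) \<partial>count_space UNIV)"
      using adm by (intro nn_integral_cong) (auto simp: admissible_def ennreal_mult G)
    then show "ennreal (cf (psum A G) m) * h m =
        (\<integral>\<^sup>+k. ennreal (pmf A k) * ennreal (cf (G k) m) * h m \<partial>count_space UNIV)"
      unfolding cf_psum
      by (subst ennreal_sum_atMost_eq_nn_integral) (simp_all add: G nn_integral_multc)
  qed
  also have "\<dots> = (\<integral>\<^sup>+k. (\<integral>\<^sup>+m. ennreal (pmf A k) * ennreal (cf (G k) m) * h m \<partial>count_space UNIV) \<partial>count_space UNIV)"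
    by (rule nn_integral_count_space_swap)
  also have "\<dots> = (\<integral>\<^sup>+k. ennreal (pmf A k) * (\<integral>\<^sup>+m. ennreal (cf (G k) m) * h m \<partial>count_space UNIV) \<partial>count_space UNIV)"
    by (simp add: mult.assoc nn_integral_cmult)
  finally show ?thesis by (simp add: nn_integral_measure_pmf)
qed

lemma nn_integral_progeny_rec:
  "(\<integral>\<^sup>+m. ennreal (cf (progeny p x) m) * h m \<partial>count_space UNIV) =
    (\<integral>\<^sup>+y. \<integral>\<^sup>+m. ennreal (cf (progeny p y) m) * h (x + m) \<partial>count_space UNIV \<partial>next_generation p x)"
  by (subst progeny_rec)
     (simp add: nn_integral_zmon_times nn_integral_psum admissible_progeny progeny_nonneg)

text \<open>The probability that the tree of \<open>x\<close> is finite, hence not known to be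
  one.\<close>

definition progeny_mass :: "('d::finite \<Rightarrow> (nat ^ 'd) pmf) \<Rightarrow> nat ^ 'd \<Rightarrow> ennreal" where
  "progeny_mass p x = (\<integral>\<^sup>+m. ennreal (cf (progeny p x) m) \<partial>count_space UNIV)"

lemma progeny_mass_zero [simp]: "progeny_mass p 0 = 1"
proof -
  have "progeny_mass p 0 = (\<integral>\<^sup>+m. indicator {0 :: nat ^ 'a} m \<partial>count_space UNIV)"
    unfolding progeny_mass_def by (intro nn_integral_cong) (auto simp: cf_one indicator_def)
  then show ?thesis by simp
qed

text \<open>Restricted to trees of size at most \<open>R\<close>, the mass is bounded by induction
  on \<open>R\<close>, since a nonzero generation uses up part of \<open>R\<close>. Monotone
  convergence removes the restriction.\<close>

lemma progeny_mass_le_1: "progeny_mass p x \<le> 1"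
proof -
  let ?h = "\<lambda>R m. indicator {m. size_vec m \<le> R} m :: ennreal"
  have *: "(\<integral>\<^sup>+m. ennreal (cf (progeny p x) m) * ?h R m \<partial>count_space UNIV) \<le> 1" for R x
  proof (induction R arbitrary: x rule: less_induct)
    case (less R)
    show ?case
    proof (cases "x = 0")
      case True
      have "(\<integral>\<^sup>+m. ennreal (cf (progeny p x) m) * ?h R m \<partial>count_space UNIV) \<le> progeny_mass p 0"
        unfolding progeny_mass_def True by (intro nn_integral_mono) (auto simp: indicator_def)
      then show ?thesis by simp
    next
      case False
      then have x: "size_vec x \<noteq> 0" by simp
      have "(\<integral>\<^sup>+m. ennreal (cf (progeny p y) m) * ?h R (x + m) \<partial>count_space UNIV) \<le> 1" for y
      proof (cases "size_vec x \<le> R")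
        case True
        then have "?h R (x + m) = ?h (R - size_vec x) m" for m by (auto simp: indicator_def)
        then show ?thesis using less[of "R - size_vec x" y] x True by simp
      qed (simp add: indicator_def)
      then have "(\<integral>\<^sup>+y. \<integral>\<^sup>+m. ennreal (cf (progeny p y) m) * ?h R (x + m) \<partial>count_space UNIV
          \<partial>next_generation p x) \<le> (\<integral>\<^sup>+y. 1 \<partial>next_generation p x)"
        by (intro nn_integral_mono)
      then show ?thesis by (subst nn_integral_progeny_rec) simp
    qed
  qed
  have "progeny_mass p x = (\<integral>\<^sup>+m. (SUP R. ennreal (cf (progeny p x) m) * ?h R m) \<partial>count_space UNIV)"
    unfolding progeny_mass_def
  proof (intro nn_integral_cong antisym SUP_least)
    fix m
    show "ennreal (cf (progeny p x) m) \<le> (SUP R. ennreal (cf (progeny p x) m) * ?h R m)"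
      by (rule SUP_upper2[of "size_vec m"]) auto
  qed (auto simp: indicator_def)
  also have "\<dots> = (SUP R. \<integral>\<^sup>+m. ennreal (cf (progeny p x) m) * ?h R m \<partial>count_space UNIV)"
    by (rule nn_integral_monotone_convergence_SUP)
       (auto simp: incseq_def le_fun_def indicator_def)
  also have "\<dots> \<le> 1" by (intro SUP_least *)
  finally show ?thesis .
qed

lemma progeny_mass_plus: "progeny_mass p (x + y) = progeny_mass p x * progeny_mass p y"
  unfolding progeny_mass_def progeny_plus by (rule nn_integral_times) (simp_all add: progeny_nonneg)

lemma progeny_mass_axis: "progeny_mass p (axis i 1) = (\<integral>\<^sup>+k. progeny_mass p k \<partial>p i)"
  unfolding progeny_mass_def using nn_integral_progeny_rec[of p "axis i 1" "\<lambda>_. 1"] by simp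

definition offspring_mean :: "('d::finite \<Rightarrow> (nat ^ 'd) pmf) \<Rightarrow> 'd \<Rightarrow> 'd \<Rightarrow> real" where
  "offspring_mean p i j = measure_pmf.expectation (p i) (\<lambda>k. real (k $ j))"

lemma offspring_mean_nonneg: "offspring_mean p i j \<ge> 0"
  unfolding offspring_mean_def by simp

lemma nn_integral_offspring_sum:
  assumes "\<And>j. integrable (measure_pmf (p i)) (\<lambda>k. real (k $ j))" and "\<And>j. a j \<ge> 0"
  shows "(\<integral>\<^sup>+k. ennreal (\<Sum>j\<in>UNIV. real (k $ j) * a j) \<partial>p i) =
    ennreal (\<Sum>j\<in>UNIV. offspring_mean p i j * a j)"
proof -
  have "(\<integral>\<^sup>+k. ennreal (\<Sum>j\<in>UNIV. real (k $ j) * a j) \<partial>p i) =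
      ennreal (measure_pmf.expectation (p i) (\<lambda>k. \<Sum>j\<in>UNIV. real (k $ j) * a j))"
    by (rule nn_integral_eq_integral) (use assms in \<open>auto intro!: sum_nonneg\<close>)
  then show ?thesis
    unfolding offspring_mean_def using assms by (subst (asm) Bochner_Integration.integral_sum) auto
qed

lemma sum_axis: "(\<Sum>j\<in>UNIV. real (axis i (1::nat) $ j) * a j) = a (i :: 'd::finite)"
proof -
  have "(\<Sum>j\<in>UNIV. real (axis i (1::nat) $ j) * a j) = (\<Sum>j\<in>UNIV. if j = i then a i else 0)"
    by (intro sum.cong) (auto simp: axis_def)
  then show ?thesis by simp
qed

text \<open>The vector \<open>w\<close> certifies subcriticality: it dominates the expected size of
  the total progeny, as \<open>trunc1_axis\<close> shows, and makes \<open>subsolution_le\<close>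
  applicable.\<close>

locale subcritical =
  fixes q :: "'d::finite \<Rightarrow> (nat ^ 'd) pmf" and w :: "'d \<Rightarrow> real"
  assumes integrable_offspring: "integrable (measure_pmf (q i)) (\<lambda>k. real (k $ j))"
    and w_pos: "w i > 0"
    and w_super: "w i \<ge> 1 + (\<Sum>j\<in>UNIV. offspring_mean q i j * w j)"
begin

lemmas subsolution = subsolution_le[of "offspring_mean q" w, OF offspring_mean_nonneg w_super w_pos]

text \<open>By Bernoulli's inequality a population \<open>k\<close> fails to have a finite tree with
  probability at most the sum of the failure probabilities \<open>D\<close> of its members. Hence
  \<open>D\<close> is a subsolution with \<open>b = 0\<close> and vanishes.\<close>

lemma progeny_mass_eq_1: "progeny_mass q x = 1"
proof -
  define S where "S x = enn2real (progeny_mass q x)" for x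
  have fin: "progeny_mass q x = ennreal (S x)" for x
    using progeny_mass_le_1[of q x] unfolding S_def
    by (intro ennreal_enn2real[symmetric]) (auto simp: less_top[symmetric] top_unique)
  have S01: "0 \<le> S x" "S x \<le> 1" for x
    using progeny_mass_le_1[of q x] unfolding fin by (auto simp: S_def)
  have S0: "S 0 = 1" by (simp add: S_def)
  have S_plus: "S (x + y) = S x * S y" for x y
    unfolding S_def progeny_mass_plus by (simp add: enn2real_mult)
  define D where "D i = 1 - S (axis i 1)" for i
  have D: "D i \<ge> 0" for i using S01 by (simp add: D_def)
  have bernoulli: "1 - (\<Sum>j\<in>UNIV. real (k $ j) * D j) \<le> S k" for k
  proof (induction k rule: nat_vec_induct)
    case (add_axis k i)
    have "1 - S (k + axis i 1) \<le> (1 - S k) + D i"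
    proof -
      have "0 \<le> (1 - S k) * D i" using S01[of k] D[of i] by simp
      then show ?thesis unfolding S_plus D_def by (simp add: algebra_simps)
    qed
    moreover have "(\<Sum>j\<in>UNIV. real ((k + axis i 1) $ j) * D j) = (\<Sum>j\<in>UNIV. real (k $ j) * D j) + D i"
      using sum_axis[of i D] by (simp add: distrib_right sum.distrib)
    ultimately show ?case using add_axis by linarith
  qed (simp add: S0)
  have "D i \<le> 0 + (\<Sum>j\<in>UNIV. offspring_mean q i j * D j)" for i
  proof -
    let ?T = "\<lambda>k. \<Sum>j\<in>UNIV. real (k $ j) * D j"
    have "(1 :: ennreal) = (\<integral>\<^sup>+k. 1 \<partial>q i)" by simp
    also have "\<dots> \<le> (\<integral>\<^sup>+k. ennreal (S k) + ennreal (?T k) \<partial>q i)"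
    proof (intro nn_integral_mono)
      fix k
      have "ennreal 1 \<le> ennreal (S k + ?T k)" using bernoulli[of k] by (intro ennreal_leI) simp
      then show "1 \<le> ennreal (S k) + ennreal (?T k)"
        using S01 D by (subst ennreal_plus[symmetric]) (auto intro!: sum_nonneg)
    qed
    also have "\<dots> = ennreal (S (axis i 1)) + ennreal (\<Sum>j\<in>UNIV. offspring_mean q i j * D j)"
      using progeny_mass_axis[of q i]
      by (subst nn_integral_add) (simp_all add: fin nn_integral_offspring_sum integrable_offspring D)
    also have "\<dots> = ennreal (S (axis i 1) + (\<Sum>j\<in>UNIV. offspring_mean q i j * D j))"
      using S01 D by (intro ennreal_plus[symmetric]) (auto intro!: sum_nonneg mult_nonneg_nonneg offspring_mean_nonneg)
    finally have "1 \<le> S (axis i 1) + (\<Sum>j\<in>UNIV. offspring_mean q i j * D j)"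
      by (subst (asm) ennreal_1[symmetric], subst (asm) ennreal_le_iff)
         (use S01 D in \<open>auto intro!: add_nonneg_nonneg sum_nonneg mult_nonneg_nonneg offspring_mean_nonneg\<close>)
    then show ?thesis by (simp add: D_def)
  qed
  then have "D i \<le> 0 * w i" for i
    by (rule subsolution) simp
  with D have "D i = 0" for i by (simp add: antisym)
  with bernoulli[of x] S01[of x] have "S x = 1" by simp
  then show ?thesis by (simp add: fin)
qed

definition progeny_law :: "nat ^ 'd \<Rightarrow> (nat ^ 'd) pmf" where
  "progeny_law x = embed_pmf (cf (progeny q x))"

lemma pmf_progeny_law: "pmf (progeny_law x) m = cf (progeny q x) m"
  unfolding progeny_law_def
  by (rule pmf_embed_pmf) (use progeny_mass_eq_1[of x] in \<open>auto simp: progeny_nonneg progeny_mass_def\<close>)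

lemma Abs_mfps_progeny_law: "Abs_mfps (pmf (progeny_law x)) = progeny q x"
  by (rule mfps_eqI) (simp add: pmf_progeny_law)

lemma progeny_law_plus: "progeny_law (x + y) = conv_pmf (progeny_law x) (progeny_law y)"
  by (rule Abs_mfps_pmf_inject) (simp add: Abs_mfps_progeny_law Abs_mfps_conv_pmf progeny_plus)

lemma progeny_law_zero [simp]: "progeny_law 0 = return_pmf 0"
  by (rule pmf_eqI) (auto simp: pmf_progeny_law cf_one indicator_def)

lemma pmf_bind_progeny_law: "pmf (bind_pmf A progeny_law) m = cf (psum A (progeny q)) m"
proof -
  have "pmf (bind_pmf A progeny_law) m = measure_pmf.expectation A (\<lambda>k. cf (progeny q k) m)"
    by (simp add: pmf_bind pmf_progeny_law)
  also have "\<dots> = (\<Sum>k\<in>{..m}. cf (progeny q k) m * pmf A k)"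
    using admissible_progeny
    by (intro integral_measure_pmf_real finite_atMost_vec) (auto simp: admissible_def)
  finally show ?thesis by (simp add: cf_psum mult.commute)
qed

lemma progeny_law_axis:
  "progeny_law (axis i 1) = map_pmf ((+) (axis i 1)) (bind_pmf (q i) progeny_law)"
proof (rule pmf_eqI)
  fix m
  show "pmf (progeny_law (axis i 1)) m = pmf (map_pmf ((+) (axis i 1)) (bind_pmf (q i) progeny_law)) m"
  proof (cases "axis i 1 \<le> m")
    case True
    then obtain y where y: "m = axis i 1 + y" by (auto simp: vec_le_iff_add)
    have "pmf (map_pmf ((+) (axis i 1)) (bind_pmf (q i) progeny_law)) m = cf (psum (q i) (progeny q)) y"
      unfolding y by (subst pmf_map_inj') (auto simp: inj_on_def pmf_bind_progeny_law)
    moreover have "pmf (progeny_law (axis i 1)) m = cf (psum (q i) (progeny q)) y"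
      unfolding pmf_progeny_law progeny_axis cf_zmon_times using True by (simp add: y)
    ultimately show ?thesis by simp
  next
    case False
    then have "pmf (map_pmf ((+) (axis i 1)) (bind_pmf (q i) progeny_law)) m = 0"
      by (auto simp: pmf_eq_0_set_pmf vec_le_iff_add)
    with False show ?thesis
      unfolding pmf_progeny_law progeny_axis cf_zmon_times by simp
  qed
qed

end

section \<open>First and second moments through truncation\<close>

context subcritical
begin

lemma nn_integral_progeny_law_plus:
  "(\<integral>\<^sup>+r. f r \<partial>progeny_law (x + y)) =
   (\<integral>\<^sup>+r. \<integral>\<^sup>+s. f (r + s) \<partial>progeny_law y \<partial>progeny_law x)"
  by (simp add: progeny_law_plus conv_pmf_def nn_integral_pair_pmf')

lemma nn_integral_progeny_law_axis:
  "(\<integral>\<^sup>+r. f r \<partial>progeny_law (axis i 1)) =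
   (\<integral>\<^sup>+k. \<integral>\<^sup>+r. f (axis i 1 + r) \<partial>progeny_law k \<partial>q i)"
  unfolding progeny_law_axis by simp

definition wsum :: "nat ^ 'd \<Rightarrow> real" where
  "wsum k = (\<Sum>j\<in>UNIV. real (k $ j) * w j)"

lemma wsum_add_axis: "wsum (k + axis i 1) = wsum k + w i"
  using sum_axis[of i w] by (simp add: wsum_def distrib_right sum.distrib)

lemma wsum_nonneg: "wsum k \<ge> 0"
  unfolding wsum_def using w_pos by (intro sum_nonneg mult_nonneg_nonneg) (auto intro: less_imp_le)

text \<open>\<open>subsolution_le\<close> compares real numbers, while moments of the progeny may a
  priori be infinite. Truncated moments are finite, and the bounds obtained for them do not depend
  on \<open>R\<close>.\<close>

definition trunc1 :: "nat \<Rightarrow> nat ^ 'd \<Rightarrow> real" where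
  "trunc1 R x = enn2real (\<integral>\<^sup>+r. ennreal (real (min (size_vec r) R)) \<partial>progeny_law x)"

definition trunc2 :: "nat \<Rightarrow> nat ^ 'd \<Rightarrow> real" where
  "trunc2 R x = enn2real (\<integral>\<^sup>+r. ennreal ((real (min (size_vec r) R))\<^sup>2) \<partial>progeny_law x)"

lemma trunc1_eq:
  "(\<integral>\<^sup>+r. ennreal (real (min (size_vec r) R)) \<partial>progeny_law x) = ennreal (trunc1 R x)"
proof -
  have "(\<integral>\<^sup>+r. ennreal (real (min (size_vec r) R)) \<partial>progeny_law x) \<le>
      (\<integral>\<^sup>+r. ennreal (real R) \<partial>progeny_law x)"
    by (intro nn_integral_mono ennreal_leI) simp
  then show ?thesis unfolding trunc1_def
    by (intro ennreal_enn2real[symmetric]) (auto simp: less_top[symmetric] top_unique)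
qed

lemma trunc2_eq:
  "(\<integral>\<^sup>+r. ennreal ((real (min (size_vec r) R))\<^sup>2) \<partial>progeny_law x) = ennreal (trunc2 R x)"
proof -
  have "(\<integral>\<^sup>+r. ennreal ((real (min (size_vec r) R))\<^sup>2) \<partial>progeny_law x) \<le>
      (\<integral>\<^sup>+r. ennreal ((real R)\<^sup>2) \<partial>progeny_law x)"
    by (intro nn_integral_mono ennreal_leI power_mono) simp_all
  then show ?thesis unfolding trunc2_def
    by (intro ennreal_enn2real[symmetric]) (auto simp: less_top[symmetric] top_unique)
qed

lemma trunc_nonneg [simp]: "trunc1 R x \<ge> 0" "trunc2 R x \<ge> 0"
  by (simp_all add: trunc1_def trunc2_def)

lemma trunc_zero [simp]: "trunc1 R 0 = 0" "trunc2 R 0 = 0"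
  by (simp_all add: trunc1_def trunc2_def)

lemma trunc1_plus: "trunc1 R (x + y) \<le> trunc1 R x + trunc1 R y"
proof -
  have "ennreal (trunc1 R (x + y)) \<le> (\<integral>\<^sup>+r. \<integral>\<^sup>+s. ennreal (real (min (size_vec r) R)) + ennreal (real (min (size_vec s) R))
      \<partial>progeny_law y \<partial>progeny_law x)"
    unfolding trunc1_eq[symmetric] nn_integral_progeny_law_plus
    by (intro nn_integral_mono) (auto intro!: ennreal_leI simp flip: ennreal_plus)
  also have "\<dots> = ennreal (trunc1 R x) + ennreal (trunc1 R y)"
    by (simp add: nn_integral_add trunc1_eq)
  finally show ?thesis by (simp flip: ennreal_plus)
qed

lemma trunc1_le_sum: "trunc1 R k \<le> (\<Sum>j\<in>UNIV. real (k $ j) * trunc1 R (axis j 1))"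
proof (induction k rule: nat_vec_induct)
  case (add_axis k i)
  have "(\<Sum>j\<in>UNIV. real ((k + axis i 1) $ j) * trunc1 R (axis j 1)) =
      (\<Sum>j\<in>UNIV. real (k $ j) * trunc1 R (axis j 1)) + trunc1 R (axis i 1)"
    using sum_axis[of i "\<lambda>j. trunc1 R (axis j 1)"] by (simp add: distrib_right sum.distrib)
  with add_axis trunc1_plus[of R k "axis i 1"] show ?case by linarith
qed simp

lemma trunc1_axis: "trunc1 R (axis i 1) \<le> w i"
proof -
  have "trunc1 R (axis i 1) \<le> 1 + (\<Sum>j\<in>UNIV. offspring_mean q i j * trunc1 R (axis j 1))" for i
  proof -
    let ?T = "\<lambda>k. \<Sum>j\<in>UNIV. real (k $ j) * trunc1 R (axis j 1)"
    have "ennreal (trunc1 R (axis i 1)) \<le>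
        (\<integral>\<^sup>+k. \<integral>\<^sup>+r. 1 + ennreal (real (min (size_vec r) R)) \<partial>progeny_law k \<partial>q i)"
      unfolding trunc1_eq[symmetric] nn_integral_progeny_law_axis
      by (intro nn_integral_mono) (auto intro!: ennreal_leI simp flip: ennreal_plus ennreal_1)
    also have "\<dots> = (\<integral>\<^sup>+k. 1 + ennreal (trunc1 R k) \<partial>q i)"
      by (simp add: nn_integral_add trunc1_eq)
    also have "\<dots> \<le> (\<integral>\<^sup>+k. 1 + ennreal (?T k) \<partial>q i)"
      by (intro nn_integral_mono add_left_mono ennreal_leI trunc1_le_sum)
    also have "\<dots> = 1 + ennreal (\<Sum>j\<in>UNIV. offspring_mean q i j * trunc1 R (axis j 1))"
      using nn_integral_offspring_sum[of q i "\<lambda>j. trunc1 R (axis j 1)", OF integrable_offspring]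
      by (subst nn_integral_add) simp_all
    also have "\<dots> = ennreal (1 + (\<Sum>j\<in>UNIV. offspring_mean q i j * trunc1 R (axis j 1)))"
      by (subst ennreal_plus) (auto intro!: sum_nonneg mult_nonneg_nonneg offspring_mean_nonneg)
    finally show ?thesis
      by (subst (asm) ennreal_le_iff)
         (auto intro!: add_nonneg_nonneg sum_nonneg mult_nonneg_nonneg offspring_mean_nonneg)
  qed
  from subsolution[of "\<lambda>i. trunc1 R (axis i 1)" 1, OF this] show ?thesis by simp
qed

lemma trunc1_le_wsum: "trunc1 R k \<le> wsum k"
  unfolding wsum_def
  by (rule order_trans[OF trunc1_le_sum]) (intro sum_mono mult_left_mono trunc1_axis, simp)

lemma trunc2_plus: "trunc2 R (x + y) \<le> trunc2 R x + trunc2 R y + 2 * trunc1 R x * trunc1 R y"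
proof -
  let ?t = "\<lambda>r. real (min (size_vec r) R)"
  have "ennreal (trunc2 R (x + y)) \<le> (\<integral>\<^sup>+r. \<integral>\<^sup>+s. ennreal ((?t r)\<^sup>2) + ennreal ((?t s)\<^sup>2) + 2 * ennreal (?t r) * ennreal (?t s)
      \<partial>progeny_law y \<partial>progeny_law x)"
    unfolding trunc2_eq[symmetric] nn_integral_progeny_law_plus
  proof (intro nn_integral_mono)
    fix r s
    have "(?t (r + s))\<^sup>2 \<le> (?t r + ?t s)\<^sup>2" by (intro power_mono) auto
    then have "ennreal ((?t (r + s))\<^sup>2) \<le> ennreal ((?t r)\<^sup>2 + (?t s)\<^sup>2 + 2 * ?t r * ?t s)"
      by (intro ennreal_leI) (simp add: power2_sum)
    then show "ennreal ((?t (r + s))\<^sup>2) \<le> ennreal ((?t r)\<^sup>2) + ennreal ((?t s)\<^sup>2) + 2 * ennreal (?t r) * ennreal (?t s)"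
      by (simp add: ennreal_mult ennreal_plus)
  qed
  also have "\<dots> = ennreal (trunc2 R x) + ennreal (trunc2 R y) + 2 * ennreal (trunc1 R x) * ennreal (trunc1 R y)"
    by (simp add: nn_integral_add nn_integral_cmult nn_integral_multc trunc1_eq trunc2_eq)
  also have "\<dots> = ennreal (trunc2 R x + trunc2 R y + 2 * trunc1 R x * trunc1 R y)"
    by (simp add: ennreal_mult ennreal_plus)
  finally show ?thesis by (subst (asm) ennreal_le_iff) auto
qed

text \<open>By independence the cross terms are products of first moments; bounding these by
  \<open>w\<close>, they accumulate to at most \<open>(wsum k)^2\<close> as individuals are
  added.\<close>

lemma trunc2_le_sum: "trunc2 R k \<le> (\<Sum>j\<in>UNIV. real (k $ j) * trunc2 R (axis j 1)) + (wsum k)\<^sup>2"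
proof (induction k rule: nat_vec_induct)
  case (add_axis k i)
  have "(\<Sum>j\<in>UNIV. real ((k + axis i 1) $ j) * trunc2 R (axis j 1)) =
      (\<Sum>j\<in>UNIV. real (k $ j) * trunc2 R (axis j 1)) + trunc2 R (axis i 1)"
    using sum_axis[of i "\<lambda>j. trunc2 R (axis j 1)"] by (simp add: distrib_right sum.distrib)
  moreover have "2 * trunc1 R k * trunc1 R (axis i 1) \<le> 2 * wsum k * w i"
    by (intro mult_mono trunc1_le_wsum trunc1_axis) (simp_all add: wsum_nonneg)
  moreover have "(wsum (k + axis i 1))\<^sup>2 \<ge> (wsum k)\<^sup>2 + 2 * wsum k * w i"
    by (simp add: wsum_add_axis power2_sum del: One_nat_def)
  ultimately show ?case using add_axis trunc2_plus[of R k "axis i 1"] by linarith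
qed (simp add: wsum_def)

lemma wsum_le: "wsum k \<le> real (size_vec k) * (\<Sum>j\<in>UNIV. w j)"
proof -
  have "w j \<le> (\<Sum>j\<in>UNIV. w j)" for j
    by (rule member_le_sum) (auto intro: less_imp_le[OF w_pos])
  then have "wsum k \<le> (\<Sum>i\<in>UNIV. real (k $ i) * (\<Sum>j\<in>UNIV. w j))"
    unfolding wsum_def by (intro sum_mono mult_left_mono) auto
  then show ?thesis by (simp add: size_vec_def sum_distrib_right)
qed

lemma progeny_law_second_moment:
  assumes sq: "\<And>i. integrable (measure_pmf (q i)) (\<lambda>k. (real (size_vec k))\<^sup>2)"
  obtains K where "K \<ge> 0"
    "\<And>x. (\<integral>\<^sup>+r. ennreal ((real (size_vec r))\<^sup>2) \<partial>progeny_law x) \<le> ennreal (K * (real (size_vec x))\<^sup>2)"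
proof -
  define W where "W = (\<Sum>j\<in>UNIV. w j)"
  have W: "W \<ge> 0" unfolding W_def by (intro sum_nonneg less_imp_le w_pos)
  have intw2: "integrable (measure_pmf (q i)) (\<lambda>k. (wsum k)\<^sup>2)" for i
  proof (rule Bochner_Integration.integrable_bound)
    show "integrable (measure_pmf (q i)) (\<lambda>k. W\<^sup>2 * (real (size_vec k))\<^sup>2)" using sq by simp
    have "(wsum k)\<^sup>2 \<le> (real (size_vec k) * W)\<^sup>2" for k
      using wsum_le[of k] wsum_nonneg[of k] unfolding W_def by (rule power_mono)
    then show "AE k in measure_pmf (q i). norm ((wsum k)\<^sup>2) \<le> norm (W\<^sup>2 * (real (size_vec k))\<^sup>2)"
      by (simp add: power_mult_distrib mult.commute)
  qed simp
  have intw: "integrable (measure_pmf (q i)) wsum" for i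
    unfolding wsum_def using integrable_offspring by simp
  \<comment> \<open>The term for \<open>i\<close> bounds the inhomogeneous part of the recursion: it
    comes from \<open>(1 + t)^2\<close>, from the cross terms in \<open>trunc2_le_sum\<close>, and
    from \<open>w_super\<close>, by which the mean of \<open>wsum\<close> is at most
    \<open>w i\<close>. Summing over \<open>i\<close> gives one constant for all types.\<close>
  define C where "C = (\<Sum>i\<in>UNIV. 1 + 2 * w i + measure_pmf.expectation (q i) (\<lambda>k. (wsum k)\<^sup>2))"
  have Ci: "1 + 2 * w i + measure_pmf.expectation (q i) (\<lambda>k. (wsum k)\<^sup>2) \<le> C" for i
    unfolding C_def
    by (rule member_le_sum) (auto intro!: add_nonneg_nonneg less_imp_le[OF w_pos])
  have C: "C \<ge> 0" unfolding C_def
    by (auto intro!: sum_nonneg add_nonneg_nonneg less_imp_le[OF w_pos])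
  have axis: "trunc2 R (axis i 1) \<le> C * w i" for R i
  proof -
    have "trunc2 R (axis i 1) \<le> C + (\<Sum>j\<in>UNIV. offspring_mean q i j * trunc2 R (axis j 1))" for i
    proof -
      let ?t = "\<lambda>r. real (min (size_vec r) R)"
      let ?T = "\<lambda>k. 1 + 2 * wsum k + ((\<Sum>j\<in>UNIV. real (k $ j) * trunc2 R (axis j 1)) + (wsum k)\<^sup>2)"
      have T0: "?T k \<ge> 0" for k
        by (auto intro!: add_nonneg_nonneg sum_nonneg wsum_nonneg)
      have "ennreal (trunc2 R (axis i 1)) \<le>
          (\<integral>\<^sup>+k. \<integral>\<^sup>+r. 1 + 2 * ennreal (?t r) + ennreal ((?t r)\<^sup>2) \<partial>progeny_law k \<partial>q i)"
        unfolding trunc2_eq[symmetric] nn_integral_progeny_law_axis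
      proof (intro nn_integral_mono)
        fix r :: "nat ^ 'd"
        have "(?t (axis i 1 + r))\<^sup>2 \<le> (1 + ?t r)\<^sup>2" by (intro power_mono) auto
        then have "ennreal ((?t (axis i 1 + r))\<^sup>2) \<le> ennreal (1 + 2 * ?t r + (?t r)\<^sup>2)"
          by (intro ennreal_leI) (simp add: power2_sum)
        then show "ennreal ((?t (axis i 1 + r))\<^sup>2) \<le> 1 + 2 * ennreal (?t r) + ennreal ((?t r)\<^sup>2)"
          by (simp add: ennreal_mult ennreal_plus)
      qed
      also have "\<dots> = (\<integral>\<^sup>+k. 1 + 2 * ennreal (trunc1 R k) + ennreal (trunc2 R k) \<partial>q i)"
        by (simp add: nn_integral_add nn_integral_cmult trunc1_eq trunc2_eq)
      also have "\<dots> = (\<integral>\<^sup>+k. ennreal (1 + 2 * trunc1 R k + trunc2 R k) \<partial>q i)"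
        by (simp add: ennreal_mult ennreal_plus)
      also have "\<dots> \<le> (\<integral>\<^sup>+k. ennreal (?T k) \<partial>q i)"
        by (intro nn_integral_mono ennreal_leI add_mono mult_left_mono trunc1_le_wsum trunc2_le_sum) auto
      also have "\<dots> = ennreal (measure_pmf.expectation (q i) ?T)"
        by (rule nn_integral_eq_integral) (use T0 intw intw2 integrable_offspring in auto)
      finally have "trunc2 R (axis i 1) \<le> measure_pmf.expectation (q i) ?T"
        using T0 by (subst (asm) ennreal_le_iff) auto
      also have "\<dots> = 1 + 2 * measure_pmf.expectation (q i) wsum +
          ((\<Sum>j\<in>UNIV. offspring_mean q i j * trunc2 R (axis j 1)) + measure_pmf.expectation (q i) (\<lambda>k. (wsum k)\<^sup>2))"
        unfolding offspring_mean_def using intw intw2 integrable_offspring by simp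
      also have "measure_pmf.expectation (q i) wsum = (\<Sum>j\<in>UNIV. offspring_mean q i j * w j)"
        unfolding offspring_mean_def wsum_def using integrable_offspring by simp
      also have "\<dots> \<le> w i" using w_super[of i] by simp
      finally show ?thesis using Ci[of i] by simp
    qed
    from subsolution[of "\<lambda>i. trunc2 R (axis i 1)" C, OF this C] show ?thesis .
  qed
  \<comment> \<open>\<open>wsum x\<close> is at most \<open>W\<close> times the size, and a natural
    number is at most its square, which absorbs the linear term.\<close>
  define K where "K = C * W + W\<^sup>2"
  show thesis
  proof (rule that)
    show "K \<ge> 0" using C W by (simp add: K_def)
    fix x
    have R: "trunc2 R x \<le> K * (real (size_vec x))\<^sup>2" for R
    proof -
      have "trunc2 R x \<le> (\<Sum>j\<in>UNIV. real (x $ j) * (C * w j)) + (wsum x)\<^sup>2"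
        by (rule order_trans[OF trunc2_le_sum]) (intro add_right_mono sum_mono mult_left_mono axis, simp)
      also have "(\<Sum>j\<in>UNIV. real (x $ j) * (C * w j)) = C * wsum x"
        by (simp add: wsum_def sum_distrib_left mult_ac)
      also have "C * wsum x + (wsum x)\<^sup>2 \<le> C * (real (size_vec x) * W) + (real (size_vec x) * W)\<^sup>2"
        using wsum_le[of x] wsum_nonneg[of x] C unfolding W_def
        by (intro add_mono mult_left_mono power_mono) auto
      also have "C * (real (size_vec x) * W) \<le> C * ((real (size_vec x))\<^sup>2 * W)"
      proof (intro mult_left_mono mult_right_mono C W)
        have "size_vec x \<le> (size_vec x)\<^sup>2" by (simp add: power2_eq_square)
        then show "real (size_vec x) \<le> (real (size_vec x))\<^sup>2" by (metis of_nat_le_iff of_nat_power)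
      qed
      finally show ?thesis by (simp add: K_def power_mult_distrib algebra_simps)
    qed
    let ?f = "\<lambda>R r. ennreal ((real (min (size_vec r) R))\<^sup>2)"
    have "(\<integral>\<^sup>+r. ennreal ((real (size_vec r))\<^sup>2) \<partial>progeny_law x) =
        (\<integral>\<^sup>+r. (SUP R. ?f R r) \<partial>progeny_law x)"
    proof (intro nn_integral_cong antisym SUP_least)
      fix r :: "nat ^ 'd"
      show "ennreal ((real (size_vec r))\<^sup>2) \<le> (SUP R. ?f R r)"
        by (rule SUP_upper2[of "size_vec r"]) auto
      show "?f R r \<le> ennreal ((real (size_vec r))\<^sup>2)" for R
        by (intro ennreal_leI power_mono) auto
    qed
    also have "\<dots> = (SUP R. \<integral>\<^sup>+r. ?f R r \<partial>progeny_law x)"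
      by (rule nn_integral_monotone_convergence_SUP)
         (auto simp: incseq_def le_fun_def intro!: ennreal_leI power_mono)
    also have "\<dots> \<le> ennreal (K * (real (size_vec x))\<^sup>2)"
      unfolding trunc2_eq by (intro SUP_least ennreal_leI R)
    finally show "(\<integral>\<^sup>+r. ennreal ((real (size_vec r))\<^sup>2) \<partial>progeny_law x) \<le> ennreal (K * (real (size_vec x))\<^sup>2)" .
  qed
qed

end

context subcritical
begin

text \<open>\<open>\<alpha>\<close> is the Green matrix of the process, the inverse of the identity
  minus the mean matrix. It enters through its linear system only; the second moment bound
  guarantees finite entries.\<close>

lemma progeny_law_mean:
  assumes sq: "\<And>i. integrable (measure_pmf (q i)) (\<lambda>k. (real (size_vec k))\<^sup>2)"
  obtains \<alpha> where "\<And>i l. \<alpha> i l \<ge> 0"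
    "\<And>x l. (\<integral>\<^sup>+r. ennreal (real (r $ l)) \<partial>progeny_law x) = ennreal (\<Sum>i\<in>UNIV. real (x $ i) * \<alpha> i l)"
    "\<And>i l. \<alpha> i l = (if i = l then 1 else 0) + (\<Sum>j\<in>UNIV. offspring_mean q i j * \<alpha> j l)"
proof -
  obtain K where K: "K \<ge> 0"
    "\<And>x. (\<integral>\<^sup>+r. ennreal ((real (size_vec r))\<^sup>2) \<partial>progeny_law x) \<le> ennreal (K * (real (size_vec x))\<^sup>2)"
    using progeny_law_second_moment[OF sq] by blast
  define \<alpha> where "\<alpha> i l = enn2real (\<integral>\<^sup>+r. ennreal (real (r $ l)) \<partial>progeny_law (axis i 1))" for i l
  have ax: "(\<integral>\<^sup>+r. ennreal (real (r $ l)) \<partial>progeny_law (axis i 1)) = ennreal (\<alpha> i l)" for i l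
  proof -
    have "(\<integral>\<^sup>+r. ennreal (real (r $ l)) \<partial>progeny_law (axis i 1)) \<le>
        (\<integral>\<^sup>+r. ennreal ((real (size_vec r))\<^sup>2) \<partial>progeny_law (axis i 1))"
      by (intro nn_integral_mono ennreal_leI component_le_size_sq)
    then show ?thesis unfolding \<alpha>_def using K(2)[of "axis i 1"]
      by (intro ennreal_enn2real[symmetric]) (auto simp: less_top[symmetric] top_unique)
  qed
  have \<alpha>0: "\<alpha> i l \<ge> 0" for i l by (simp add: \<alpha>_def)
  have lin: "(\<integral>\<^sup>+r. ennreal (real (r $ l)) \<partial>progeny_law x) = ennreal (\<Sum>i\<in>UNIV. real (x $ i) * \<alpha> i l)" for x l
  proof (induction x rule: nat_vec_induct)
    case (add_axis x i)
    have "(\<integral>\<^sup>+r. ennreal (real (r $ l)) \<partial>progeny_law (x + axis i 1)) =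
        (\<integral>\<^sup>+r. \<integral>\<^sup>+s. ennreal (real (r $ l)) + ennreal (real (s $ l))
          \<partial>progeny_law (axis i 1) \<partial>progeny_law x)"
      unfolding nn_integral_progeny_law_plus by (simp add: ennreal_plus)
    also have "\<dots> = ennreal (\<Sum>i\<in>UNIV. real (x $ i) * \<alpha> i l) + ennreal (\<alpha> i l)"
      using add_axis ax[of i l] by (simp add: nn_integral_add)
    also have "\<dots> = ennreal (\<Sum>j\<in>UNIV. real ((x + axis i 1) $ j) * \<alpha> j l)"
      using sum_axis[of i "\<lambda>j. \<alpha> j l"] \<alpha>0
      by (subst ennreal_plus[symmetric]) (auto simp: distrib_right sum.distrib intro!: sum_nonneg)
    finally show ?case .
  qed simp
  have "\<alpha> i l = (if i = l then 1 else 0) + (\<Sum>j\<in>UNIV. offspring_mean q i j * \<alpha> j l)" for i l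
  proof -
    have "ennreal (\<alpha> i l) = (\<integral>\<^sup>+k. \<integral>\<^sup>+r. ennreal (if i = l then 1 else 0) + ennreal (real (r $ l))
        \<partial>progeny_law k \<partial>q i)"
      unfolding ax[symmetric] nn_integral_progeny_law_axis
      by (intro nn_integral_cong) (auto simp: axis_def ennreal_plus)
    also have "\<dots> = ennreal (if i = l then 1 else 0) + ennreal (\<Sum>j\<in>UNIV. offspring_mean q i j * \<alpha> j l)"
      using nn_integral_offspring_sum[of q i "\<lambda>j. \<alpha> j l", OF integrable_offspring \<alpha>0]
      by (simp add: nn_integral_add lin)
    also have "\<dots> = ennreal ((if i = l then 1 else 0) + (\<Sum>j\<in>UNIV. offspring_mean q i j * \<alpha> j l))"
      by (subst ennreal_plus) (auto intro!: sum_nonneg mult_nonneg_nonneg offspring_mean_nonneg \<alpha>0)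
    finally show ?thesis
      by (subst (asm) ennreal_inj)
         (auto intro!: add_nonneg_nonneg sum_nonneg mult_nonneg_nonneg offspring_mean_nonneg \<alpha>0)
  qed
  with \<alpha>0 lin show thesis by (rule that)
qed

end

text \<open>
  The vectors \<open>h\<close> for which \<open>1 - cos (t \<bullet> h)\<close> is dominated by \<open>1 - \<bar>fourier A t\<bar>\<^sup>2\<close> uniformly in \<open>t\<close>
  form a subgroup containing all differences of points of the support, so that aperiodicity
  yields a Gaussian bound on the whole torus without a compactness argument.
\<close>

definition spread :: "(nat ^ 'd::finite) pmf \<Rightarrow> (real ^ 'd) set" where
  "spread A = {h. \<exists>C. \<forall>t. 1 - cos (t \<bullet> h) \<le> C * (1 - (cmod (fourier A t))\<^sup>2)}"

text \<open>Since \<open>1 - cos x = 2 (sin (x/2))^2\<close>, this is subadditivity of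
  \<open>\<bar>sin\<bar>\<close> followed by \<open>(s + t)^2 \<le> 2 s^2 + 2 t^2\<close>. It makes
  \<open>spread\<close> closed under addition.\<close>

lemma one_minus_cos_add: "1 - cos (a + b) \<le> 2 * (1 - cos a) + 2 * (1 - cos (b :: real))"
proof -
  have c: "1 - cos x = 2 * (sin (x / 2))\<^sup>2" for x :: real
    using cos_double_sin[of "x / 2"] by simp
  let ?s = "sin (a / 2)" and ?t = "sin (b / 2)"
  have "\<bar>sin ((a + b) / 2)\<bar> \<le> \<bar>?s * cos (b / 2)\<bar> + \<bar>cos (a / 2) * ?t\<bar>"
    unfolding add_divide_distrib sin_add by (rule abs_triangle_ineq)
  also have "\<dots> \<le> \<bar>?s\<bar> + \<bar>?t\<bar>"
    unfolding abs_mult by (intro add_mono mult_left_le mult_right_le_one_le mult_left_le_one_le) auto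
  finally have "\<bar>sin ((a + b) / 2)\<bar>\<^sup>2 \<le> (\<bar>?s\<bar> + \<bar>?t\<bar>)\<^sup>2" by (intro power_mono) auto
  also have "\<dots> \<le> 2 * ?s\<^sup>2 + 2 * ?t\<^sup>2"
    using zero_le_power2[of "\<bar>?s\<bar> - \<bar>?t\<bar>"] by (simp add: power2_sum power2_diff)
  finally show ?thesis unfolding c by simp
qed

lemma spread_zero: "0 \<in> spread A"
  unfolding spread_def by (auto intro!: exI[of _ 0])

lemma spread_add: "g \<in> spread A \<Longrightarrow> h \<in> spread A \<Longrightarrow> g + h \<in> spread A"
proof -
  assume "g \<in> spread A" "h \<in> spread A"
  then obtain C D where CD: "\<And>t. 1 - cos (t \<bullet> g) \<le> C * (1 - (cmod (fourier A t))\<^sup>2)"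
    "\<And>t. 1 - cos (t \<bullet> h) \<le> D * (1 - (cmod (fourier A t))\<^sup>2)"
    unfolding spread_def by blast
  have "1 - cos (t \<bullet> (g + h)) \<le> (2 * C + 2 * D) * (1 - (cmod (fourier A t))\<^sup>2)" for t
  proof -
    have "1 - cos (t \<bullet> (g + h)) \<le> 2 * (1 - cos (t \<bullet> g)) + 2 * (1 - cos (t \<bullet> h))"
      unfolding inner_add_right by (rule one_minus_cos_add)
    also have "\<dots> \<le> 2 * (C * (1 - (cmod (fourier A t))\<^sup>2)) + 2 * (D * (1 - (cmod (fourier A t))\<^sup>2))"
      by (intro add_mono mult_left_mono CD) auto
    finally show ?thesis by (simp add: algebra_simps)
  qed
  then show ?thesis unfolding spread_def by blast
qed

lemma spread_minus: "h \<in> spread A \<Longrightarrow> - h \<in> spread A"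
  unfolding spread_def by simp

lemma spread_diff: "g \<in> spread A \<Longrightarrow> h \<in> spread A \<Longrightarrow> g - h \<in> spread A"
  using spread_add[of g A "- h"] spread_minus by auto

text \<open>Symmetrization: the squared modulus is the transform of the difference of two
  independent copies.\<close>

lemma cmod_fourier_sq:
  "(cmod (fourier A t))\<^sup>2 = measure_pmf.expectation (pair_pmf A A)
     (\<lambda>z. cos (t \<bullet> (real_vec (fst z) - real_vec (snd z))))"
proof -
  have "complex_of_real ((cmod (fourier A t))\<^sup>2) = fourier A t * cnj (fourier A t)"
    by (rule complex_norm_square)
  also have "cnj (fourier A t) = measure_pmf.expectation A (\<lambda>r. cis (- (t \<bullet> real_vec r)))"
    unfolding fourier_def by (simp add: cis_cnj flip: Bochner_Integration.integral_cnj)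
  also have "fourier A t * \<dots> = measure_pmf.expectation (pair_pmf A A)
     (\<lambda>z. cis (t \<bullet> (real_vec (fst z) - real_vec (snd z))))"
    unfolding fourier_def
    by (subst expectation_pair_pmf_mult[symmetric]) (simp_all add: cis_mult inner_diff_right)
  finally have "(cmod (fourier A t))\<^sup>2 = Re (measure_pmf.expectation (pair_pmf A A)
     (\<lambda>z. cis (t \<bullet> (real_vec (fst z) - real_vec (snd z)))))"
    by (metis Re_complex_of_real)
  also have "\<dots> = measure_pmf.expectation (pair_pmf A A)
     (\<lambda>z. Re (cis (t \<bullet> (real_vec (fst z) - real_vec (snd z)))))"
    by (rule integral_Re[symmetric]) (auto intro!: measure_pmf.integrable_const_bound[of _ 1])
  finally show ?thesis by simp
qed

text \<open>In the symmetrized expectation of \<open>1 - cos\<close> all terms are nonnegative, and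
  the single atom \<open>(r, s)\<close> already gives the bound.\<close>

lemma spread_support:
  assumes "r \<in> set_pmf A" "s \<in> set_pmf A"
  shows "real_vec r - real_vec s \<in> spread A"
proof -
  let ?h = "\<lambda>t z. t \<bullet> (real_vec (fst z) - real_vec (snd z))"
  define c where "c = pmf A r * pmf A s"
  have c: "c > 0" using assms by (simp add: c_def pmf_positive)
  have int: "integrable (measure_pmf (pair_pmf A A)) (\<lambda>z. cos (?h t z))" for t
    by (rule measure_pmf.integrable_const_bound[of _ 1]) auto
  have "1 - cos (?h t (r, s)) \<le> 1 / c * (1 - (cmod (fourier A t))\<^sup>2)" for t
  proof -
    have "c * (1 - cos (?h t (r, s))) =
        measure_pmf.expectation (pair_pmf A A) (\<lambda>z. indicator {(r, s)} z * (1 - cos (?h t (r, s))))"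
      by (simp add: c_def measure_pmf_single pmf_pair)
    also have "\<dots> \<le> measure_pmf.expectation (pair_pmf A A) (\<lambda>z. 1 - cos (?h t z))"
    proof (rule integral_mono)
      show "integrable (measure_pmf (pair_pmf A A)) (\<lambda>z. indicator {(r, s)} z * (1 - cos (?h t (r, s))))"
        by (intro integrable_mult_left integrable_real_indicator) (auto simp: measure_pmf.emeasure_eq_measure)
    qed (use int in \<open>auto simp: indicator_def\<close>)
    also have "\<dots> = 1 - (cmod (fourier A t))\<^sup>2"
      unfolding cmod_fourier_sq using int by simp
    finally show ?thesis using c by (simp add: field_simps)
  qed
  then show ?thesis unfolding spread_def fst_conv snd_conv by blast
qed

section \<open>The critical process cut at one type\<close>

lemma integrable_real_if_sq:
  assumes "integrable (measure_pmf A) (\<lambda>k. (real (size_vec k))\<^sup>2)"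
  shows "integrable (measure_pmf A) (\<lambda>k. real (k $ j))"
proof (rule Bochner_Integration.integrable_bound[OF assms])
  show "AE k in measure_pmf A. norm (real (k $ j)) \<le> norm ((real (size_vec k))\<^sup>2)"
    by (intro AE_I2) (simp only: real_norm_def abs_of_nat abs_power2 component_le_size_sq)
qed simp

lemma offspring_mean_pos_iff:
  assumes "integrable (measure_pmf (p i)) (\<lambda>k. real (k $ j))"
  shows "offspring_mean p i j > 0 \<longleftrightarrow> (\<exists>k\<in>set_pmf (p i). k $ j > 0)"
proof -
  have "offspring_mean p i j = 0 \<longleftrightarrow> (\<forall>k\<in>set_pmf (p i). k $ j = 0)"
    unfolding offspring_mean_def
    by (subst integral_nonneg_eq_0_iff_AE[OF assms]) (auto simp: AE_measure_pmf_iff)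
  moreover have "offspring_mean p i j > 0 \<longleftrightarrow> offspring_mean p i j \<noteq> 0"
    using offspring_mean_nonneg[of p i j] by linarith
  ultimately show ?thesis by auto
qed

lemma set_conv_pmf: "set_pmf (conv_pmf A B) = {x + y | x y. x \<in> set_pmf A \<and> y \<in> set_pmf B}"
  unfolding conv_pmf_def by auto

text \<open>Only offspring laws occur, no probability space. Irreducibility is phrased as
  reachability because it is used by induction along paths of types, towards \<open>\<tau>\<close>
  in \<open>ex_subcritical\<close> and away from it in \<open>excursion_aperiodic\<close>.\<close>

locale critical_offspring =
  fixes p :: "'d::finite \<Rightarrow> (nat ^ 'd) pmf" and u v :: "real ^ 'd" and \<tau> :: 'd
  assumes sq: "integrable (measure_pmf (p i)) (\<lambda>k. (real (size_vec k))\<^sup>2)"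
    and u_pos: "u $ i > 0" and v_pos: "v $ i > 0"
    and right_eigen: "(\<Sum>j\<in>UNIV. offspring_mean p i j * u $ j) = u $ i"
    and left_eigen: "(\<Sum>i\<in>UNIV. v $ i * offspring_mean p i j) = v $ j"
    and irreducible: "(i, j) \<in> {(i, j). offspring_mean p i j > 0}\<^sup>*"
    and aperiodic: "\<exists>i m. pmf (p i) m > 0 \<and> pmf (p i) (m + axis l 1) > 0"
begin

lemma offspring_mean_freeze:
  "offspring_mean (freeze \<tau> p) i j = (if i = \<tau> then 0 else offspring_mean p i j)"
  by (simp add: offspring_mean_def freeze_def)

lemma freeze_sq: "integrable (measure_pmf (freeze \<tau> p i)) (\<lambda>k. (real (size_vec k))\<^sup>2)"
  using sq by (auto simp: freeze_def intro: integrable_measure_pmf_finite)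

lemma ex_subcritical: "\<exists>w. subcritical (freeze \<tau> p) w"
proof -
  define M where "M = offspring_mean (freeze \<tau> p)"
  have M0: "M i j \<ge> 0" for i j by (simp add: M_def offspring_mean_nonneg)
  define y where "y n = ((\<lambda>z i. \<Sum>j\<in>UNIV. M i j * z j) ^^ n) (($) u)" for n
  have y0: "y 0 = ($) u" and ySuc: "y (Suc n) i = (\<Sum>j\<in>UNIV. M i j * y n j)" for n i
    by (simp_all add: y_def)
  have Mu: "(\<Sum>j\<in>UNIV. M i j * u $ j) = (if i = \<tau> then 0 else u $ i)" for i
    using right_eigen[of i] by (simp add: M_def offspring_mean_freeze)
  have dec: "y (Suc n) i \<le> y n i" for n i
  proof (induction n arbitrary: i)
    case 0
    then show ?case using u_pos[of i] by (auto simp: ySuc y0 Mu)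
  next
    case (Suc n)
    then show ?case unfolding ySuc[of "Suc n"] by (subst ySuc) (intro sum_mono mult_left_mono M0)
  qed
  have dec': "y n i \<le> y m i" if "m \<le> n" for m n i
    using lift_Suc_antimono_le[of "\<lambda>n. y n i", OF dec that] .
  have nonneg: "y n i \<ge> 0" for n i
  proof (induction n arbitrary: i)
    case 0
    then show ?case using u_pos[of i] by (simp add: y0)
  next
    case (Suc n)
    then show ?case unfolding ySuc by (intro sum_nonneg mult_nonneg_nonneg M0)
  qed
  \<comment> \<open>Backwards along a path from \<open>i\<close> to \<open>\<tau>\<close>: a drop at
    \<open>j\<close> after \<open>n\<close> steps gives one at its predecessor after
    \<open>n + 1\<close> steps.\<close>
  have "\<exists>n. y n i < u $ i" for i
    using irreducible[of i \<tau>]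
  proof (induction rule: converse_rtrancl_induct)
    case base
    have "y 1 \<tau> = 0" using Mu[of \<tau>] by (simp add: ySuc y0)
    then show ?case using u_pos[of \<tau>] by (intro exI[of _ 1]) simp
  next
    case (step i j)
    then obtain n where n: "y n j < u $ j" by blast
    show ?case
    proof (cases "i = \<tau>")
      case True
      then have "y 1 i = 0" using Mu[of \<tau>] by (simp add: ySuc y0)
      then show ?thesis using u_pos[of i] by (intro exI[of _ 1]) simp
    next
      case False
      have pos: "M i j > 0" using step(1) False by (simp add: M_def offspring_mean_freeze)
      have "y (Suc n) i < (\<Sum>j\<in>UNIV. M i j * u $ j)"
        unfolding ySuc
      proof (rule sum_strict_mono_ex1)
        show "\<forall>j\<in>UNIV. M i j * y n j \<le> M i j * u $ j"
          using dec'[of 0 n] by (auto intro!: mult_left_mono M0 simp: y0)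
        show "\<exists>a\<in>UNIV. M i a * y n a < M i a * u $ a"
          using n pos by (intro bexI[of _ j]) auto
      qed simp
      then show ?thesis using Mu[of i] False by auto
    qed
  qed
  then obtain k where k: "\<And>i. y (k i) i < u $ i" by metis
  define K where "K = Max (range k)"
  have K: "y K i < u $ i" for i
  proof -
    have "k i \<le> K" unfolding K_def by (rule Max_ge) auto
    then show ?thesis using dec'[of "k i" K i] k[of i] by linarith
  qed
  define \<epsilon> where "\<epsilon> = Min (range (\<lambda>i. u $ i - y K i))"
  have "\<epsilon> \<in> range (\<lambda>i. u $ i - y K i)" unfolding \<epsilon>_def by (rule Min_in) auto
  then have \<epsilon>: "\<epsilon> > 0" using K by auto
  have \<epsilon>_le: "\<epsilon> \<le> u $ i - y K i" for i unfolding \<epsilon>_def by (rule Min_le) auto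
  \<comment> \<open>A partial Neumann series applied to \<open>u\<close>. Then
    \<open>w - M w\<close> telescopes to the total drop divided by \<open>\<epsilon>\<close>, the
    smallest drop, and so is at least one.\<close>
  define w where "w i = (\<Sum>n<K. y n i) / \<epsilon>" for i
  have w0: "w i \<ge> 0" for i unfolding w_def using \<epsilon> nonneg by (intro divide_nonneg_pos sum_nonneg) auto
  have super: "w i \<ge> 1 + (\<Sum>j\<in>UNIV. M i j * w j)" for i
  proof -
    have "(\<Sum>j\<in>UNIV. M i j * w j) = (\<Sum>n<K. y (Suc n) i) / \<epsilon>"
      unfolding w_def ySuc sum_divide_distrib sum_distrib_left by (subst sum.swap) simp
    then have "w i - (\<Sum>j\<in>UNIV. M i j * w j) = (\<Sum>n<K. y n i - y (Suc n) i) / \<epsilon>"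
      by (simp add: w_def sum_subtractf diff_divide_distrib)
    also have "(\<Sum>n<K. y n i - y (Suc n) i) = u $ i - y K i"
      using sum_lessThan_telescope'[of "\<lambda>n. y n i" K] by (simp add: y0)
    also have "(u $ i - y K i) / \<epsilon> \<ge> 1" using \<epsilon>_le[of i] \<epsilon> by simp
    finally show ?thesis by linarith
  qed
  have "subcritical (freeze \<tau> p) w"
  proof
    fix i j
    show "integrable (measure_pmf (freeze \<tau> p i)) (\<lambda>k. real (k $ j))"
      by (rule integrable_real_if_sq[OF freeze_sq])
    show "w i \<ge> 1 + (\<Sum>j\<in>UNIV. offspring_mean (freeze \<tau> p) i j * w j)"
      using super by (simp add: M_def)
    have "(\<Sum>j\<in>UNIV. M i j * w j) \<ge> 0" by (intro sum_nonneg mult_nonneg_nonneg M0 w0)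
    then show "w i > 0" using super[of i] by linarith
  qed
  then show ?thesis by blast
qed

end

lemma norm_real_vec_le: "norm (real_vec r) \<le> real (size_vec r)"
  using norm_le_l1_cart[of "real_vec r"] by (simp add: size_vec_def)

context critical_offspring
begin

text \<open>The choice of the certificate is immaterial, since \<open>progeny_law\<close> does not
  mention it.\<close>

sublocale frozen: subcritical "freeze \<tau> p" "SOME w. subcritical (freeze \<tau> p) w"
  by (rule someI_ex[OF ex_subcritical])

text \<open>
  The joint law, for one individual of type \<open>\<tau>\<close>, of the number of its nearest descendants of type
  \<open>\<tau>\<close> (coordinate \<open>\<tau>\<close>) and of the numbers of individuals of the other types in between.
\<close>

definition excursion :: "(nat ^ 'd) pmf" where
  "excursion = bind_pmf (p \<tau>) frozen.progeny_law"

lemma Abs_mfps_excursion: "Abs_mfps (pmf excursion) = psum (p \<tau>) (progeny (freeze \<tau> p))"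
  by (rule mfps_eqI) (simp add: excursion_def frozen.pmf_bind_progeny_law)

lemma progeny_eq_sum:
  "real (m $ \<tau>) * cf (progeny p x) m =
    (\<Sum>r\<in>{..m}. real (r $ \<tau>) * pmf (conv_power excursion (m $ \<tau>)) (m - r) * pmf (frozen.progeny_law x) r)"
  unfolding otter_dwass Abs_mfps_excursion[symmetric] Abs_mfps_conv_power[symmetric] cf_times
  by (simp add: frozen.pmf_progeny_law mult_ac)

text \<open>The form suited to dominated convergence: the local limit theorem acts on the
  convolution power for fixed \<open>r\<close>, and \<open>r\<close> is averaged under a law
  independent of \<open>m\<close>.\<close>

lemma progeny_eq_expectation:
  "real (m $ \<tau>) * cf (progeny p x) m = measure_pmf.expectation (frozen.progeny_law x)
     (\<lambda>r. if r \<le> m then real (r $ \<tau>) * pmf (conv_power excursion (m $ \<tau>)) (m - r) else 0)"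
  unfolding progeny_eq_sum
  by (subst integral_measure_pmf_real[OF finite_atMost_vec[of m]]) (auto intro!: sum.cong split: if_splits)

lemma excursion_sq_size: "integrable (measure_pmf excursion) (\<lambda>r. (real (size_vec r))\<^sup>2)"
proof -
  obtain K where K: "K \<ge> 0"
    "\<And>x. (\<integral>\<^sup>+r. ennreal ((real (size_vec r))\<^sup>2) \<partial>frozen.progeny_law x) \<le> ennreal (K * (real (size_vec x))\<^sup>2)"
    using frozen.progeny_law_second_moment[OF freeze_sq] by blast
  have "(\<integral>\<^sup>+r. ennreal ((real (size_vec r))\<^sup>2) \<partial>excursion) \<le>
      (\<integral>\<^sup>+k. ennreal (K * (real (size_vec k))\<^sup>2) \<partial>p \<tau>)"
    unfolding excursion_def by (simp add: K nn_integral_mono)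
  also have "\<dots> = ennreal (measure_pmf.expectation (p \<tau>) (\<lambda>k. K * (real (size_vec k))\<^sup>2))"
    by (rule nn_integral_eq_integral) (use sq K in auto)
  also have "\<dots> < \<infinity>" by simp
  finally show ?thesis by (intro integrableI_nonneg) auto
qed

lemma excursion_sq: "integrable (measure_pmf excursion) (\<lambda>r. (norm (real_vec r))\<^sup>2)"
proof (rule Bochner_Integration.integrable_bound[OF excursion_sq_size])
  show "AE r in measure_pmf excursion. norm ((norm (real_vec r))\<^sup>2) \<le> norm ((real (size_vec r))\<^sup>2)"
    by (intro AE_I2) (simp add: norm_real_vec_le)
qed simp

text \<open>Criticality identifies two combinations of the Green matrix. Its column at
  \<open>\<tau>\<close> solves the same system as \<open>u / u $ \<tau>\<close>. Multiplying the
  system by \<open>v\<close> from the left, everything cancels except the row of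
  \<open>\<tau>\<close>, where freezing removed the offspring.\<close>

lemma frozen_means:
  obtains \<alpha> where "\<And>i l. \<alpha> i l \<ge> 0"
    "\<And>x l. (\<integral>\<^sup>+r. ennreal (real (r $ l)) \<partial>frozen.progeny_law x) = ennreal (\<Sum>i\<in>UNIV. real (x $ i) * \<alpha> i l)"
    "\<And>i. \<alpha> i \<tau> = u $ i / u $ \<tau>"
    "\<And>l. (\<Sum>j\<in>UNIV. offspring_mean p \<tau> j * \<alpha> j l) = v $ l / v $ \<tau>"
proof -
  obtain \<alpha> where \<alpha>: "\<And>i l. \<alpha> i l \<ge> 0"
    "\<And>x l. (\<integral>\<^sup>+r. ennreal (real (r $ l)) \<partial>frozen.progeny_law x) = ennreal (\<Sum>i\<in>UNIV. real (x $ i) * \<alpha> i l)"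
    "\<And>i l. \<alpha> i l = (if i = l then 1 else 0) + (\<Sum>j\<in>UNIV. offspring_mean (freeze \<tau> p) i j * \<alpha> j l)"
    using frozen.progeny_law_mean[OF freeze_sq] by blast
  \<comment> \<open>With the absolute value of the difference, the one-sided comparison with
    \<open>b = 0\<close> yields equality.\<close>
  define y where "y i = \<bar>\<alpha> i \<tau> - u $ i / u $ \<tau>\<bar>" for i
  have "y i \<le> 0 + (\<Sum>j\<in>UNIV. offspring_mean (freeze \<tau> p) i j * y j)" for i
  proof (cases "i = \<tau>")
    case True
    have "\<alpha> \<tau> \<tau> = 1" using \<alpha>(3)[of \<tau> \<tau>] by (simp add: offspring_mean_freeze)
    then have "y \<tau> = 0" using u_pos[of \<tau>] by (simp add: y_def)
    then show ?thesis using True by (simp add: offspring_mean_freeze)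
  next
    case False
    have "\<alpha> i \<tau> = (\<Sum>j\<in>UNIV. offspring_mean p i j * \<alpha> j \<tau>)"
      using \<alpha>(3)[of i \<tau>] False by (simp add: offspring_mean_freeze)
    moreover have "u $ i / u $ \<tau> = (\<Sum>j\<in>UNIV. offspring_mean p i j * (u $ j / u $ \<tau>))"
      unfolding right_eigen[of i, symmetric] sum_divide_distrib by simp
    ultimately have "y i = \<bar>\<Sum>j\<in>UNIV. offspring_mean p i j * (\<alpha> j \<tau> - u $ j / u $ \<tau>)\<bar>"
      unfolding y_def by (simp add: right_diff_distrib sum_subtractf)
    also have "\<dots> \<le> (\<Sum>j\<in>UNIV. \<bar>offspring_mean p i j * (\<alpha> j \<tau> - u $ j / u $ \<tau>)\<bar>)"
      by (rule sum_abs)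
    finally show ?thesis
      using False by (simp add: abs_mult y_def offspring_mean_freeze offspring_mean_nonneg)
  qed
  from frozen.subsolution[of y 0, OF this] have "y i \<le> 0" for i by simp
  then have 3: "\<alpha> i \<tau> = u $ i / u $ \<tau>" for i unfolding y_def by (metis abs_le_zero_iff eq_iff_diff_eq_0)
  have 4: "(\<Sum>j\<in>UNIV. offspring_mean p \<tau> j * \<alpha> j l) = v $ l / v $ \<tau>" for l
  proof -
    have vM: "(\<Sum>i\<in>UNIV. v $ i * offspring_mean (freeze \<tau> p) i j) = v $ j - v $ \<tau> * offspring_mean p \<tau> j" for j
    proof -
      have "(\<Sum>i\<in>UNIV. v $ i * offspring_mean (freeze \<tau> p) i j) =
          (\<Sum>i\<in>UNIV. v $ i * offspring_mean p i j - (if i = \<tau> then v $ \<tau> * offspring_mean p \<tau> j else 0))"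
        by (intro sum.cong) (auto simp: offspring_mean_freeze)
      then show ?thesis by (simp add: sum_subtractf left_eigen)
    qed
    have "(\<Sum>i\<in>UNIV. v $ i * \<alpha> i l) = (\<Sum>i\<in>UNIV. v $ i * (if i = l then 1 else 0)) +
        (\<Sum>i\<in>UNIV. \<Sum>j\<in>UNIV. v $ i * (offspring_mean (freeze \<tau> p) i j * \<alpha> j l))"
      by (subst \<alpha>(3)) (simp only: distrib_left sum.distrib sum_distrib_left)
    also have "(\<Sum>i\<in>UNIV. v $ i * (if i = l then 1 else 0)) = v $ l"
      by (simp add: if_distrib cong: if_cong)
    also have "(\<Sum>i\<in>UNIV. \<Sum>j\<in>UNIV. v $ i * (offspring_mean (freeze \<tau> p) i j * \<alpha> j l)) =
        (\<Sum>j\<in>UNIV. (\<Sum>i\<in>UNIV. v $ i * offspring_mean (freeze \<tau> p) i j) * \<alpha> j l)"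
      by (subst sum.swap) (simp add: sum_distrib_right mult.assoc)
    also have "(\<Sum>j\<in>UNIV. (\<Sum>i\<in>UNIV. v $ i * offspring_mean (freeze \<tau> p) i j) * \<alpha> j l) =
        (\<Sum>j\<in>UNIV. v $ j * \<alpha> j l) - v $ \<tau> * (\<Sum>j\<in>UNIV. offspring_mean p \<tau> j * \<alpha> j l)"
      by (simp add: vM left_diff_distrib sum_subtractf sum_distrib_left mult.assoc)
    finally have "v $ \<tau> * (\<Sum>j\<in>UNIV. offspring_mean p \<tau> j * \<alpha> j l) = v $ l" by simp
    then show ?thesis using v_pos[of \<tau>] by (simp add: field_simps)
  qed
  from \<alpha>(1,2) 3 4 show thesis by (rule that)
qed

lemma integrable_offspring: "integrable (measure_pmf (p i)) (\<lambda>k. real (k $ j))"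
  by (rule integrable_real_if_sq[OF sq])

text \<open>Proportionality to \<open>v\<close> is what places targets \<open>n v + O(1)\<close> at
  bounded distance from the centre of the local limit theorem.\<close>

lemma excursion_mean: "measure_pmf.expectation excursion real_vec = v /\<^sub>R v $ \<tau>"
proof -
  obtain \<alpha> where \<alpha>: "\<And>i l. \<alpha> i l \<ge> 0"
    "\<And>x l. (\<integral>\<^sup>+r. ennreal (real (r $ l)) \<partial>frozen.progeny_law x) = ennreal (\<Sum>i\<in>UNIV. real (x $ i) * \<alpha> i l)"
    "\<And>i. \<alpha> i \<tau> = u $ i / u $ \<tau>"
    "\<And>l. (\<Sum>j\<in>UNIV. offspring_mean p \<tau> j * \<alpha> j l) = v $ l / v $ \<tau>"
    by (rule frozen_means) blast
  have coord: "measure_pmf.expectation excursion (\<lambda>r. real (r $ l)) = v $ l / v $ \<tau>" for l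
  proof -
    have "ennreal (measure_pmf.expectation excursion (\<lambda>r. real (r $ l))) =
        (\<integral>\<^sup>+r. ennreal (real (r $ l)) \<partial>excursion)"
      by (rule nn_integral_eq_integral[symmetric]) (simp_all add: integrable_real_if_sq[OF excursion_sq_size])
    also have "\<dots> = (\<integral>\<^sup>+k. ennreal (\<Sum>i\<in>UNIV. real (k $ i) * \<alpha> i l) \<partial>p \<tau>)"
      unfolding excursion_def by (simp add: \<alpha>(2))
    also have "\<dots> = ennreal (v $ l / v $ \<tau>)"
      using nn_integral_offspring_sum[of p \<tau> "\<lambda>i. \<alpha> i l", OF integrable_offspring \<alpha>(1)]
      by (simp add: \<alpha>(4))
    finally show ?thesis
      using v_pos[of l] v_pos[of \<tau>] by (subst (asm) ennreal_inj) auto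
  qed
  have intv: "integrable (measure_pmf excursion) real_vec"
  proof (rule Bochner_Integration.integrable_bound)
    show "integrable (measure_pmf excursion) (\<lambda>r. \<Sum>j\<in>UNIV. real (r $ j))"
      by (intro Bochner_Integration.integrable_sum integrable_real_if_sq[OF excursion_sq_size])
    show "AE r in measure_pmf excursion. norm (real_vec r) \<le> norm (\<Sum>j\<in>UNIV. real (r $ j))"
      by (intro AE_I2, rule order_trans[OF norm_real_vec_le]) (simp add: size_vec_def)
  qed simp
  show ?thesis
  proof (intro vec_eq_iff[THEN iffD2] allI)
    fix l
    have "measure_pmf.expectation excursion real_vec $ l = measure_pmf.expectation excursion (\<lambda>r. real_vec r $ l)"
      using integral_inner_left[OF intv, of "axis l 1"] by (simp add: inner_axis)
    then show "measure_pmf.expectation excursion real_vec $ l = (v /\<^sub>R v $ \<tau>) $ l"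
      by (simp add: coord field_simps)
  qed
qed

text \<open>The source of the factor \<open>x \<bullet> u\<close> in the asymptotics.\<close>

lemma frozen_mean_\<tau>:
  "integrable (measure_pmf (frozen.progeny_law x)) (\<lambda>r. real (r $ \<tau>))"
  "measure_pmf.expectation (frozen.progeny_law x) (\<lambda>r. real (r $ \<tau>)) = (real_vec x \<bullet> u) / u $ \<tau>"
proof -
  obtain \<alpha> where \<alpha>: "\<And>i l. \<alpha> i l \<ge> 0"
    "\<And>x l. (\<integral>\<^sup>+r. ennreal (real (r $ l)) \<partial>frozen.progeny_law x) = ennreal (\<Sum>i\<in>UNIV. real (x $ i) * \<alpha> i l)"
    "\<And>i. \<alpha> i \<tau> = u $ i / u $ \<tau>"
    "\<And>l. (\<Sum>j\<in>UNIV. offspring_mean p \<tau> j * \<alpha> j l) = v $ l / v $ \<tau>"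
    by (rule frozen_means) blast
  have eq: "(\<Sum>i\<in>UNIV. real (x $ i) * \<alpha> i \<tau>) = (real_vec x \<bullet> u) / u $ \<tau>"
    by (simp add: \<alpha>(3) inner_vec_def sum_divide_distrib)
  have nn: "(\<integral>\<^sup>+r. ennreal (real (r $ \<tau>)) \<partial>frozen.progeny_law x) = ennreal ((real_vec x \<bullet> u) / u $ \<tau>)"
    by (simp add: \<alpha>(2) eq)
  have pos: "(real_vec x \<bullet> u) / u $ \<tau> \<ge> 0"
    unfolding eq[symmetric] by (intro sum_nonneg mult_nonneg_nonneg \<alpha>(1)) simp
  show int: "integrable (measure_pmf (frozen.progeny_law x)) (\<lambda>r. real (r $ \<tau>))"
    by (rule integrableI_nonneg) (auto simp: nn)
  have "ennreal (measure_pmf.expectation (frozen.progeny_law x) (\<lambda>r. real (r $ \<tau>))) = ennreal ((real_vec x \<bullet> u) / u $ \<tau>)"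
    unfolding nn[symmetric] by (rule nn_integral_eq_integral[OF int, symmetric]) simp
  then show "measure_pmf.expectation (frozen.progeny_law x) (\<lambda>r. real (r $ \<tau>)) = (real_vec x \<bullet> u) / u $ \<tau>"
    using pos by (subst (asm) ennreal_inj) auto
qed

text \<open>The set \<open>?T i\<close> consists of the possible cut progenies of the children of an
  individual of type \<open>i\<close>; for \<open>i = \<tau>\<close> it is the support of
  \<open>excursion\<close>. Differences inside \<open>?T i\<close> are carried from
  \<open>\<tau>\<close> to every type, (A5) turns differences into vectors, and unit vectors are
  obtained by removing descendants.\<close>

lemma excursion_aperiodic: "axis l 1 \<in> spread excursion"
proof -
  let ?G = "frozen.progeny_law"
  let ?T = "\<lambda>i. set_pmf (bind_pmf (p i) ?G)"
  let ?H = "spread excursion"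
  have ne: "\<exists>r. r \<in> set_pmf (?G x)" for x using set_pmf_not_empty[of "?G x"] by blast
  have GG: "x + y \<in> set_pmf (?G (a + b))" if "x \<in> set_pmf (?G a)" "y \<in> set_pmf (?G b)" for x y a b
    using that by (auto simp: frozen.progeny_law_plus set_conv_pmf)
  have fz: "freeze \<tau> p \<tau> = return_pmf 0" "\<And>i. i \<noteq> \<tau> \<Longrightarrow> freeze \<tau> p i = p i"
    by (simp_all add: freeze_def)
  have G_\<tau>: "?G (axis \<tau> 1) = return_pmf (axis \<tau> 1)"
    unfolding frozen.progeny_law_axis by (simp add: fz bind_return_pmf)
  have G_axis: "set_pmf (?G (axis i 1)) = (\<lambda>r. axis i 1 + r) ` ?T i" if "i \<noteq> \<tau>" for i
    using that unfolding frozen.progeny_law_axis by (simp add: fz)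
  \<comment> \<open>The subtree of one child of type \<open>j\<close> varies while the progeny
    \<open>r'\<close> of its siblings is kept fixed.\<close>
  have differ: "real_vec r - real_vec s \<in> ?H"
    if Q: "\<forall>r\<in>?T i. \<forall>s\<in>?T i. real_vec r - real_vec s \<in> ?H" and k: "k + axis j 1 \<in> set_pmf (p i)"
      and rs: "r \<in> set_pmf (?G (axis j 1))" "s \<in> set_pmf (?G (axis j 1))" for i j k r s
  proof -
    obtain r' where r': "r' \<in> set_pmf (?G k)" using ne by blast
    have "r' + r \<in> ?T i" "r' + s \<in> ?T i"
      using GG[OF r' rs(1)] GG[OF r' rs(2)] k unfolding set_bind_pmf by blast+
    with Q have "real_vec (r' + r) - real_vec (r' + s) \<in> ?H" by blast
    then show ?thesis by (simp add: real_vec_plus)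
  qed
  have Q: "\<forall>r\<in>?T i. \<forall>s\<in>?T i. real_vec r - real_vec s \<in> ?H" for i
    using irreducible[of \<tau> i]
  proof (induction rule: rtrancl_induct)
    case base
    show ?case using spread_support[of _ excursion] by (simp add: excursion_def)
  next
    case (step i j)
    show ?case
    proof (cases "j = \<tau>")
      case True
      then show ?thesis using spread_support[of _ excursion] by (simp add: excursion_def)
    next
      case False
      from step(2) obtain k where k: "k \<in> set_pmf (p i)" "k $ j > 0"
        using offspring_mean_pos_iff[OF integrable_offspring] by auto
      then have "(k - axis j 1) + axis j 1 \<in> set_pmf (p i)"
        by (simp add: add.commute[of _ "axis j (Suc 0)"] vec_add_diff_inverse axis_le_iff)
      note st = differ[OF step.IH this]
      show ?thesis
      proof (intro ballI)
        fix r s assume "r \<in> ?T j" "s \<in> ?T j"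
        then have "axis j 1 + r \<in> set_pmf (?G (axis j 1))" "axis j 1 + s \<in> set_pmf (?G (axis j 1))"
          unfolding G_axis[OF False] by auto
        from st[OF this] show "real_vec r - real_vec s \<in> ?H"
          by (simp add: real_vec_plus)
      qed
    qed
  qed
  \<comment> \<open>Two offspring vectors differing by one individual of type \<open>l\<close> allow
    the whole progeny \<open>s\<close> of that individual to be added or omitted.\<close>
  have S: "real_vec s \<in> ?H" if s: "s \<in> set_pmf (?G (axis l 1))" for s l
  proof -
    obtain i m where im: "m \<in> set_pmf (p i)" "m + axis l 1 \<in> set_pmf (p i)"
      using aperiodic[of l] unfolding pmf_positive_iff by blast
    obtain r where r: "r \<in> set_pmf (?G m)" using ne by blast
    have "r \<in> ?T i" "r + s \<in> ?T i"
      using GG[OF r s] r im unfolding set_bind_pmf by blast+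
    with Q[of i] have "real_vec (r + s) - real_vec r \<in> ?H" by blast
    then show ?thesis by (simp add: real_vec_plus)
  qed
  have Sk: "\<forall>s\<in>set_pmf (?G k). real_vec s \<in> ?H" for k
  proof (induction k rule: nat_vec_induct)
    case (add_axis k i)
    then show ?case
      using S[of _ i] by (auto simp: frozen.progeny_law_plus set_conv_pmf real_vec_plus simp del: One_nat_def intro!: spread_add)
  qed (simp add: spread_zero)
  have ax: "real_vec (axis l 1) = (axis l 1 :: real ^ 'd)"
    by (simp add: vec_eq_iff axis_def)
  show ?thesis
  proof (cases "l = \<tau>")
    case True
    then show ?thesis using S[of "axis l 1" l] G_\<tau> ax by simp
  next
    case False
    \<comment> \<open>The progeny of an individual of type \<open>l\<close> is the individual
      together with the progeny \<open>r\<close> of its children; both it and \<open>r\<close> lie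
      in the subgroup, hence so does their difference.\<close>
    obtain k where k: "k \<in> set_pmf (p l)" using set_pmf_not_empty[of "p l"] by blast
    obtain r where r: "r \<in> set_pmf (?G k)" using ne by blast
    have "axis l 1 + r \<in> set_pmf (?G (axis l 1))"
      unfolding G_axis[OF False] using k r by auto
    from spread_diff[OF S[OF this]] Sk[of k] r have "real_vec (axis l 1 + r) - real_vec r \<in> ?H" by blast
    then show ?thesis using ax by (simp add: real_vec_plus)
  qed
qed

end

section \<open>Asymptotics of the law of the total progeny\<close>

context critical_offspring
begin

theorem progeny_asymptotics:
  obtains L where "L > 0"
    "\<And>x m. (\<And>i. \<exists>B. \<forall>\<^sub>F n in sequentially. \<bar>real (m n $ i) - real n * v $ i\<bar> \<le> B) \<Longrightarrow>
      (\<lambda>n. sqrt (real n) ^ CARD('d) * real n * cf (progeny p x) (m n)) \<longlonglongrightarrow> L * (real_vec x \<bullet> u)"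
proof -
  have aper: "\<exists>C. \<forall>t. 1 - cos (t $ l) \<le> C * (1 - (cmod (fourier excursion t))\<^sup>2)" for l
    using excursion_aperiodic[of l] by (simp add: spread_def inner_axis)
  obtain L B where L: "L > 0"
    and bound: "\<And>n w. n > 0 \<Longrightarrow> sqrt (real n) ^ CARD('d) * pmf (conv_power excursion n) w \<le> B"
    and limit: "\<And>N w. filterlim N at_top sequentially \<Longrightarrow>
       (\<lambda>n. (real_vec (w n) - real (N n) *\<^sub>R (v /\<^sub>R v $ \<tau>)) /\<^sub>R sqrt (real (N n))) \<longlonglongrightarrow> 0 \<Longrightarrow>
       (\<lambda>n. sqrt (real (N n)) ^ CARD('d) * pmf (conv_power excursion (N n)) (w n)) \<longlonglongrightarrow> L"
    using local_limit_theorem[OF excursion_sq aper] unfolding excursion_mean by blast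
  \<comment> \<open>The limit of \<open>(n / N n)^(1 + d/2)\<close>, where \<open>N n\<close> is
    asymptotic to \<open>n v $ \<tau>\<close>: it converts the scale of the local limit theorem into
    powers of \<open>n\<close>.\<close>
  define c where "c = sqrt (1 / v $ \<tau>) ^ CARD('d) * (1 / v $ \<tau>)"
  have c: "c > 0" unfolding c_def using v_pos[of \<tau>] by simp
  show thesis
  proof (rule that)
    show "c * L / u $ \<tau> > 0" using c L u_pos[of \<tau>] by simp
    fix x m
    assume bd: "\<And>i. \<exists>B. \<forall>\<^sub>F n in sequentially. \<bar>real (m n $ i) - real n * v $ i\<bar> \<le> B"
    then obtain D where D: "\<And>i. \<forall>\<^sub>F n in sequentially. \<bar>real (m n $ i) - real n * v $ i\<bar> \<le> D i" by metis
    have top: "filterlim (\<lambda>n. m n $ i) at_top sequentially" for i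
    proof -
      have "filterlim (\<lambda>n. real n * v $ i - D i) at_top sequentially"
        using v_pos[of i] by real_asymp
      then have "filterlim (\<lambda>n. real (m n $ i)) at_top sequentially"
        by (rule filterlim_at_top_mono) (use D[of i] in \<open>eventually_elim, linarith\<close>)
      then show ?thesis
        by (simp add: filterlim_sequentially_iff_filterlim_real)
    qed
    define N where "N n = m n $ \<tau>" for n
    have N: "filterlim N at_top sequentially" unfolding N_def by (rule top)
    have evN: "\<forall>\<^sub>F n in sequentially. N n > 0"
      using N by (metis eventually_gt_at_top filterlim_iff)
    have evle: "\<forall>\<^sub>F n in sequentially. r \<le> m n" for r
    proof -
      have "\<forall>\<^sub>F n in sequentially. \<forall>i. r $ i \<le> m n $ i"
        by (rule eventually_all_finite) (use top in \<open>auto simp: filterlim_at_top\<close>)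
      then show ?thesis by (simp add: less_eq_vec_def)
    qed
    let ?E = "measure_pmf.expectation (frozen.progeny_law x)"
    \<comment> \<open>The condition \<open>N n > 0\<close> is needed for the bound \<open>B\<close>,
      which then dominates the integrand by \<open>r $ \<tau> * B\<close> for every
      \<open>n\<close>.\<close>
    let ?h = "\<lambda>n r. if r \<le> m n \<and> N n > 0 then real (r $ \<tau>) * (sqrt (real (N n)) ^ CARD('d) * pmf (conv_power excursion (N n)) (m n - r)) else 0"
    have "(\<lambda>n. ?E (?h n)) \<longlonglongrightarrow> ?E (\<lambda>r. real (r $ \<tau>) * L)"
    proof (rule integral_dominated_convergence[where w = "\<lambda>r. real (r $ \<tau>) * B"])
      show "integrable (measure_pmf (frozen.progeny_law x)) (\<lambda>r. real (r $ \<tau>) * B)"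
        using frozen_mean_\<tau>(1) by simp
      show "AE r in measure_pmf (frozen.progeny_law x). (\<lambda>n. ?h n r) \<longlonglongrightarrow> real (r $ \<tau>) * L"
      proof (rule AE_I2)
        fix r
        have "(\<lambda>n. (real_vec (m n - r) - real (N n) *\<^sub>R (v /\<^sub>R v $ \<tau>)) /\<^sub>R sqrt (real (N n))) \<longlonglongrightarrow> 0"
        proof (rule tendsto_bounded_over_sqrt[OF N])
          fix i
          \<comment> \<open>The centre \<open>N n * v $ i / v $ \<tau>\<close> differs from
            \<open>n * v $ i\<close> by the error of coordinate \<open>\<tau>\<close> times
            \<open>v $ i / v $ \<tau>\<close>; the other two terms are the error of coordinate
            \<open>i\<close> and the fixed shift by \<open>r\<close>.\<close>
          define K where "K = D i + real (r $ i) + D \<tau> * (v $ i / v $ \<tau>)"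
          have "\<forall>\<^sub>F n in sequentially. \<bar>(real_vec (m n - r) - real (N n) *\<^sub>R (v /\<^sub>R v $ \<tau>)) $ i\<bar> \<le> K"
            using D[of i] D[of \<tau>] evle[of r]
          proof eventually_elim
            case (elim n)
            have "r $ i \<le> m n $ i" using elim by (simp add: less_eq_vec_def)
            then have eq: "(real_vec (m n - r) - real (N n) *\<^sub>R (v /\<^sub>R v $ \<tau>)) $ i =
                (real (m n $ i) - real n * v $ i) - real (r $ i) - (real (m n $ \<tau>) - real n * v $ \<tau>) * (v $ i / v $ \<tau>)"
              using v_pos[of \<tau>] by (simp add: N_def of_nat_diff field_simps)
            have "\<bar>(real (m n $ \<tau>) - real n * v $ \<tau>) * (v $ i / v $ \<tau>)\<bar> \<le> D \<tau> * (v $ i / v $ \<tau>)"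
              unfolding abs_mult using elim(2) v_pos[of i] v_pos[of \<tau>] by (intro mult_mono) auto
            then show ?case unfolding eq K_def using elim(1) by linarith
          qed
          then show "\<exists>B. \<forall>\<^sub>F n in sequentially. \<bar>(real_vec (m n - r) - real (N n) *\<^sub>R (v /\<^sub>R v $ \<tau>)) $ i\<bar> \<le> B"
            by blast
        qed
        from limit[OF N this]
        have "(\<lambda>n. real (r $ \<tau>) * (sqrt (real (N n)) ^ CARD('d) * pmf (conv_power excursion (N n)) (m n - r))) \<longlonglongrightarrow> real (r $ \<tau>) * L"
          by (rule tendsto_mult_left)
        then show "(\<lambda>n. ?h n r) \<longlonglongrightarrow> real (r $ \<tau>) * L"
          by (rule Lim_transform_eventually) (use evle[of r] evN in \<open>eventually_elim, simp\<close>)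
      qed
      have B: "B \<ge> 0" using bound[of 1 0] by (simp add: order_trans[OF pmf_nonneg])
      show "AE r in measure_pmf (frozen.progeny_law x). norm (?h n r) \<le> real (r $ \<tau>) * B" for n
        by (rule AE_I2) (auto simp: abs_mult B intro!: mult_left_mono bound)
    qed auto
    also have "?E (\<lambda>r. real (r $ \<tau>) * L) = (real_vec x \<bullet> u) / u $ \<tau> * L"
      using frozen_mean_\<tau>[of x] by simp
    finally have lim: "(\<lambda>n. ?E (?h n)) \<longlonglongrightarrow> (real_vec x \<bullet> u) / u $ \<tau> * L" .
    have eq: "sqrt (real (N n)) ^ CARD('d) * (real (N n) * cf (progeny p x) (m n)) = ?E (?h n)" if "N n > 0" for n
      unfolding N_def progeny_eq_expectation
      by (subst integral_mult_right_zero[symmetric], rule Bochner_Integration.integral_cong)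
         (use that in \<open>auto simp: N_def\<close>)
    have ratio: "(\<lambda>n. real n / real (N n)) \<longlonglongrightarrow> 1 / v $ \<tau>"
    proof -
      have "(\<lambda>n. (real (N n) - real n * v $ \<tau>) / real n) \<longlonglongrightarrow> 0"
      proof (rule Lim_null_comparison[where g = "\<lambda>n. D \<tau> / real n"])
        show "\<forall>\<^sub>F n in sequentially. norm ((real (N n) - real n * v $ \<tau>) / real n) \<le> D \<tau> / real n"
          using D[of \<tau>] by eventually_elim (simp add: N_def divide_right_mono)
        show "(\<lambda>n. D \<tau> / real n) \<longlonglongrightarrow> 0" by (rule lim_const_over_n)
      qed
      then have "(\<lambda>n. (real (N n) - real n * v $ \<tau>) / real n + v $ \<tau>) \<longlonglongrightarrow> 0 + v $ \<tau>"
        by (rule tendsto_add) simp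
      then have "(\<lambda>n. inverse ((real (N n) - real n * v $ \<tau>) / real n + v $ \<tau>)) \<longlonglongrightarrow> inverse (0 + v $ \<tau>)"
        by (rule tendsto_inverse) (use v_pos[of \<tau>] in simp)
      then have "(\<lambda>n. real n / real (N n)) \<longlonglongrightarrow> inverse (0 + v $ \<tau>)"
        by (rule Lim_transform_eventually)
           (use eventually_gt_at_top[of 0] in \<open>eventually_elim, simp add: field_simps\<close>)
      then show ?thesis by (simp add: inverse_eq_divide)
    qed
    have "(\<lambda>n. (sqrt (real n / real (N n)) ^ CARD('d) * (real n / real (N n))) * ?E (?h n)) \<longlonglongrightarrow>
        c * ((real_vec x \<bullet> u) / u $ \<tau> * L)"
      unfolding c_def by (intro tendsto_intros ratio lim)
    moreover have "\<forall>\<^sub>F n in sequentially. (sqrt (real n / real (N n)) ^ CARD('d) * (real n / real (N n))) * ?E (?h n) =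
        sqrt (real n) ^ CARD('d) * real n * cf (progeny p x) (m n)"
      using evN
    proof eventually_elim
      case (elim n)
      show ?case
        unfolding eq[OF elim, symmetric] real_sqrt_divide power_divide using elim by simp
    qed
    ultimately have "(\<lambda>n. sqrt (real n) ^ CARD('d) * real n * cf (progeny p x) (m n)) \<longlonglongrightarrow> c * ((real_vec x \<bullet> u) / u $ \<tau> * L)"
      by (rule Lim_transform_eventually)
    then show "(\<lambda>n. sqrt (real n) ^ CARD('d) * real n * cf (progeny p x) (m n)) \<longlonglongrightarrow> c * L / u $ \<tau> * (real_vec x \<bullet> u)"
      by (simp add: mult_ac)
  qed
qed

end

subsection \<open>Paths and total progeny of a Galton--Watson process\<close>

text \<open>Finite points of \<open>enat\<close> are isolated, so convergence to one of them means
  that the partial sums become constant. This makes the event of a given total progeny a countable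
  combination of events on finitely many generations.\<close>

lemma suminf_enat_eq_iff:
  fixes f :: "nat \<Rightarrow> nat"
  shows "(\<Sum>k. enat (f k)) = enat M \<longleftrightarrow> (\<forall>\<^sub>F n in sequentially. (\<Sum>l<n. f l) = M)"
proof -
  have partial: "(\<Sum>l<n. enat (f l)) = enat (\<Sum>l<n. f l)" for n
    by (induction n) (auto simp: zero_enat_def)
  show ?thesis
  proof
    assume "(\<Sum>k. enat (f k)) = enat M"
    with summable_LIMSEQ[of "\<lambda>k. enat (f k)"] have "(\<lambda>n. enat (\<Sum>l<n. f l)) \<longlonglongrightarrow> enat M"
      by (simp add: partial)
    from topological_tendstoD[OF this open_enat] show "\<forall>\<^sub>F n in sequentially. (\<Sum>l<n. f l) = M"
      by simp
  next
    assume "\<forall>\<^sub>F n in sequentially. (\<Sum>l<n. f l) = M"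
    then have "(\<lambda>n. \<Sum>l<n. enat (f l)) \<longlonglongrightarrow> enat M"
      unfolding partial by (intro tendsto_eventually) (auto elim: eventually_mono)
    then show "(\<Sum>k. enat (f k)) = enat M"
      by (simp add: sums_def[symmetric] sums_unique[symmetric])
  qed
qed

lemma total_progeny_eq_iff:
  "total_progeny X \<omega> = (\<chi> i. enat (m $ i)) \<longleftrightarrow> (\<forall>\<^sub>F n in sequentially. (\<Sum>l<n. X l \<omega>) = m)"
proof -
  have "total_progeny X \<omega> = (\<chi> i. enat (m $ i)) \<longleftrightarrow>
      (\<forall>i. \<forall>\<^sub>F n in sequentially. (\<Sum>l<n. X l \<omega>) $ i = m $ i)"
    by (simp add: total_progeny_def vec_eq_iff suminf_enat_eq_iff)
  also have "\<dots> \<longleftrightarrow> (\<forall>\<^sub>F n in sequentially. \<forall>i. (\<Sum>l<n. X l \<omega>) $ i = m $ i)"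
    by (auto intro: eventually_all_finite elim: eventually_mono)
  finally show ?thesis by (simp add: vec_eq_iff)
qed

lemma partial_progeny_le:
  assumes "total_progeny X \<omega> = (\<chi> i. enat (m $ i))"
  shows "(\<Sum>l<n. X l \<omega>) \<le> m"
proof -
  from assms obtain N where N: "\<And>n. n \<ge> N \<Longrightarrow> (\<Sum>l<n. X l \<omega>) = m"
    unfolding total_progeny_eq_iff eventually_sequentially by blast
  have "(\<Sum>l<n. X l \<omega> $ i) \<le> (\<Sum>l<max n N. X l \<omega> $ i)" for i
    by (rule sum_mono2) auto
  then have "(\<Sum>l<n. X l \<omega>) \<le> (\<Sum>l<max n N. X l \<omega>)"
    by (simp add: less_eq_vec_def)
  then show ?thesis using N[of "max n N"] by simp
qed

context galton_watson
begin

lemma measurable_X_eq [measurable]: "Measurable.pred (P x) (\<lambda>\<omega>. X l \<omega> = z)"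
  using measurable_X[of l x] by measurable

lemma measurable_progeny [measurable]:
  "Measurable.pred (P x) (\<lambda>\<omega>. total_progeny X \<omega> = (\<chi> i. enat (m $ i)))"
proof -
  have *: "(\<lambda>\<omega>. \<Sum>l<n. X l \<omega>) \<in> measurable (P x) (count_space UNIV)" for n
  proof (induction n)
    case (Suc n)
    have "(\<lambda>\<omega>. (\<Sum>l<n. X l \<omega>, X n \<omega>)) \<in>
        measurable (P x) (count_space UNIV \<Otimes>\<^sub>M count_space UNIV)"
      by (intro measurable_Pair Suc measurable_X)
    then have "(\<lambda>\<omega>. (\<Sum>l<n. X l \<omega>, X n \<omega>)) \<in> measurable (P x) (count_space UNIV)"
      by (subst (asm) pair_measure_countable) simp_all
    from measurable_compose[OF this, of "\<lambda>(a, b). a + b" "count_space UNIV"]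
    show ?case by (simp add: add.commute)
  qed simp
  have [measurable]: "Measurable.pred (P x) (\<lambda>\<omega>. (\<Sum>l<n. X l \<omega>) = m)" for n
    using *[of n] by measurable
  show ?thesis unfolding total_progeny_eq_iff eventually_sequentially by measurable
qed

definition cylinder :: "nat ^ 'd \<Rightarrow> nat \<Rightarrow> (nat \<Rightarrow> nat ^ 'd) \<Rightarrow> 'a set" where
  "cylinder x k y = {\<omega> \<in> space (P x). \<forall>l\<le>k. X l \<omega> = y l}"

lemma sets_cylinder [measurable]: "cylinder x k y \<in> sets (P x)"
  unfolding cylinder_def by measurable

lemma measure_cylinder_0: "measure (P x) (cylinder x 0 y) = (if y 0 = x then 1 else 0)"
proof -
  interpret prob_space "P x" by (rule prob_space_P)
  have eq: "cylinder x 0 y = {\<omega> \<in> space (P x). X 0 \<omega> = y 0}" by (simp add: cylinder_def)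
  show ?thesis
  proof (cases "y 0 = x")
    case True
    have "prob {\<omega> \<in> space (P x). X 0 \<omega> = y 0} = 1"
      by (subst prob_Collect_eq_1) (use start[of x] True in auto)
    then show ?thesis using True eq by simp
  next
    case False
    have "prob {\<omega> \<in> space (P x). X 0 \<omega> = y 0} = 0"
      by (subst prob_Collect_eq_0) (use start[of x] False in \<open>auto elim: eventually_mono\<close>)
    then show ?thesis using False eq by simp
  qed
qed

lemma measure_cylinder_Suc:
  "measure (P x) (cylinder x (Suc k) y) = measure (P x) (cylinder x k y) * pmf (next_generation p (y k)) (y (Suc k))"
  unfolding cylinder_def by (rule markov)

lemma cylinder_cong: "(\<And>l. l \<le> k \<Longrightarrow> y l = y' l) \<Longrightarrow> cylinder x k y = cylinder x k y'"
  unfolding cylinder_def by auto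

text \<open>Extending a cylinder by zeros does not change its probability, because the empty
  population has an empty next generation. The Markov property speaks only of cylinder
  probabilities, so the conclusion is almost sure.\<close>

lemma extinct_forever:
  assumes "y k = 0"
  shows "AE \<omega> in P x. \<omega> \<in> cylinder x k y \<longrightarrow> (\<forall>l>k. X l \<omega> = 0)"
proof -
  interpret prob_space "P x" by (rule prob_space_P)
  define y' where "y' l = (if l \<le> k then y l else 0)" for l
  have same: "cylinder x k y = cylinder x k y'" by (rule cylinder_cong) (simp add: y'_def)
  have pr: "prob (cylinder x (k + j) y') = prob (cylinder x k y)" for j
  proof (induction j)
    case (Suc j)
    have "y' (k + j) = 0" "y' (Suc (k + j)) = 0" using assms by (auto simp: y'_def)
    then show ?case using Suc measure_cylinder_Suc[of x "k + j" y'] by simp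
  qed (simp add: same)
  have sub: "cylinder x (k + j) y' \<subseteq> cylinder x k y" for j
    unfolding same by (auto simp: cylinder_def)
  have "AE \<omega> in P x. \<omega> \<notin> cylinder x k y - cylinder x (k + j) y'" for j
  proof -
    have "prob (cylinder x k y - cylinder x (k + j) y') = 0"
      using finite_measure_Diff[OF _ _ sub[of j]] pr[of j] by simp
    then show ?thesis by (subst prob_eq_0[symmetric]) auto
  qed
  then have "AE \<omega> in P x. \<forall>j. \<omega> \<notin> cylinder x k y - cylinder x (k + j) y'"
    unfolding AE_all_countable by blast
  then show ?thesis
  proof eventually_elim
    case (elim \<omega>)
    show ?case
    proof (intro impI allI)
      fix l assume "\<omega> \<in> cylinder x k y" "l > k"
      with elim have "\<omega> \<in> cylinder x (k + (l - k)) y'" by blast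
      then have "X l \<omega> = y' l" using \<open>l > k\<close> by (simp add: cylinder_def)
      then show "X l \<omega> = 0" using \<open>l > k\<close> by (simp add: y'_def)
    qed
  qed
qed

text \<open>The link between the process and its formal progeny. Generation \<open>k\<close> is
  counted by \<open>progeny p (y k)\<close>, hence the sum stops before \<open>k\<close>. The
  induction measure, the part of \<open>m\<close> not yet used up, decreases only if
  \<open>y k \<noteq> 0\<close>; an empty generation is settled by
  \<open>extinct_forever\<close>.\<close>

lemma joint_progeny:
  "measure (P x) {\<omega> \<in> space (P x). (\<forall>l\<le>k. X l \<omega> = y l) \<and> total_progeny X \<omega> = (\<chi> i. enat (m $ i))} =
   measure (P x) (cylinder x k y) * cf (zmon (\<Sum>l<k. y l) * progeny p (y k)) m"
proof (induction "size_vec m - size_vec (\<Sum>l<k. y l)" arbitrary: k y rule: less_induct)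
  case less
  interpret prob_space "P x" by (rule prob_space_P)
  let ?E = "\<lambda>k y. {\<omega> \<in> space (P x). (\<forall>l\<le>k. X l \<omega> = y l) \<and> total_progeny X \<omega> = (\<chi> i. enat (m $ i))}"
  define s where "s = (\<Sum>l<k. y l)"
  have part: "(\<Sum>l<Suc k. X l \<omega>) = s + y k" if "\<omega> \<in> cylinder x k y" for \<omega>
    using that by (simp add: s_def cylinder_def)
  consider "\<not> s + y k \<le> m" | "y k = 0" | "s + y k \<le> m" "y k \<noteq> 0" by blast
  then show ?case
  proof cases
    case 1
    have "\<omega> \<notin> ?E k y" for \<omega>
    proof
      assume "\<omega> \<in> ?E k y"
      then have "\<omega> \<in> cylinder x k y" "total_progeny X \<omega> = (\<chi> i. enat (m $ i))" by (auto simp: cylinder_def)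
      with part partial_progeny_le[of X \<omega> m "Suc k"] 1 show False by metis
    qed
    then have "?E k y = {}" by blast
    moreover have "cf (zmon s * progeny p (y k)) m = 0"
      using 1 by (subst progeny_rec) (simp add: mult.assoc[symmetric] zmon_plus[symmetric] cf_zmon_times)
    ultimately show ?thesis unfolding s_def by (simp only: measure_empty mult_zero_right)
  next
    case 2
    have "AE \<omega> in P x. \<omega> \<in> ?E k y \<longleftrightarrow> \<omega> \<in> (if s = m then cylinder x k y else {})"
      using extinct_forever[of y k x, OF 2]
    proof eventually_elim
      case (elim \<omega>)
      have "total_progeny X \<omega> = (\<chi> i. enat (m $ i)) \<longleftrightarrow> s = m" if "\<omega> \<in> cylinder x k y"
      proof -
        have ps: "(\<Sum>l<n. X l \<omega>) = s" if "n \<ge> k" for n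
        proof -
          have "(\<Sum>l<n. X l \<omega>) = (\<Sum>l<k. X l \<omega>)"
          proof (rule sum.mono_neutral_right)
            show "\<forall>l\<in>{..<n} - {..<k}. X l \<omega> = 0"
            proof
              fix l assume "l \<in> {..<n} - {..<k}"
              then have "l = k \<or> l > k" by auto
              then show "X l \<omega> = 0" using elim \<open>\<omega> \<in> cylinder x k y\<close> 2 by (auto simp: cylinder_def)
            qed
          qed (use that in auto)
          also have "\<dots> = s" using \<open>\<omega> \<in> cylinder x k y\<close> by (simp add: s_def cylinder_def)
          finally show ?thesis .
        qed
        show ?thesis
          unfolding total_progeny_eq_iff eventually_sequentially
          using ps by (metis le_max_iff_disj max.cobounded1 max.cobounded2 order_refl)
      qed
      then show ?case by (auto simp: cylinder_def)
    qed
    then have "prob (?E k y) = prob (if s = m then cylinder x k y else {})"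
      by (intro measure_eq_AE) auto
    moreover have "cf (zmon s * progeny p (y k)) m = (if s = m then 1 else 0)"
      unfolding 2 by (simp add: zmon_def)
    ultimately show ?thesis unfolding s_def by auto
  next
    case 3
    have "?E k y = (\<Union>z\<in>{..m}. ?E (Suc k) (y(Suc k := z)))"
    proof (intro equalityI subsetI)
      fix \<omega> assume \<omega>: "\<omega> \<in> ?E k y"
      have "(\<Sum>l<Suc (Suc k). X l \<omega>) \<le> m" using \<omega> by (intro partial_progeny_le) auto
      moreover have "X (Suc k) \<omega> \<le> (\<Sum>l<Suc (Suc k). X l \<omega>)"
        by (simp add: less_eq_vec_def)
      ultimately have "X (Suc k) \<omega> \<in> {..m}" by (metis atMost_iff order_trans)
      moreover have "\<omega> \<in> ?E (Suc k) (y(Suc k := X (Suc k) \<omega>))"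
        using \<omega> by (auto simp: le_Suc_eq)
      ultimately show "\<omega> \<in> (\<Union>z\<in>{..m}. ?E (Suc k) (y(Suc k := z)))" by blast
    next
      fix \<omega> assume "\<omega> \<in> (\<Union>z\<in>{..m}. ?E (Suc k) (y(Suc k := z)))"
      then show "\<omega> \<in> ?E k y" by (force simp: le_Suc_eq)
    qed
    then have "prob (?E k y) = (\<Sum>z\<in>{..m}. prob (?E (Suc k) (y(Suc k := z))))"
      by (simp only:) (intro finite_measure_finite_Union finite_atMost_vec, auto simp: disjoint_family_on_def)
    also have "\<dots> = (\<Sum>z\<in>{..m}. prob (cylinder x k y) * (pmf (next_generation p (y k)) z * cf (zmon (s + y k) * progeny p z) m))"
    proof (intro sum.cong refl)
      fix z
      let ?y = "y(Suc k := z)"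
      have s': "(\<Sum>l<Suc k. ?y l) = s + y k" by (simp add: s_def)
      have "size_vec s < size_vec (s + y k)" "size_vec (s + y k) \<le> size_vec m"
        using 3 size_vec_diff[of "s + y k" m] by (auto simp: zero_less_iff_neq_zero)
      then have "size_vec m - size_vec (\<Sum>l<Suc k. ?y l) < size_vec m - size_vec (\<Sum>l<k. y l)"
        unfolding s' s_def[symmetric] by linarith
      from less[OF this]
      have "prob (?E (Suc k) ?y) = prob (cylinder x (Suc k) ?y) * cf (zmon (s + y k) * progeny p z) m"
        unfolding s' by (simp only: fun_upd_same)
      moreover have "prob (cylinder x (Suc k) ?y) = prob (cylinder x k y) * pmf (next_generation p (y k)) z"
        unfolding measure_cylinder_Suc using cylinder_cong[of k ?y y x] by simp
      ultimately show "prob (?E (Suc k) ?y) =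
          prob (cylinder x k y) * (pmf (next_generation p (y k)) z * cf (zmon (s + y k) * progeny p z) m)"
        by simp
    qed
    \<comment> \<open>The next generation was allowed to range up to \<open>m\<close> rather than up
      to the remaining \<open>m - (s + y k)\<close>; by admissibility the surplus terms are
      zero.\<close>
    also have "\<dots> = prob (cylinder x k y) * cf (zmon (s + y k) * psum (next_generation p (y k)) (progeny p)) m"
      using 3(1) by (simp add: cf_zmon_times cf_psum_le[OF admissible_progeny, of "m - (s + y k)" m] sum_distrib_left)
    also have "zmon (s + y k) * psum (next_generation p (y k)) (progeny p) = zmon s * progeny p (y k)"
      using progeny_rec[of p "y k"] by (simp only: zmon_plus mult.assoc)
    finally show ?thesis by (simp add: s_def)
  qed
qed

end

section \<open>Laws of finite paths\<close>

primrec path_law :: "('d::finite \<Rightarrow> (nat ^ 'd) pmf) \<Rightarrow> nat ^ 'd \<Rightarrow> nat \<Rightarrow> (nat ^ 'd) list pmf" where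
  "path_law p x 0 = return_pmf [x]"
| "path_law p x (Suc k) = bind_pmf (path_law p x k) (\<lambda>ys. map_pmf (\<lambda>z. ys @ [z]) (next_generation p (last ys)))"

lemma length_path_law: "ys \<in> set_pmf (path_law p x k) \<Longrightarrow> length ys = Suc k"
  by (induction k arbitrary: ys) auto

lemma pmf_path_law_Suc:
  "pmf (path_law p x (Suc k)) (ys @ [z]) = pmf (path_law p x k) ys * pmf (next_generation p (last ys)) z"
proof -
  have eq: "pmf (map_pmf (\<lambda>z. zs @ [z]) (next_generation p (last zs))) (ys @ [z]) =
      indicator {ys} zs * pmf (next_generation p (last ys)) z" for zs
  proof (cases "zs = ys")
    case True
    have "inj (\<lambda>z. ys @ [z])" by (simp add: inj_def)
    from pmf_map_inj'[OF this] show ?thesis using True by simp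
  next
    case False
    then show ?thesis by (auto simp: pmf_eq_0_set_pmf)
  qed
  show ?thesis by (simp add: pmf_bind eq measure_pmf_single)
qed

lemma (in galton_watson) measure_cylinder:
  assumes "length ys = Suc k"
  shows "measure (P x) (cylinder x k ((!) ys)) = pmf (path_law p x k) ys"
  using assms
proof (induction k arbitrary: ys)
  case 0
  then obtain y where "ys = [y]" by (auto simp: length_Suc_conv)
  then show ?case by (simp add: measure_cylinder_0 indicator_def)
next
  case (Suc k)
  define zs where "zs = butlast ys"
  have "ys \<noteq> []" using Suc.prems by auto
  then have ys: "ys = zs @ [last ys]" "length zs = Suc k"
    using Suc.prems by (simp_all add: zs_def)
  have nth: "ys ! l = zs ! l" if "l \<le> k" for l
    using that ys by (metis le_imp_less_Suc nth_append)
  have "measure (P x) (cylinder x (Suc k) ((!) ys)) =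
      measure (P x) (cylinder x k ((!) ys)) * pmf (next_generation p (ys ! k)) (ys ! Suc k)"
    by (rule measure_cylinder_Suc)
  also have "cylinder x k ((!) ys) = cylinder x k ((!) zs)" by (rule cylinder_cong) (rule nth)
  also have "ys ! k = last zs"
    using nth[of k] ys(2) last_conv_nth[of zs] by (cases "zs = []") auto
  also have "ys ! Suc k = last ys"
    using \<open>ys \<noteq> []\<close> Suc.prems by (simp add: last_conv_nth)
  also have "measure (P x) (cylinder x k ((!) zs)) = pmf (path_law p x k) zs" by (rule Suc.IH[OF ys(2)])
  finally show ?case using ys(1) pmf_path_law_Suc[of p x k zs "last ys"] by simp
qed

text \<open>The conditional probability of total progeny \<open>m\<close> given the initial path \<open>ys\<close>.\<close>

definition path_weight :: "('d::finite \<Rightarrow> (nat ^ 'd) pmf) \<Rightarrow> nat ^ 'd \<Rightarrow> (nat ^ 'd) list \<Rightarrow> real" where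
  "path_weight p m ys = cf (zmon (sum_list (butlast ys)) * progeny p (last ys)) m"

lemma path_weight_nonneg: "path_weight p m ys \<ge> 0"
  unfolding path_weight_def cf_zmon_times by (simp add: progeny_nonneg)

context galton_watson
begin

definition path :: "nat \<Rightarrow> 'a \<Rightarrow> (nat ^ 'd) list" where
  "path k \<omega> = map (\<lambda>l. X l \<omega>) [0..<Suc k]"

lemma path_eq_iff: "length ys = Suc k \<Longrightarrow> path k \<omega> = ys \<longleftrightarrow> (\<forall>l\<le>k. X l \<omega> = ys ! l)"
  unfolding path_def list_eq_iff_nth_eq by (auto simp del: upt_Suc simp: less_Suc_eq_le)

lemma measurable_path_eq [measurable]: "Measurable.pred (P x) (\<lambda>\<omega>. path k \<omega> = ys)"
proof (cases "length ys = Suc k")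
  case True
  then show ?thesis unfolding path_eq_iff[OF True] by measurable
next
  case False
  then have "path k \<omega> \<noteq> ys" for \<omega> by (auto simp: path_def)
  then show ?thesis by simp
qed

lemma emeasure_path_aux:
  assumes [measurable]: "Measurable.pred (P x) Q"
  shows "emeasure (P x) {\<omega> \<in> space (P x). path k \<omega> \<in> B \<and> Q \<omega>} =
    (\<integral>\<^sup>+ys. emeasure (P x) {\<omega> \<in> space (P x). path k \<omega> = ys \<and> Q \<omega>} * indicator B ys \<partial>count_space UNIV)"
proof -
  have "{\<omega> \<in> space (P x). path k \<omega> \<in> B \<and> Q \<omega>} = (\<Union>ys\<in>B. {\<omega> \<in> space (P x). path k \<omega> = ys \<and> Q \<omega>})"
    by auto
  then have "emeasure (P x) {\<omega> \<in> space (P x). path k \<omega> \<in> B \<and> Q \<omega>} =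
      (\<integral>\<^sup>+ys. emeasure (P x) {\<omega> \<in> space (P x). path k \<omega> = ys \<and> Q \<omega>} \<partial>count_space B)"
    by (simp only:) (intro emeasure_UN_countable, auto simp: disjoint_family_on_def)
  then show ?thesis by (simp add: nn_integral_count_space_indicator)
qed

lemma emeasure_path:
  "emeasure (P x) {\<omega> \<in> space (P x). path k \<omega> \<in> B} = emeasure (measure_pmf (path_law p x k)) B"
proof -
  interpret prob_space "P x" by (rule prob_space_P)
  have "emeasure (P x) {\<omega> \<in> space (P x). path k \<omega> = ys} = ennreal (pmf (path_law p x k) ys)" for ys
  proof (cases "length ys = Suc k")
    case True
    then show ?thesis
      using measure_cylinder[OF True, of x] by (simp add: path_eq_iff cylinder_def emeasure_eq_measure)
  next
    case False
    then have "path k \<omega> \<noteq> ys" for \<omega> by (auto simp: path_def)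
    moreover have "pmf (path_law p x k) ys = 0"
      using False length_path_law by (auto simp: pmf_eq_0_set_pmf)
    ultimately show ?thesis by simp
  qed
  then have "emeasure (P x) {\<omega> \<in> space (P x). path k \<omega> \<in> B} =
      (\<integral>\<^sup>+ys. ennreal (pmf (path_law p x k) ys) * indicator B ys \<partial>count_space UNIV)"
    using emeasure_path_aux[where Q = "\<lambda>_. True" and x = x and k = k and B = B] by simp
  also have "\<dots> = (\<integral>\<^sup>+ys. indicator B ys \<partial>path_law p x k)"
    by (simp add: nn_integral_measure_pmf)
  finally show ?thesis by simp
qed

lemma emeasure_path_progeny:
  "emeasure (P x) {\<omega> \<in> space (P x). path k \<omega> \<in> B \<and> total_progeny X \<omega> = (\<chi> i. enat (m $ i))} =
    (\<integral>\<^sup>+ys. ennreal (pmf (path_law p x k) ys * path_weight p m ys) * indicator B ys \<partial>count_space UNIV)"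
proof -
  interpret prob_space "P x" by (rule prob_space_P)
  have "emeasure (P x) {\<omega> \<in> space (P x). path k \<omega> = ys \<and> total_progeny X \<omega> = (\<chi> i. enat (m $ i))} =
      ennreal (pmf (path_law p x k) ys * path_weight p m ys)" for ys
  proof (cases "length ys = Suc k")
    case True
    have "ys \<noteq> []" using True by auto
    then have "(\<Sum>l<k. ys ! l) = sum_list (butlast ys)" "ys ! k = last ys"
      using True by (auto simp: sum_list_sum_nth nth_butlast atLeast0LessThan last_conv_nth)
    then show ?thesis
      using joint_progeny[of x k "(!) ys" m] measure_cylinder[OF True, of x]
      by (simp add: path_eq_iff[OF True] emeasure_eq_measure path_weight_def)
  next
    case False
    then have "path k \<omega> \<noteq> ys" for \<omega> by (auto simp: path_def)
    moreover have "pmf (path_law p x k) ys = 0"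
      using False length_path_law by (auto simp: pmf_eq_0_set_pmf)
    ultimately show ?thesis by simp
  qed
  then show ?thesis
    using emeasure_path_aux[OF measurable_progeny, of x k B m] by simp
qed

end

subsection \<open>Exponential tilting\<close>

lemma monom_vec_plus: "monom_vec r (k + l) = monom_vec r k * monom_vec r l"
  by (simp add: monom_vec_def power_add prod.distrib)

lemma monom_vec_zero [simp]: "monom_vec r 0 = 1"
  by (simp add: monom_vec_def)

lemma monom_vec_axis: "monom_vec r (axis i 1) = r $ i"
proof -
  have "monom_vec r (axis i 1) = (\<Prod>j\<in>UNIV. if j = i then r $ i else 1)"
    unfolding monom_vec_def by (intro prod.cong) (auto simp: axis_def)
  then show ?thesis by simp
qed

lemma monom_vec_pos: "(\<And>i. r $ i > 0) \<Longrightarrow> monom_vec r k > 0"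
  unfolding monom_vec_def by (intro prod_pos) simp

locale tilted =
  fixes p :: "'d::finite \<Rightarrow> (nat ^ 'd) pmf" and a :: "real ^ 'd"
  assumes a_pos: "a $ i > 0" and gf_finite: "gen_fun_finite p a"
begin

abbreviation p' where "p' \<equiv> associated p a"

abbreviation f where "f \<equiv> gen_fun p a"

lemma f_pos: "f $ i > 0"
proof -
  obtain k where k: "k \<in> set_pmf (p i)" using set_pmf_not_empty[of "p i"] by blast
  have "sum (\<lambda>k. pmf (p i) k * monom_vec a k) {k} \<le> infsum (\<lambda>k. pmf (p i) k * monom_vec a k) UNIV"
    using gf_finite monom_vec_pos[of a, OF a_pos]
    by (intro finite_sum_le_infsum) (auto simp: gen_fun_finite_def less_imp_le)
  moreover have "pmf (p i) k * monom_vec a k > 0"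
    using k monom_vec_pos[of a, OF a_pos] by (simp add: pmf_positive)
  ultimately show ?thesis by (simp add: gen_fun_def)
qed

lemma pmf_p': "pmf (p' i) k * f $ i = monom_vec a k * pmf (p i) k"
  using associated_pmf[of a p i k, OF a_pos gf_finite] f_pos[of i] by simp

lemma pmf_p'_pos_iff: "pmf (p' i) k > 0 \<longleftrightarrow> pmf (p i) k > 0"
  using associated_pmf[of a p i k, OF a_pos gf_finite] f_pos[of i] monom_vec_pos[of a k, OF a_pos]
  by (simp add: zero_less_divide_iff zero_less_mult_iff)

text \<open>Each parent of type \<open>i\<close> contributes \<open>1 / f $ i\<close> and each child
  of type \<open>j\<close> contributes \<open>a $ j\<close>, so the density depends only on the two
  populations and not on who begot whom.\<close>

lemma next_generation_tilted:
  "pmf (next_generation p' x) z * monom_vec f x = monom_vec a z * pmf (next_generation p x) z"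
proof (induction x arbitrary: z rule: nat_vec_induct)
  case zero
  then show ?case by (simp add: indicator_def)
next
  case (add_axis x i)
  have "pmf (next_generation p' (x + axis i 1)) z * monom_vec f (x + axis i 1) =
      (\<Sum>k\<in>{..z}. (pmf (p' i) k * f $ i) * (pmf (next_generation p' x) (z - k) * monom_vec f x))"
    unfolding next_generation_add_axis pmf_conv_pmf monom_vec_plus monom_vec_axis
    by (simp add: sum_distrib_left sum_distrib_right mult_ac)
  also have "\<dots> = (\<Sum>k\<in>{..z}. monom_vec a (k + (z - k)) * (pmf (p i) k * pmf (next_generation p x) (z - k)))"
    unfolding pmf_p' add_axis monom_vec_plus by (simp add: mult_ac)
  also have "\<dots> = (\<Sum>k\<in>{..z}. monom_vec a z * (pmf (p i) k * pmf (next_generation p x) (z - k)))"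
    by (intro sum.cong refl) (simp add: vec_add_diff_inverse)
  also have "\<dots> = monom_vec a z * pmf (next_generation p (x + axis i 1)) z"
    unfolding next_generation_add_axis pmf_conv_pmf by (simp add: sum_distrib_left)
  finally show ?case .
qed

text \<open>In a finite tree all individuals act as parents, which gives the exponent
  \<open>m\<close> of \<open>f\<close>, and all but the ancestors \<open>x\<close> are children,
  which gives the exponent \<open>m - x\<close> of \<open>a\<close>.\<close>

lemma progeny_tilted:
  "cf (progeny p' x) m * monom_vec f m * monom_vec a x = monom_vec a m * cf (progeny p x) m"
proof (induction "size_vec m" arbitrary: m x rule: less_induct)
  case less
  show ?case
  proof (cases "x = 0 \<or> \<not> x \<le> m")
    case True
    have "cf (progeny q x) m = 0" if "\<not> x \<le> m" for q
      using that admissible_progeny[of q] by (auto simp: admissible_def)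
    then show ?thesis using True by (auto simp: cf_one)
  next
    case False
    define l where "l = m - x"
    have m: "m = x + l" using False by (simp add: l_def vec_add_diff_inverse)
    have "size_vec l < size_vec m" using False by (simp add: m zero_less_iff_neq_zero)
    note IH = less[OF this]
    have rec: "cf (progeny q x) m = (\<Sum>y\<in>{..l}. pmf (next_generation q x) y * cf (progeny q y) l)" for q
      using False by (subst progeny_rec) (simp add: cf_zmon_times cf_psum l_def)
    have "cf (progeny p' x) m * monom_vec f m * monom_vec a x =
        (\<Sum>y\<in>{..l}. (pmf (next_generation p' x) y * monom_vec f x) * (cf (progeny p' y) l * monom_vec f l)) * monom_vec a x"
      unfolding rec by (simp add: m monom_vec_plus sum_distrib_left sum_distrib_right mult_ac)
    also have "\<dots> = (\<Sum>y\<in>{..l}. pmf (next_generation p x) y * (cf (progeny p' y) l * monom_vec f l * monom_vec a y)) * monom_vec a x"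
      unfolding next_generation_tilted by (simp add: mult_ac)
    also have "\<dots> = monom_vec a m * cf (progeny p x) m"
      unfolding IH rec by (simp add: m monom_vec_plus sum_distrib_left sum_distrib_right mult_ac)
    finally show ?thesis .
  qed
qed

text \<open>The same count along a path: the last generation has not reproduced yet, hence
  \<open>butlast\<close>, and the first one has no parents, hence the factor for
  \<open>x\<close>.\<close>

lemma path_law_tilted:
  "length ys = Suc k \<Longrightarrow> pmf (path_law p' x k) ys * monom_vec f (sum_list (butlast ys)) * monom_vec a x =
    monom_vec a (sum_list ys) * pmf (path_law p x k) ys"
proof (induction k arbitrary: ys)
  case 0
  then obtain y where "ys = [y]" by (auto simp: length_Suc_conv)
  then show ?case by (simp add: indicator_def)
next
  case (Suc k)
  then have "ys \<noteq> []" by auto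
  then obtain zs z where ys: "ys = zs @ [z]" by (metis append_butlast_last_id)
  have len: "length zs = Suc k" using Suc.prems by (simp add: ys)
  then have "zs \<noteq> []" by auto
  then have zs: "sum_list zs = sum_list (butlast zs) + last zs"
    by (metis append_butlast_last_id sum_list.append sum_list_simps(1) sum_list.Cons sum_list.Nil add_0_right)
  have "pmf (path_law p' x (Suc k)) ys * monom_vec f (sum_list (butlast ys)) * monom_vec a x =
      (pmf (path_law p' x k) zs * monom_vec f (sum_list (butlast zs)) * monom_vec a x) *
      (pmf (next_generation p' (last zs)) z * monom_vec f (last zs))"
    unfolding ys pmf_path_law_Suc by (simp add: zs monom_vec_plus mult_ac)
  also have "\<dots> = monom_vec a (sum_list ys) * pmf (path_law p x (Suc k)) ys"
    unfolding Suc.IH[OF len] next_generation_tilted ys pmf_path_law_Suc by (simp add: monom_vec_plus mult_ac)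
  finally show ?case .
qed

text \<open>The factors of the last generation, children for the path and ancestors for the
  remaining tree, cancel. What remains is free of \<open>ys\<close>.\<close>

lemma joint_tilted:
  assumes "length ys = Suc k"
  shows "(pmf (path_law p' x k) ys * path_weight p' m ys) * (monom_vec f m * monom_vec a x) =
    monom_vec a m * (pmf (path_law p x k) ys * path_weight p m ys)"
proof (cases "sum_list (butlast ys) \<le> m")
  case True
  define s where "s = sum_list (butlast ys)"
  define l where "l = m - s"
  have m: "m = s + l" using True by (simp add: l_def s_def vec_add_diff_inverse)
  have "ys \<noteq> []" using assms by auto
  then have sum: "sum_list ys = s + last ys"
    unfolding s_def by (metis append_butlast_last_id sum_list.append sum_list.Cons sum_list.Nil add_0_right)
  have w: "path_weight q m ys = cf (progeny q (last ys)) l" for q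
    using True by (simp add: path_weight_def cf_zmon_times l_def s_def)
  have pos: "monom_vec a (last ys) > 0" by (rule monom_vec_pos) (rule a_pos)
  have "(pmf (path_law p' x k) ys * path_weight p' m ys) * (monom_vec f m * monom_vec a x) * monom_vec a (last ys) =
      (pmf (path_law p' x k) ys * monom_vec f s * monom_vec a x) * (cf (progeny p' (last ys)) l * monom_vec f l * monom_vec a (last ys))"
    unfolding w by (simp add: m monom_vec_plus mult_ac)
  also have "\<dots> = monom_vec a m * (pmf (path_law p x k) ys * path_weight p m ys) * monom_vec a (last ys)"
    unfolding s_def path_law_tilted[OF assms] progeny_tilted w
    by (simp add: sum m monom_vec_plus mult_ac)
  finally show ?thesis using pos by simp
qed (simp add: path_weight_def cf_zmon_times)

end

lemma next_generation_harmonic: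
  assumes "\<And>i j. integrable (measure_pmf (p i)) (\<lambda>k. real (k $ j))" and u: "\<And>i. u $ i \<ge> 0"
    and eigen: "\<And>i. (\<Sum>j\<in>UNIV. offspring_mean p i j * u $ j) = u $ i"
  shows "(\<integral>\<^sup>+z. ennreal (real_vec z \<bullet> u) \<partial>next_generation p x) = ennreal (real_vec x \<bullet> u)"
proof (induction x rule: nat_vec_induct)
  case (add_axis x i)
  have pos: "real_vec z \<bullet> u \<ge> 0" for z
    unfolding inner_vec_def using u by (simp add: sum_nonneg)
  have ax: "real_vec (axis i 1) \<bullet> u = u $ i"
    using sum_axis[of i "($) u"] by (simp add: inner_vec_def)
  have "(\<integral>\<^sup>+z. ennreal (real_vec z \<bullet> u) \<partial>next_generation p (x + axis i 1)) =
      (\<integral>\<^sup>+k. \<integral>\<^sup>+z. ennreal (real_vec k \<bullet> u) + ennreal (real_vec z \<bullet> u) \<partial>next_generation p x \<partial>p i)"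
    unfolding next_generation_add_axis
    by (simp add: conv_pmf_def nn_integral_pair_pmf' real_vec_plus inner_add_left pos)
  also have "\<dots> = (\<integral>\<^sup>+k. ennreal (real_vec k \<bullet> u) \<partial>p i) + ennreal (real_vec x \<bullet> u)"
    by (simp add: nn_integral_add add_axis)
  also have "(\<integral>\<^sup>+k. ennreal (real_vec k \<bullet> u) \<partial>p i) = ennreal (u $ i)"
    using nn_integral_offspring_sum[of p i "($) u", OF assms(1) u] by (simp add: inner_vec_def eigen)
  also have "ennreal (u $ i) + ennreal (real_vec x \<bullet> u) = ennreal (real_vec (x + axis i 1) \<bullet> u)"
    using u[of i] pos[of x] by (simp only: ennreal_plus[symmetric] real_vec_plus inner_add_left ax add.commute)
  finally show ?case .
qed simp

text \<open>The martingale property of the population weighted by \<open>u\<close>; it gives the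
  limiting path density total mass one.\<close>

lemma path_law_harmonic:
  assumes "\<And>i j. integrable (measure_pmf (p i)) (\<lambda>k. real (k $ j))" and u: "\<And>i. u $ i \<ge> 0"
    and eigen: "\<And>i. (\<Sum>j\<in>UNIV. offspring_mean p i j * u $ j) = u $ i"
  shows "(\<integral>\<^sup>+ys. ennreal (real_vec (last ys) \<bullet> u) \<partial>path_law p x k) = ennreal (real_vec x \<bullet> u)"
  by (induction k) (simp_all add: next_generation_harmonic[OF assms])

context galton_watson
begin

lemma distr_X_1: "distr (P (axis i 1)) (count_space UNIV) (X 1) = measure_pmf (p i)"
proof (rule measure_eqI_countable[of _ UNIV])
  let ?e = "axis i 1 :: nat ^ 'd"
  interpret prob_space "P ?e" by (rule prob_space_P)
  fix z :: "nat ^ 'd"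
  define y where "y l = (if l = 0 then ?e else z)" for l :: nat
  have "emeasure (distr (P ?e) (count_space UNIV) (X 1)) {z} = emeasure (P ?e) {\<omega> \<in> space (P ?e). X 1 \<omega> = z}"
  proof -
    have "X 1 -` {z} \<inter> space (P ?e) = {\<omega> \<in> space (P ?e). X 1 \<omega> = z}" by auto
    then show ?thesis using measurable_X[of 1 ?e] by (subst emeasure_distr) simp_all
  qed
  also have "\<dots> = emeasure (P ?e) (cylinder ?e 1 y)"
  proof (rule emeasure_eq_AE)
    show "AE \<omega> in P ?e. (\<omega> \<in> {\<omega> \<in> space (P ?e). X 1 \<omega> = z}) = (\<omega> \<in> cylinder ?e 1 y)"
      using start[of ?e] by eventually_elim (auto simp: cylinder_def y_def le_Suc_eq)
  qed auto
  also have "\<dots> = ennreal (pmf (p i) z)"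
    unfolding emeasure_eq_measure
    using measure_cylinder_Suc[of ?e 0 y] measure_cylinder_0[of ?e y] by (simp add: y_def)
  finally show "emeasure (distr (P ?e) (count_space UNIV) (X 1)) {z} = emeasure (measure_pmf (p i)) {z}"
    by (simp add: emeasure_pmf_single)
qed auto

lemma integrable_X_1_iff:
  "integrable (P (axis i 1)) (\<lambda>\<omega>. real (X 1 \<omega> $ j)) \<longleftrightarrow> integrable (measure_pmf (p i)) (\<lambda>k. real (k $ j))"
  unfolding distr_X_1[symmetric] using measurable_X[of 1 "axis i 1"] by (subst integrable_distr_eq) auto

lemma mean_matrix_eq: "mean_matrix P X $ i $ j = offspring_mean p i j"
  unfolding mean_matrix_def offspring_mean_def distr_X_1[symmetric]
  using measurable_X[of 1 "axis i 1"] by (subst integral_distr) auto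

definition path_mass :: "nat ^ 'd \<Rightarrow> nat \<Rightarrow> nat ^ 'd \<Rightarrow> (nat ^ 'd) list set \<Rightarrow> real" where
  "path_mass x k m B = measure (P x) {\<omega> \<in> space (P x). path k \<omega> \<in> B \<and> total_progeny X \<omega> = (\<chi> i. enat (m $ i))}"

lemma ennreal_path_mass:
  "ennreal (path_mass x k m B) =
    (\<integral>\<^sup>+ys. ennreal (pmf (path_law p x k) ys * path_weight p m ys) * indicator B ys \<partial>count_space UNIV)"
proof -
  interpret prob_space "P x" by (rule prob_space_P)
  show ?thesis unfolding path_mass_def emeasure_path_progeny[symmetric] emeasure_eq_measure ..
qed

lemma ennreal_path_mass':
  "ennreal (path_mass x k m B) = (\<integral>\<^sup>+ys. ennreal (path_weight p m ys * indicator B ys) \<partial>path_law p x k)"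
proof -
  have "ennreal (pmf (path_law p x k) ys * path_weight p m ys) * indicator B ys =
      ennreal (pmf (path_law p x k) ys) * ennreal (path_weight p m ys * indicator B ys)" for ys
    by (auto simp: ennreal_mult path_weight_nonneg indicator_def)
  then show ?thesis
    unfolding ennreal_path_mass by (simp add: nn_integral_measure_pmf)
qed

text \<open>Without a restriction on the path the time \<open>k\<close> is irrelevant, and at time
  zero the path law is a point mass.\<close>

lemma path_mass_UNIV: "path_mass x k m UNIV = cf (progeny p x) m"
proof -
  have "path_mass x k m UNIV = path_mass x 0 m UNIV" by (simp add: path_mass_def)
  moreover have "ennreal (path_mass x 0 m UNIV) = ennreal (cf (progeny p x) m)"
    unfolding ennreal_path_mass' by (simp add: path_weight_def)
  ultimately show ?thesis
    by (subst (asm) ennreal_inj) (auto simp: path_mass_def progeny_nonneg)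
qed

lemma path_mass_eq_expectation:
  "integrable (measure_pmf (path_law p x k)) (\<lambda>ys. path_weight p m ys * indicator B ys)"
  "path_mass x k m B = measure_pmf.expectation (path_law p x k) (\<lambda>ys. path_weight p m ys * indicator B ys)"
proof -
  show int: "integrable (measure_pmf (path_law p x k)) (\<lambda>ys. path_weight p m ys * indicator B ys)"
    by (rule integrableI_nonneg) (auto simp: path_weight_nonneg ennreal_path_mass'[symmetric])
  have "ennreal (path_mass x k m B) = ennreal (measure_pmf.expectation (path_law p x k) (\<lambda>ys. path_weight p m ys * indicator B ys))"
    unfolding ennreal_path_mass' by (rule nn_integral_eq_integral[OF int]) (simp add: path_weight_nonneg)
  then show "path_mass x k m B = measure_pmf.expectation (path_law p x k) (\<lambda>ys. path_weight p m ys * indicator B ys)"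
    by (subst (asm) ennreal_inj) (auto simp: path_mass_def path_weight_nonneg)
qed

end

text \<open>The constant is chosen before \<open>B\<close>, so it cancels in conditional
  probabilities.\<close>

lemma path_mass_tilted:
  assumes "galton_watson p P X" "galton_watson (associated p a) P' X'"
    and "\<And>i. a $ i > 0" "gen_fun_finite p a"
  shows "\<exists>c>0. \<forall>B. galton_watson.path_mass P X x k m B = c * galton_watson.path_mass P' X' x k m B"
proof -
  interpret T: tilted p a by unfold_locales (use assms in auto)
  interpret G: galton_watson p P X by fact
  interpret G': galton_watson "associated p a" P' X' by fact
  define c1 where "c1 = monom_vec T.f m * monom_vec a x"
  define c2 where "c2 = monom_vec a m"
  have c: "c1 > 0" "c2 > 0"
    unfolding c1_def c2_def using assms(3) T.f_pos by (auto intro!: mult_pos_pos monom_vec_pos)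
  have "G.path_mass x k m B = c1 / c2 * G'.path_mass x k m B" for B
  proof -
    have J: "ennreal c1 * (ennreal (pmf (path_law T.p' x k) ys * path_weight T.p' m ys) * indicator B ys) =
        ennreal c2 * (ennreal (pmf (path_law p x k) ys * path_weight p m ys) * indicator B ys)" for ys
    proof (cases "length ys = Suc k")
      case True
      have "ennreal (c1 * (pmf (path_law T.p' x k) ys * path_weight T.p' m ys)) =
          ennreal (c2 * (pmf (path_law p x k) ys * path_weight p m ys))"
        using T.joint_tilted[OF True, of x m] by (simp add: c1_def c2_def mult_ac)
      then have "ennreal c1 * ennreal (pmf (path_law T.p' x k) ys * path_weight T.p' m ys) =
          ennreal c2 * ennreal (pmf (path_law p x k) ys * path_weight p m ys)"
        using c by (simp only: ennreal_mult path_weight_nonneg mult_nonneg_nonneg pmf_nonneg less_imp_le)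
      then show ?thesis by (simp only: mult.assoc[symmetric])
    next
      case False
      then have "pmf (path_law q x k) ys = 0" for q
        using length_path_law by (auto simp: pmf_eq_0_set_pmf)
      then show ?thesis by simp
    qed
    have "ennreal (c1 * G'.path_mass x k m B) = ennreal (c2 * G.path_mass x k m B)"
    proof -
      have "ennreal (c1 * G'.path_mass x k m B) = ennreal c1 * ennreal (G'.path_mass x k m B)"
        using c by (intro ennreal_mult) (auto simp: G'.path_mass_def)
      also have "\<dots> = (\<integral>\<^sup>+ys. ennreal c1 *
          (ennreal (pmf (path_law T.p' x k) ys * path_weight T.p' m ys) * indicator B ys) \<partial>count_space UNIV)"
        unfolding G'.ennreal_path_mass by (rule nn_integral_cmult[symmetric]) simp
      also have "\<dots> = (\<integral>\<^sup>+ys. ennreal c2 *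
          (ennreal (pmf (path_law p x k) ys * path_weight p m ys) * indicator B ys) \<partial>count_space UNIV)"
        by (simp only: J)
      also have "\<dots> = ennreal c2 * ennreal (G.path_mass x k m B)"
        unfolding G.ennreal_path_mass by (rule nn_integral_cmult) simp
      also have "\<dots> = ennreal (c2 * G.path_mass x k m B)"
        using c by (intro ennreal_mult[symmetric]) (auto simp: G.path_mass_def)
      finally show ?thesis .
    qed
    then have "c1 * G'.path_mass x k m B = c2 * G.path_mass x k m B"
      using c by (subst (asm) ennreal_inj) (auto simp: G.path_mass_def G'.path_mass_def)
    then show ?thesis using c by (simp add: field_simps)
  qed
  then show ?thesis using c by (intro exI[of _ "c1 / c2"]) auto
qed

text \<open>A nonzero entry of a power contains a path of nonzero entries. Reachability depends only
  on which entries vanish, and so can be carried over to the tilted process.\<close>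

lemma mat_power_reachable:
  assumes "mat_power A n $ i $ j \<noteq> 0"
  shows "(i, j) \<in> {(i, j). A $ i $ j \<noteq> 0}\<^sup>*"
  using assms
proof (induction n arbitrary: i)
  case 0
  then show ?case by (auto simp: mat_def split: if_splits)
next
  case (Suc n)
  then have "(\<Sum>k\<in>UNIV. A $ i $ k * mat_power A n $ k $ j) \<noteq> 0"
    by (simp add: matrix_matrix_mult_def)
  then obtain k where "A $ i $ k * mat_power A n $ k $ j \<noteq> 0"
    by (meson sum.not_neutral_contains_not_neutral)
  then have "(i, k) \<in> {(i, j). A $ i $ j \<noteq> 0}" "mat_power A n $ k $ j \<noteq> 0" by auto
  then show ?case using Suc.IH by (meson converse_rtrancl_into_rtrancl)
qed

lemma finite_moments_imp_sq:
  assumes "finite_moments (CARD('d) + 1) D"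
  shows "integrable (measure_pmf D) (\<lambda>k :: nat ^ 'd::finite. (real (size_vec k))\<^sup>2)"
proof (rule Bochner_Integration.integrable_bound)
  let ?d = "CARD('d)"
  show "integrable (measure_pmf D) (\<lambda>k. (real ?d)\<^sup>2 * (1 + norm (real_vec k) ^ (?d + 1)))"
    using assms by (simp add: finite_moments_def)
  show "AE k in measure_pmf D. norm ((real (size_vec k))\<^sup>2) \<le> norm ((real ?d)\<^sup>2 * (1 + norm (real_vec k) ^ (?d + 1)))"
  proof (rule AE_I2)
    fix k :: "nat ^ 'd"
    let ?n = "norm (real_vec k)"
    have "real (k $ i) \<le> ?n" for i
      using component_le_norm_cart[of "real_vec k" i] by simp
    then have "real (size_vec k) \<le> (\<Sum>i\<in>(UNIV :: 'd set). ?n)"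
      unfolding size_vec_def of_nat_sum by (intro sum_mono)
    then have "(real (size_vec k))\<^sup>2 \<le> (real ?d * ?n)\<^sup>2"
      by (intro power_mono) auto
    also have "\<dots> = (real ?d)\<^sup>2 * ?n\<^sup>2" by (simp add: power_mult_distrib)
    also have "?n\<^sup>2 \<le> 1 + ?n ^ (?d + 1)"
    proof (cases "?n \<le> 1")
      case True
      then have "?n\<^sup>2 \<le> 1" by (simp add: power_le_one)
      moreover have "?n ^ (?d + 1) \<ge> 0" by simp
      ultimately show ?thesis by linarith
    next
      case False
      have "2 \<le> ?d + 1" using zero_less_card_finite[where 'a = 'd] by linarith
      then have "?n\<^sup>2 \<le> ?n ^ (?d + 1)" using False by (intro power_increasing) auto
      then show ?thesis by simp
    qed
    finally show "norm ((real (size_vec k))\<^sup>2) \<le> norm ((real ?d)\<^sup>2 * (1 + ?n ^ (?d + 1)))"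
      by (simp add: mult_left_mono)
  qed
qed simp

lemma floor_vec_diff_bound:
  assumes "\<And>i. v $ i > 0"
  shows "\<bar>real ((floor_vec (real n *\<^sub>R v) - s) $ i) - real n * v $ i\<bar> \<le> 1 + real (s $ i)"
proof -
  have "\<bar>real (nat \<lfloor>real n * v $ i\<rfloor>) - real n * v $ i\<bar> \<le> 1"
    using assms[of i] by (simp add: of_nat_nat) linarith
  \<comment> \<open>Subtraction on naturals truncates: if \<open>c > b\<close> the difference is 0,
    and the bound holds since \<open>y \<le> b + 1\<close>.\<close>
  moreover have "\<bar>real (b - c) - y\<bar> \<le> 1 + real c" if "\<bar>real b - y\<bar> \<le> 1" "y \<ge> 0" for b c :: nat and y
    using that by (cases "c \<le> b") (auto simp: of_nat_diff abs_le_iff)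
  ultimately show ?thesis
    using assms[of i] by (simp add: floor_vec_def)
qed

lemma eventually_le_floor_vec:
  assumes "\<And>i. v $ i > 0"
  shows "\<forall>\<^sub>F n in sequentially. s \<le> floor_vec (real n *\<^sub>R v)"
proof -
  have "\<forall>\<^sub>F n in sequentially. s $ i \<le> nat \<lfloor>real n * v $ i\<rfloor>" for i
  proof -
    have "filterlim (\<lambda>n. real n * v $ i) at_top sequentially"
      using assms[of i] by real_asymp
    then have "\<forall>\<^sub>F n in sequentially. real (s $ i) \<le> real n * v $ i"
      by (simp add: filterlim_at_top)
    then show ?thesis by eventually_elim (simp add: le_nat_iff le_floor_iff)
  qed
  then have "\<forall>\<^sub>F n in sequentially. \<forall>i. s $ i \<le> nat \<lfloor>real n * v $ i\<rfloor>"
    by (rule eventually_all_finite)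
  then show ?thesis by (simp add: less_eq_vec_def floor_vec_def)
qed

subsection \<open>Conditioning on the total progeny\<close>

theorem theorem3:
  fixes p :: "'d::finite \<Rightarrow> (nat ^ 'd) pmf"
    and P :: "nat ^ 'd \<Rightarrow> 'a measure" and X :: "nat \<Rightarrow> 'a \<Rightarrow> nat ^ 'd"
    and a :: "real ^ 'd"
    and P' :: "nat ^ 'd \<Rightarrow> 'b measure" and X' :: "nat \<Rightarrow> 'b \<Rightarrow> nat ^ 'd"
    and u v :: "real ^ 'd"
    and x\<^sub>0 :: "nat ^ 'd" and j :: nat and k :: "nat \<Rightarrow> nat" and x :: "nat \<Rightarrow> nat ^ 'd"
  assumes "galton_watson p P X"
    and "finite_means P X"
    and "nonsingular p P X"
    and "positive_regular P X"
    and "\<forall>i. extinction_prob P X $ i > 0"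
    and "\<forall>i. a $ i > 0"
    and "gen_fun_finite p a"
    and "galton_watson (associated p a) P' X'"
    and "critical P' X'"
    and "\<forall>l. \<exists>i m. pmf (p i) m > 0 \<and> pmf (p i) (m + axis l 1) > 0"
    and "\<forall>i. finite_moments (CARD('d) + 1) (associated p a i)"
    and "\<forall>i. positive_definite (covariance_matrix (associated p a i))"
    and "perron_eigenvectors (mean_matrix P' X') 1 u v"
    and "x\<^sub>0 \<noteq> 0"
    and "j \<ge> 1"
    and "mono_on {1..j} k"
  shows "(\<lambda>n::nat. \<P>(\<omega> in P x\<^sub>0. (\<forall>l\<in>{1..j}. X (k l) \<omega> = x l) \<bar>
             total_progeny X \<omega> = (\<chi> i. enat (floor_vec (real n *\<^sub>R v) $ i))))
         \<longlonglongrightarrow> (real_vec (x j) \<bullet> u) / (real_vec x\<^sub>0 \<bullet> u) *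
             \<P>(\<omega> in P' x\<^sub>0. \<forall>l\<in>{1..j}. X' (k l) \<omega> = x l)"
proof -
  interpret G: galton_watson p P X by fact
  interpret G': galton_watson "associated p a" P' X' by fact
  interpret T: tilted p a by unfold_locales (use assms in auto)
  define p' where "p' = associated p a"
  define K where "K = k j"
  \<comment> \<open>Paths are recorded up to the last observed time \<open>K = k j\<close>; by
    monotonicity of \<open>k\<close> all the indices \<open>k l\<close> lie within the list.\<close>
  define B where "B = {ys :: (nat ^ 'd) list. \<forall>l\<in>{1..j}. ys ! k l = x l}"
  define m where "m n = floor_vec (real n *\<^sub>R v)" for n :: nat
  have u_pos: "u $ i > 0" and v_pos: "v $ i > 0" for i
    using assms(13) by (auto simp: perron_eigenvectors_def)
  have sq: "integrable (measure_pmf (p' i)) (\<lambda>k. (real (size_vec k))\<^sup>2)" for i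
    using assms(11) by (auto simp: p'_def intro: finite_moments_imp_sq)
  have int': "integrable (measure_pmf (p' i)) (\<lambda>k. real (k $ l))" for i l
    by (rule integrable_real_if_sq[OF sq])
  have int: "integrable (measure_pmf (p i)) (\<lambda>k. real (k $ l))" for i l
    using assms(2) unfolding finite_means_def G.integrable_X_1_iff by blast
  have eigen: "(\<Sum>l\<in>UNIV. offspring_mean p' i l * u $ l) = u $ i" for i
  proof -
    have "(mean_matrix P' X' *v u) $ i = u $ i"
      using assms(13) by (simp add: perron_eigenvectors_def)
    then show ?thesis by (simp add: matrix_vector_mult_def G'.mean_matrix_eq p'_def)
  qed
  have crit: "critical_offspring p' u v"
  proof
    show "(\<Sum>i\<in>UNIV. v $ i * offspring_mean p' i l) = v $ l" for l
    proof -
      have "(v v* mean_matrix P' X') $ l = v $ l"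
        using assms(13) by (simp add: perron_eigenvectors_def)
      then show ?thesis by (simp add: vector_matrix_mult_def G'.mean_matrix_eq p'_def mult.commute)
    qed
    show "(i, l) \<in> {(i, j). offspring_mean p' i j > 0}\<^sup>*" for i l
    proof -
      obtain n where "mat_power (mean_matrix P X) n $ i $ l > 0"
        using assms(4) unfolding positive_regular_def by blast
      then have "(i, l) \<in> {(i, j). mean_matrix P X $ i $ j \<noteq> 0}\<^sup>*"
        by (intro mat_power_reachable[of _ n]) auto
      \<comment> \<open>Tilting changes the means but not the supports; with finite means on both
        sides, a mean is positive exactly if some vector of the support has a child of that
        type.\<close>
      also have "{(i, j). mean_matrix P X $ i $ j \<noteq> 0} = {(i, j). offspring_mean p' i j > 0}"
      proof -
        have "mean_matrix P X $ i $ j \<noteq> 0 \<longleftrightarrow> offspring_mean p i j > 0" for i j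
          using offspring_mean_nonneg[of p i j] by (simp add: G.mean_matrix_eq less_le)
        moreover have "set_pmf (p' i) = set_pmf (p i)" for i
          using T.pmf_p'_pos_iff[of i] by (auto simp: p'_def pmf_positive_iff[symmetric])
        ultimately show ?thesis
          by (simp add: offspring_mean_pos_iff int int')
      qed
      finally show ?thesis .
    qed
    show "\<exists>i m. pmf (p' i) m > 0 \<and> pmf (p' i) (m + axis l 1) > 0" for l
      using assms(10) unfolding p'_def T.pmf_p'_pos_iff by blast
  qed (fact sq u_pos v_pos eigen)+
  interpret C: critical_offspring p' u v by fact
  obtain L where L: "L > 0" and asymp:
    "\<And>x m. (\<And>i. \<exists>B. \<forall>\<^sub>F n in sequentially. \<bar>real (m n $ i) - real n * v $ i\<bar> \<le> B) \<Longrightarrow>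
      (\<lambda>n. sqrt (real n) ^ CARD('d) * real n * cf (progeny p' x) (m n)) \<longlonglongrightarrow> L * (real_vec x \<bullet> u)"
    using C.progeny_asymptotics by blast
  have u_inner: "real_vec y \<bullet> u \<ge> 0" for y :: "nat ^ 'd"
    unfolding inner_vec_def using u_pos by (auto intro!: sum_nonneg simp: less_imp_le)
  have x\<^sub>0: "real_vec x\<^sub>0 \<bullet> u > 0"
  proof -
    obtain i where "x\<^sub>0 $ i \<noteq> 0" using assms(14) by (auto simp: vec_eq_iff)
    then show ?thesis
      unfolding inner_vec_def using u_pos
      by (intro sum_pos2[of _ i]) (auto simp: less_imp_le)
  qed

  define g where "g n = cf (progeny p' x\<^sub>0) (m n)" for n
  \<comment> \<open>For \<open>g n > 0\<close> this is the density, with respect to the law of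
    critical paths, of the path law conditioned on total progeny \<open>m n\<close>. Its limit
    \<open>hlim\<close> is the density of the Doob transform by the harmonic function of
    \<open>u\<close>.\<close>
  define h where "h n ys = path_weight p' (m n) ys / g n" for n ys
  define hlim where "hlim ys = (real_vec (last ys) \<bullet> u) / (real_vec x\<^sub>0 \<bullet> u)" for ys :: "(nat ^ 'd) list"
  let ?L = "path_law p' x\<^sub>0 K"
  let ?E = "measure_pmf.expectation ?L"
  have h_lim: "(\<lambda>n. h n ys) \<longlonglongrightarrow> hlim ys" for ys
  proof -
    define s where "s = sum_list (butlast ys)"
    let ?c = "\<lambda>n. sqrt (real n) ^ CARD('d) * real n"
    have bd: "\<exists>B. \<forall>\<^sub>F n in sequentially. \<bar>real ((m n - s) $ i) - real n * v $ i\<bar> \<le> B" for s i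
      using floor_vec_diff_bound[OF v_pos] unfolding m_def by (blast intro: always_eventually)
    have "(\<lambda>n. ?c n * cf (progeny p' (last ys)) (m n - s)) \<longlonglongrightarrow> L * (real_vec (last ys) \<bullet> u)"
      by (rule asymp) (rule bd)
    moreover have "(\<lambda>n. ?c n * g n) \<longlonglongrightarrow> L * (real_vec x\<^sub>0 \<bullet> u)"
      unfolding g_def by (rule asymp) (use bd[of 0] in simp)
    ultimately have "(\<lambda>n. (?c n * cf (progeny p' (last ys)) (m n - s)) / (?c n * g n)) \<longlonglongrightarrow>
        (L * (real_vec (last ys) \<bullet> u)) / (L * (real_vec x\<^sub>0 \<bullet> u))"
      by (rule tendsto_divide) (use L x\<^sub>0 in simp)
    also have "(L * (real_vec (last ys) \<bullet> u)) / (L * (real_vec x\<^sub>0 \<bullet> u)) = hlim ys"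
      using L by (simp add: hlim_def)
    finally show ?thesis
    proof (rule Lim_transform_eventually)
      show "\<forall>\<^sub>F n in sequentially. ?c n * cf (progeny p' (last ys)) (m n - s) / (?c n * g n) = h n ys"
        using eventually_le_floor_vec[OF v_pos, of s] eventually_gt_at_top[of 0]
        by eventually_elim (simp add: h_def path_weight_def cf_zmon_times s_def m_def)
    qed
  qed
  have hlim_nonneg: "hlim ys \<ge> 0" for ys
    using u_inner x\<^sub>0 by (simp add: hlim_def)
  have g_nonneg: "g n \<ge> 0" for n by (simp add: g_def progeny_nonneg)
  have h_nonneg: "h n ys \<ge> 0" for n ys
    by (simp add: h_def path_weight_nonneg g_nonneg)
  have mass_hlim: "(\<integral>\<^sup>+ys. ennreal (hlim ys) \<partial>?L) = 1"
  proof -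
    have "(\<integral>\<^sup>+ys. ennreal (hlim ys) \<partial>?L) =
        (\<integral>\<^sup>+ys. ennreal (real_vec (last ys) \<bullet> u) / ennreal (real_vec x\<^sub>0 \<bullet> u) \<partial>?L)"
      unfolding hlim_def using u_inner x\<^sub>0 by (simp add: divide_ennreal)
    also have "\<dots> = ennreal (real_vec x\<^sub>0 \<bullet> u) / ennreal (real_vec x\<^sub>0 \<bullet> u)"
      by (subst nn_integral_divide)
         (simp_all add: path_law_harmonic[OF int' less_imp_le[OF u_pos] eigen])
    finally show ?thesis using x\<^sub>0 by (simp add: ennreal_divide_self)
  qed
  have int_hlim: "integrable (measure_pmf ?L) hlim"
    by (rule integrableI_nonneg) (auto simp: mass_hlim hlim_nonneg)
  have int_w: "integrable (measure_pmf ?L) (\<lambda>ys. path_weight p' (m n) ys * indicator C ys)" for n C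
    unfolding p'_def by (rule G'.path_mass_eq_expectation(1))
  have int_h: "integrable (measure_pmf ?L) (h n)" for n
    using int_w[of n UNIV] by (simp add: h_def[abs_def])
  \<comment> \<open>An inequality, because for small \<open>n\<close> the probability
    \<open>g n\<close> may vanish, and then \<open>h n\<close> is zero. Scheffe's lemma asks for no
    more than this bound.\<close>
  have mass: "?E (h n) \<le> 1" for n
  proof -
    have "?E (\<lambda>ys. path_weight p' (m n) ys) = g n"
      using G'.path_mass_eq_expectation(2)[of x\<^sub>0 K "m n" UNIV] G'.path_mass_UNIV[of x\<^sub>0 K "m n"]
      by (simp add: g_def p'_def)
    then show ?thesis by (simp add: h_def[abs_def])
  qed
  have "(\<lambda>n. \<integral>\<^sup>+ys. ennreal (norm (h n ys - hlim ys)) \<partial>?L) \<longlonglongrightarrow> 0"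
  proof (rule Scheffe_lemma2)
    fix n
    have "(\<integral>\<^sup>+ys. ennreal (norm (h n ys)) \<partial>?L) = ennreal (?E (h n))"
      using h_nonneg int_h by (simp add: nn_integral_eq_integral)
    also have "\<dots> \<le> ennreal 1" by (intro ennreal_leI mass)
    also have "\<dots> = (\<integral>\<^sup>+ys. ennreal (norm (hlim ys)) \<partial>?L)"
      using hlim_nonneg by (simp add: mass_hlim)
    finally show "(\<integral>\<^sup>+ys. ennreal (norm (h n ys)) \<partial>?L) \<le>
        (\<integral>\<^sup>+ys. ennreal (norm (hlim ys)) \<partial>?L)" .
  qed (use int_hlim h_lim in auto)
  then have L1: "(\<lambda>n. ?E (\<lambda>ys. norm (h n ys - hlim ys))) \<longlonglongrightarrow> 0"
    using int_h int_hlim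
    by (intro tendsto_ennrealD, subst nn_integral_eq_integral[symmetric]) auto
  \<comment> \<open>Convergence in L1 passes to every set of paths, in particular to the infinite
    sets \<open>B\<close> that leave some times unobserved.\<close>
  have lim: "(\<lambda>n. ?E (\<lambda>ys. h n ys * indicator B ys)) \<longlonglongrightarrow>
      ?E (\<lambda>ys. hlim ys * indicator B ys)"
  proof (rule LIM_zero_cancel, rule Lim_null_comparison[OF always_eventually L1], rule allI)
    fix n
    have i1: "integrable (measure_pmf ?L) (\<lambda>ys. f ys * indicator B ys)"
      if "integrable (measure_pmf ?L) f" for f :: "(nat ^ 'd) list \<Rightarrow> real"
      using that by (intro integrable_real_mult_indicator) auto
    have "norm (?E (\<lambda>ys. h n ys * indicator B ys) -
        ?E (\<lambda>ys. hlim ys * indicator B ys)) =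
        norm (?E (\<lambda>ys. (h n ys - hlim ys) * indicator B ys))"
      using i1[OF int_h] i1[OF int_hlim] by (simp add: left_diff_distrib)
    also have "\<dots> \<le> ?E (\<lambda>ys. norm (h n ys - hlim ys))"
      using i1[of "\<lambda>ys. h n ys - hlim ys"] int_h[of n] int_hlim
      by (intro order_trans[OF integral_norm_bound] integral_mono integrable_norm)
         (auto simp: abs_mult mult_left_le)
    finally show "norm (?E (\<lambda>ys. h n ys * indicator B ys) -
        ?E (\<lambda>ys. hlim ys * indicator B ys)) \<le>
        ?E (\<lambda>ys. norm (h n ys - hlim ys))" .
  qed

  have k_le: "k l \<le> K" if "l \<in> {1..j}" for l
    using assms(15,16) that by (auto simp: K_def mono_on_def)
  have path_B: "G.path K \<omega> \<in> B \<longleftrightarrow> (\<forall>l\<in>{1..j}. X (k l) \<omega> = x l)" for \<omega>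
    unfolding B_def G.path_def using k_le by (auto simp del: upt_Suc simp: less_Suc_eq_le)
  have path_B': "G'.path K \<omega> \<in> B \<longleftrightarrow> (\<forall>l\<in>{1..j}. X' (k l) \<omega> = x l)" for \<omega>
    unfolding B_def G'.path_def using k_le by (auto simp del: upt_Suc simp: less_Suc_eq_le)
  \<comment> \<open>If the conditioning event is null, division by zero makes both sides 0, so the
    identity holds for all \<open>n\<close>.\<close>
  have cond: "\<P>(\<omega> in P x\<^sub>0. (\<forall>l\<in>{1..j}. X (k l) \<omega> = x l) \<bar>
      total_progeny X \<omega> = (\<chi> i. enat (m n $ i))) =
      ?E (\<lambda>ys. h n ys * indicator B ys)" for n
  proof -
    obtain c where c: "c > 0" "\<And>C. G.path_mass x\<^sub>0 K (m n) C = c * G'.path_mass x\<^sub>0 K (m n) C"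
      using path_mass_tilted[OF assms(1,8) T.a_pos T.gf_finite] by metis
    have "\<P>(\<omega> in P x\<^sub>0. (\<forall>l\<in>{1..j}. X (k l) \<omega> = x l) \<bar> total_progeny X \<omega> = (\<chi> i. enat (m n $ i))) =
        G.path_mass x\<^sub>0 K (m n) B / G.path_mass x\<^sub>0 K (m n) UNIV"
      unfolding cond_prob_def G.path_mass_def by (simp add: path_B)
    also have "\<dots> = G'.path_mass x\<^sub>0 K (m n) B / g n"
      using c G'.path_mass_UNIV[of x\<^sub>0 K "m n"] by (simp add: g_def p'_def)
    also have "\<dots> = ?E (\<lambda>ys. path_weight p' (m n) ys * indicator B ys) / g n"
      using G'.path_mass_eq_expectation(2)[of x\<^sub>0 K "m n" B] by (simp add: p'_def)
    also have "\<dots> = ?E (\<lambda>ys. h n ys * indicator B ys)"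
      by (simp add: h_def)
    finally show ?thesis .
  qed
  have "?E (\<lambda>ys. hlim ys * indicator B ys) =
      ?E (\<lambda>ys. (real_vec (x j) \<bullet> u) / (real_vec x\<^sub>0 \<bullet> u) * indicator B ys)"
  proof (intro integral_cong_AE AE_pmfI)
    fix ys assume "ys \<in> set_pmf ?L"
    then have "length ys = Suc K" by (rule length_path_law)
    then have "ys ! K = last ys" by (cases "ys = []") (auto simp: last_conv_nth)
    \<comment> \<open>The last observation is made at the final time \<open>K\<close>, so on
      \<open>B\<close> the factor \<open>hlim\<close> is constant and leaves the
      expectation.\<close>
    then have "last ys = x j" if "ys \<in> B"
      using that assms(15) by (auto simp: B_def K_def)
    then show "hlim ys * indicator B ys = (real_vec (x j) \<bullet> u) / (real_vec x\<^sub>0 \<bullet> u) * indicator B ys"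
      by (auto simp: hlim_def indicator_def)
  qed auto
  also have "\<dots> = (real_vec (x j) \<bullet> u) / (real_vec x\<^sub>0 \<bullet> u) * measure (measure_pmf ?L) B"
    by simp
  also have "measure (measure_pmf ?L) B = \<P>(\<omega> in P' x\<^sub>0. \<forall>l\<in>{1..j}. X' (k l) \<omega> = x l)"
    using G'.emeasure_path[of x\<^sub>0 K B] by (simp add: measure_def path_B' p'_def)
  finally have "?E (\<lambda>ys. hlim ys * indicator B ys) =
      (real_vec (x j) \<bullet> u) / (real_vec x\<^sub>0 \<bullet> u) * \<P>(\<omega> in P' x\<^sub>0. \<forall>l\<in>{1..j}. X' (k l) \<omega> = x l)" .
  with lim show ?thesis unfolding cond[symmetric] m_def by (simp only:)
qed

end
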